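(* Let $K$ be polynomial in the input. For each $\mathcal{X}\in\{\mathcal{X}_c,\mathcal{X}_d\}$ and $\mathcal{Y}\in\{\mathcal{Y}_c,\mathcal{Y}_d\}$, the decision problem Bounded-$K$-Adaptability$(\mathcal{X},\mathcal{U}_d(x),\mathcal{Y})$ is in $\Sigma_2^p$.
   Context: An instance consists of rational data encoded in binary: a bound $R\in\mathbb{Z}_+$, vectors $a\in\mathbb{Q}^{m_x}$, $b\in\mathbb{Q}^{m_u}$, matrices $A\in\mathbb{Q}^{m_x\times n_x}$, $W\in\mathbb{Q}^{m_y\times n_y}$, an $m_u\times n_u$ matrix $B(x)$ whose entries depend linearly on $x$ with rational coefficients, and an $m_y\times n_x$ matrix $T(u)$ whose entries depend linearly on $u$ with rational coefficients. The sets are $\mathcal{X}_c=\{x\in[0,R]^{n_x}: Ax\le a\}$, $\mathcal{X}_d=\mathcal{X}_c\cap\mathbb{Z}^{n_x}$, $\mathcal{U}_d(x)=\{u\in[0,R]^{n_u}\cap\mathbb{Z}^{n_u}: B(x)u\le b\}$, $\mathcal{Y}_c(x,u)=\{y\in[0,R]^{n_y}: T(u)x+Wy\le 0\}$, $\mathcal{Y}_d(x,u)=\mathcal{Y}_c(x,u)\cap\mathbb{Z}^{n_y}$. Bounded-$K$-Adaptability$(\mathcal{X},\mathcal{U}_d(x),\mathcal{Y})$ is the decision problem $$\exists x\in\mathcal{X},\ y^1,\dots,y^K\in\mathbb{R}^{n_y}\ \ \forall u\in\mathcal{U}_d(x):\ \{y^1,\dots,y^K\}\cap\mathcal{Y}(x,u)\neq\emptyset\,?$$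 Here $K$ is given by a (polynomial-time computable) function of the input, the function itself not being part of the input; "$K$ is polynomial in the input" means that $K$ is bounded by a polynomial in the encoding length of the instance (this includes constant $K$). $\Sigma_2^p$ is the class of problems expressible as $\exists X\,\forall Y: P(I,X,Y)$, where $I$ is the instance, $X,Y$ range over objects of encoding length polynomial in that of $I$, and $P$ is decidable in polynomial time. *)

theory Defs
  imports
    "Jordan_Normal_Form.Matrix"
    "HOL-Computational_Algebra.Polynomial"
    Complex_Main
begin

section \<open>Deterministic multi-tape Turing machines\<close>

text \<open>
  The tape alphabet is blank, 0, 1, with \<^const>\<open>None\<close> as the blank.  Tapes are infinite in both
  directions; a tape is its contents together with the head position.
\<close>

type_synonym sym = "bool option"
type_synonym tape = "(int \<Rightarrow> sym) \<times> int"

datatype dir = MoveLeft | Stay | MoveRight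

fun offset :: "dir \<Rightarrow> int" where
  "offset MoveLeft = -1"
| "offset Stay = 0"
| "offset MoveRight = 1"

text \<open>
  The non-halting states are the numbers below \<open>num_states\<close>, and 0 is the start state (if
  \<open>num_states\<close> is positive).  Every number from \<open>num_states\<close> on is a halting state.  Hence only the
  finite part of \<open>delta\<close> on states below \<open>num_states\<close> and on symbol lists of length \<open>num_tapes\<close>
  matters.  Tape 0 is the input tape and tape 1 the output tape; all tapes may be written.
\<close>

record tm =
  num_tapes :: nat
  num_states :: nat
  delta :: "nat \<Rightarrow> sym list \<Rightarrow> nat \<times> (sym \<times> dir) list"

definition turing_machine :: "tm \<Rightarrow> bool" where
  "turing_machine M \<longleftrightarrow> num_tapes M \<ge> 2 \<and>
     (\<forall>q < num_states M. \<forall>ss. length ss = num_tapes M \<longrightarrow>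
        length (snd (delta M q ss)) = num_tapes M)"

type_synonym config = "nat \<times> tape list"

definition read_sym :: "tape \<Rightarrow> sym" where
  "read_sym t = fst t (snd t)"

definition act :: "sym \<times> dir \<Rightarrow> tape \<Rightarrow> tape" where
  "act a t = ((fst t)(snd t := fst a), snd t + offset (snd a))"

definition step :: "tm \<Rightarrow> config \<Rightarrow> config" where
  "step M c =
     (if fst c < num_states M
      then (let r = delta M (fst c) (map read_sym (snd c))
            in (fst r, map2 act (snd r) (snd c)))
      else c)"

definition blank_tape :: tape where
  "blank_tape = (\<lambda>_. None, 0)"

definition input_tape :: "bool list \<Rightarrow> tape" where
  "input_tape w = (\<lambda>i. if 0 \<le> i \<and> i < int (length w) then Some (w ! nat i) else None, 0)"

definition start_config :: "tm \<Rightarrow> bool list \<Rightarrow> config" where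
  "start_config M w = (0, input_tape w # replicate (num_tapes M - 1) blank_tape)"

definition tape_holds :: "tape \<Rightarrow> bool list \<Rightarrow> bool" where
  "tape_holds t v \<longleftrightarrow>
     (\<forall>i < length v. fst t (int i) = Some (v ! i)) \<and> fst t (int (length v)) = None"

definition computes_within :: "tm \<Rightarrow> bool list \<Rightarrow> bool list \<Rightarrow> nat \<Rightarrow> bool" where
  "computes_within M w v n \<longleftrightarrow>
     (let c = (step M ^^ n) (start_config M w)
      in fst c \<ge> num_states M \<and> tape_holds (snd c ! 1) v)"


section \<open>Polynomial time and the class $\Sigma_2^p$\<close>

text \<open>Polynomial-time computability of \<open>f\<close> on the (promised) set of inputs \<open>D\<close>.\<close>

definition polytime_computable_on :: "bool list set \<Rightarrow> (bool list \<Rightarrow> bool list) \<Rightarrow> bool" where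
  "polytime_computable_on D f \<longleftrightarrow>
     (\<exists>M (p :: nat poly). turing_machine M \<and>
        (\<forall>w \<in> D. computes_within M w (f w) (poly p (length w))))"

definition polytime_decidable :: "bool list set \<Rightarrow> bool" where
  "polytime_decidable L \<longleftrightarrow> polytime_computable_on UNIV (\<lambda>w. [w \<in> L])"

text \<open>
  Self-delimiting encoding of lists: every element is announced by a 1, and a 0 ends the list.
\<close>

fun enc_list :: "('a \<Rightarrow> bool list) \<Rightarrow> 'a list \<Rightarrow> bool list" where
  "enc_list e [] = [False]"
| "enc_list e (x # xs) = True # e x @ enc_list e xs"

definition enc_string :: "bool list \<Rightarrow> bool list" where
  "enc_string = enc_list (\<lambda>b. [b])"

definition enc_triple :: "bool list \<Rightarrow> bool list \<Rightarrow> bool list \<Rightarrow> bool list" where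
  "enc_triple w X Y = enc_string w @ enc_string X @ enc_string Y"

definition Sigma2p :: "bool list set set" where
  "Sigma2p = {L. \<exists>(p :: nat poly) P. polytime_decidable P \<and>
     (\<forall>w. w \<in> L \<longleftrightarrow>
        (\<exists>X. length X \<le> poly p (length w) \<and>
           (\<forall>Y. length Y \<le> poly p (length w) \<longrightarrow> enc_triple w X Y \<in> P)))}"


section \<open>Instances\<close>

text \<open>
  The matrix-valued linear maps are given by their coefficient matrices,
  \<open>B(x) = (\<Sum>k<n\<^sub>x. x\<^sub>k B\<^sub>k)\<close> and \<open>T(u) = (\<Sum>k<n\<^sub>u. u\<^sub>k T\<^sub>k)\<close>, as the lists
  \<open>B\<^sub>0, B\<^sub>1, \<dots>\<close> (\<open>coeffs_B\<close>) and \<open>T\<^sub>0, T\<^sub>1, \<dots>\<close> (\<open>coeffs_T\<close>).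
\<close>

record adapt_inst =
  n_x :: nat
  n_u :: nat
  n_y :: nat
  m_x :: nat
  m_u :: nat
  m_y :: nat
  bound_R :: nat
  vec_a :: "rat vec"
  vec_b :: "rat vec"
  mat_A :: "rat mat"
  mat_W :: "rat mat"
  coeffs_B :: "rat mat list"
  coeffs_T :: "rat mat list"

definition valid_inst :: "adapt_inst \<Rightarrow> bool" where
  "valid_inst I \<longleftrightarrow>
     vec_a I \<in> carrier_vec (m_x I) \<and>
     vec_b I \<in> carrier_vec (m_u I) \<and>
     mat_A I \<in> carrier_mat (m_x I) (n_x I) \<and>
     mat_W I \<in> carrier_mat (m_y I) (n_y I) \<and>
     length (coeffs_B I) = n_x I \<and> set (coeffs_B I) \<subseteq> carrier_mat (m_u I) (n_u I) \<and>
     length (coeffs_T I) = n_u I \<and> set (coeffs_T I) \<subseteq> carrier_mat (m_y I) (n_x I)"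

text \<open>Binary digits, least significant first; no digits for 0.\<close>

fun digits :: "nat \<Rightarrow> bool list" where
  "digits n = (if n = 0 then [] else odd n # digits (n div 2))"

declare digits.simps [simp del]

definition enc_nat :: "nat \<Rightarrow> bool list" where
  "enc_nat n = enc_string (digits n)"

definition enc_int :: "int \<Rightarrow> bool list" where
  "enc_int z = (z < 0) # enc_nat (nat \<bar>z\<bar>)"

definition enc_rat :: "rat \<Rightarrow> bool list" where
  "enc_rat r = enc_int (fst (quotient_of r)) @ enc_int (snd (quotient_of r))"

definition enc_vec :: "rat vec \<Rightarrow> bool list" where
  "enc_vec v = enc_list enc_rat (list_of_vec v)"

definition enc_mat :: "rat mat \<Rightarrow> bool list" where
  "enc_mat A = enc_list enc_vec (rows A)"

text \<open>
  The dimensions are written in unary, so that the encoding length bounds the numbers of variables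
  and constraints even if some matrices have no rows or columns; all numerical data are in binary.
\<close>

definition enc_dim :: "nat \<Rightarrow> bool list" where
  "enc_dim n = replicate n True @ [False]"

definition enc_inst :: "adapt_inst \<Rightarrow> bool list" where
  "enc_inst I =
     enc_dim (n_x I) @ enc_dim (n_u I) @ enc_dim (n_y I) @
     enc_dim (m_x I) @ enc_dim (m_u I) @ enc_dim (m_y I) @
     enc_nat (bound_R I) @ enc_vec (vec_a I) @ enc_vec (vec_b I) @
     enc_mat (mat_A I) @ enc_mat (mat_W I) @
     enc_list enc_mat (coeffs_B I) @ enc_list enc_mat (coeffs_T I)"


section \<open>The sets $X_c$, $X_d$, $U_d(x)$, $Y_c(x,u)$, $Y_d(x,u)$\<close>

abbreviation real_vec :: "rat vec \<Rightarrow> real vec" where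
  "real_vec \<equiv> map_vec real_of_rat"

abbreviation real_mat :: "rat mat \<Rightarrow> real mat" where
  "real_mat \<equiv> map_mat real_of_rat"

definition real_box :: "nat \<Rightarrow> nat \<Rightarrow> real vec set" where
  "real_box R n = {v \<in> carrier_vec n. \<forall>i < n. 0 \<le> v $ i \<and> v $ i \<le> real R}"

definition int_vecs :: "real vec set" where
  "int_vecs = {v. \<forall>i < dim_vec v. v $ i \<in> \<int>}"

definition B_of :: "adapt_inst \<Rightarrow> real vec \<Rightarrow> real mat" where
  "B_of I x = mat (m_u I) (n_u I)
     (\<lambda>(i, j). \<Sum>k<n_x I. real_of_rat (coeffs_B I ! k $$ (i, j)) * x $ k)"

definition T_of :: "adapt_inst \<Rightarrow> real vec \<Rightarrow> real mat" where
  "T_of I u = mat (m_y I) (n_x I)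
     (\<lambda>(i, j). \<Sum>k<n_u I. real_of_rat (coeffs_T I ! k $$ (i, j)) * u $ k)"

text \<open>Vectors are ordered componentwise.\<close>

definition X_c :: "adapt_inst \<Rightarrow> real vec set" where
  "X_c I = {x \<in> real_box (bound_R I) (n_x I). real_mat (mat_A I) *\<^sub>v x \<le> real_vec (vec_a I)}"

definition X_d :: "adapt_inst \<Rightarrow> real vec set" where
  "X_d I = X_c I \<inter> int_vecs"

definition U_d :: "adapt_inst \<Rightarrow> real vec \<Rightarrow> real vec set" where
  "U_d I x = {u \<in> real_box (bound_R I) (n_u I) \<inter> int_vecs. B_of I x *\<^sub>v u \<le> real_vec (vec_b I)}"

definition Y_c :: "adapt_inst \<Rightarrow> real vec \<Rightarrow> real vec \<Rightarrow> real vec set" where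
  "Y_c I x u = {y \<in> real_box (bound_R I) (n_y I).
     T_of I u *\<^sub>v x + real_mat (mat_W I) *\<^sub>v y \<le> 0\<^sub>v (m_y I)}"

definition Y_d :: "adapt_inst \<Rightarrow> real vec \<Rightarrow> real vec \<Rightarrow> real vec set" where
  "Y_d I x u = Y_c I x u \<inter> int_vecs"


section \<open>Bounded $K$-adaptability\<close>

definition K_adaptable ::
  "nat \<Rightarrow> nat \<Rightarrow> real vec set \<Rightarrow> (real vec \<Rightarrow> real vec set)
   \<Rightarrow> (real vec \<Rightarrow> real vec \<Rightarrow> real vec set) \<Rightarrow> bool" where
  "K_adaptable k n X U Y \<longleftrightarrow>
     (\<exists>x \<in> X. \<exists>ys. length ys = k \<and> set ys \<subseteq> carrier_vec n \<and>
        (\<forall>u \<in> U x. set ys \<inter> Y x u \<noteq> {}))"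

definition bounded_K_adaptability ::
  "(adapt_inst \<Rightarrow> nat) \<Rightarrow> (adapt_inst \<Rightarrow> real vec set) \<Rightarrow> (adapt_inst \<Rightarrow> real vec \<Rightarrow> real vec set)
   \<Rightarrow> (adapt_inst \<Rightarrow> real vec \<Rightarrow> real vec \<Rightarrow> real vec set) \<Rightarrow> bool list set" where
  "bounded_K_adaptability K X U Y =
     {enc_inst I | I. valid_inst I \<and> K_adaptable (K I) (n_y I) (X I) (U I) (Y I)}"

definition polytime_parameter :: "(adapt_inst \<Rightarrow> nat) \<Rightarrow> bool" where
  "polytime_parameter K \<longleftrightarrow>
     (\<exists>f. polytime_computable_on (enc_inst ` Collect valid_inst) f \<and>
        (\<forall>I. valid_inst I \<longrightarrow> f (enc_inst I) = enc_nat (K I)))"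

definition polynomial_parameter :: "(adapt_inst \<Rightarrow> nat) \<Rightarrow> bool" where
  "polynomial_parameter K \<longleftrightarrow>
     (\<exists>p :: nat poly. \<forall>I. valid_inst I \<longrightarrow> K I \<le> poly p (length (enc_inst I)))"


section \<open>Instances are determined by their encodings\<close>

definition prefix_free :: "('a \<Rightarrow> bool list) \<Rightarrow> bool" where
  "prefix_free e \<longleftrightarrow> (\<forall>x y r s. e x @ r = e y @ s \<longrightarrow> x = y \<and> r = s)"

lemma prefix_freeD: "prefix_free e \<Longrightarrow> e x @ r = e y @ s \<longleftrightarrow> x = y \<and> r = s"
  unfolding prefix_free_def by blast

lemma prefix_free_enc_list:
  assumes "prefix_free e"
  shows "prefix_free (enc_list e)"
proof -
  have "xs = ys \<and> r = s" if "enc_list e xs @ r = enc_list e ys @ s" for xs ys r s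
    using that
  proof (induction xs arbitrary: ys)
    case Nil
    then show ?case by (cases ys) auto
  next
    case (Cons x xs)
    then show ?case by (cases ys) (auto simp: prefix_freeD[OF assms])
  qed
  then show ?thesis unfolding prefix_free_def by blast
qed

lemma prefix_free_enc_string: "prefix_free enc_string"
  unfolding enc_string_def by (rule prefix_free_enc_list) (simp add: prefix_free_def)

lemma digits_inj: "digits m = digits n \<Longrightarrow> m = n"
proof (induction m arbitrary: n rule: less_induct)
  case (less m)
  show ?case
  proof (cases "m = 0 \<or> n = 0")
    case True
    with less.prems show ?thesis
      by (auto simp: digits.simps[of m] digits.simps[of n] split: if_splits)
  next
    case False
    with less.prems have "odd m = odd n" "digits (m div 2) = digits (n div 2)"
      by (simp_all add: digits.simps[of m] digits.simps[of n])
    moreover from this(2) False have "m div 2 = n div 2"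
      by (intro less.IH) auto
    ultimately show ?thesis
      by (metis odd_two_times_div_two_succ even_two_times_div_two)
  qed
qed

lemma prefix_free_enc_nat: "prefix_free enc_nat"
  unfolding prefix_free_def enc_nat_def
  by (auto simp: prefix_freeD[OF prefix_free_enc_string] dest: digits_inj)

lemma prefix_free_enc_int: "prefix_free enc_int"
  unfolding prefix_free_def enc_int_def
  by (auto simp: prefix_freeD[OF prefix_free_enc_nat])

lemma prefix_free_enc_rat: "prefix_free enc_rat"
  unfolding prefix_free_def enc_rat_def
  by (auto simp: prefix_freeD[OF prefix_free_enc_int] prod_eq_iff quotient_of_inject_eq[symmetric])

lemma prefix_free_enc_vec: "prefix_free enc_vec"
  unfolding prefix_free_def enc_vec_def
  by (metis prefix_freeD[OF prefix_free_enc_list[OF prefix_free_enc_rat]] vec_list)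

lemma enc_mat_rows:
  assumes "enc_mat A @ r = enc_mat B @ s"
  shows "rows A = rows B \<and> r = s"
  using assms unfolding enc_mat_def
  by (simp add: prefix_freeD[OF prefix_free_enc_list[OF prefix_free_enc_vec]])

lemma enc_mat_inj:
  assumes "enc_mat A @ r = enc_mat B @ s" "A \<in> carrier_mat m n" "B \<in> carrier_mat m n"
  shows "A = B \<and> r = s"
  using enc_mat_rows[OF assms(1)] assms(2,3)
  by (metis carrier_matD(2) mat_of_rows_rows)

lemma enc_mats_inj:
  assumes "enc_list enc_mat As @ r = enc_list enc_mat Bs @ s"
    "set As \<subseteq> carrier_mat m n" "set Bs \<subseteq> carrier_mat m n"
  shows "As = Bs \<and> r = s"
  using assms
proof (induction As arbitrary: Bs)
  case Nil
  then show ?case by (cases Bs) auto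
next
  case (Cons A As)
  from Cons.prems obtain B Bs' where Bs: "Bs = B # Bs'" by (cases Bs) auto
  with Cons.prems have "enc_mat A @ (enc_list enc_mat As @ r) = enc_mat B @ (enc_list enc_mat Bs' @ s)"
    by simp
  from enc_mat_inj[OF this] Cons.prems Bs
  have "A = B" "enc_list enc_mat As @ r = enc_list enc_mat Bs' @ s" by auto
  with Cons Bs show ?case by auto
qed

lemma prefix_free_enc_dim: "prefix_free enc_dim"
proof -
  have "m = n \<and> r = s" if "enc_dim m @ r = enc_dim n @ s" for m n r s
    using that
  proof (induction m arbitrary: n)
    case 0
    then show ?case by (cases n) (auto simp: enc_dim_def)
  next
    case (Suc m)
    then show ?case by (cases n) (auto simp: enc_dim_def)
  qed
  then show ?thesis unfolding prefix_free_def by blast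
qed

lemma enc_inst_inj: "inj_on enc_inst (Collect valid_inst)"
proof (rule inj_onI)
  fix I J assume "I \<in> Collect valid_inst" "J \<in> Collect valid_inst" and eq: "enc_inst I = enc_inst J"
  then have vI: "valid_inst I" and vJ: "valid_inst J" by auto
  note D = prefix_freeD[OF prefix_free_enc_dim] prefix_freeD[OF prefix_free_enc_nat]
    prefix_freeD[OF prefix_free_enc_vec]
  from eq have dims: "n_x I = n_x J" "n_u I = n_u J" "n_y I = n_y J" "m_x I = m_x J" "m_u I = m_u J"
      "m_y I = m_y J" "bound_R I = bound_R J" "vec_a I = vec_a J" "vec_b I = vec_b J"
    and rest: "enc_mat (mat_A I) @ enc_mat (mat_W I) @ enc_list enc_mat (coeffs_B I) @
        enc_list enc_mat (coeffs_T I) =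
      enc_mat (mat_A J) @ enc_mat (mat_W J) @ enc_list enc_mat (coeffs_B J) @
        enc_list enc_mat (coeffs_T J)"
    unfolding enc_inst_def by (simp_all add: D)
  note carr = vI[unfolded valid_inst_def] vJ[unfolded valid_inst_def, folded dims]
  from enc_mat_inj[OF rest] carr have A: "mat_A I = mat_A J"
    and rest1: "enc_mat (mat_W I) @ enc_list enc_mat (coeffs_B I) @ enc_list enc_mat (coeffs_T I) =
      enc_mat (mat_W J) @ enc_list enc_mat (coeffs_B J) @ enc_list enc_mat (coeffs_T J)"
    by blast+
  from enc_mat_inj[OF rest1] carr have W: "mat_W I = mat_W J"
    and rest2: "enc_list enc_mat (coeffs_B I) @ enc_list enc_mat (coeffs_T I) =
      enc_list enc_mat (coeffs_B J) @ enc_list enc_mat (coeffs_T J)"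
    by blast+
  from enc_mats_inj[OF rest2] carr have B: "coeffs_B I = coeffs_B J"
    and rest3: "enc_list enc_mat (coeffs_T I) @ [] = enc_list enc_mat (coeffs_T J) @ []"
    by auto
  from enc_mats_inj[OF rest3] carr have "coeffs_T I = coeffs_T J" by blast
  with dims A W B show "I = J" by simp
qed

end

theory Submission
  imports Defs "Jordan_Normal_Form.Determinant"
begin

text \<open>
  A solution \<open>(x, y\<^sup>1, \<dots>, y\<^sup>K)\<close> is described by linear inequalities: for every scenario \<open>u\<close> in the
  box, either some \<open>y\<^sup>k\<close> copes with \<open>u\<close>, or one of the rows of \<open>B(x) u \<le> b\<close> is violated, which is
  a strict linear inequality in \<open>x\<close>.  There are exponentially many scenarios, but each inequality has
  short coefficients, so by Cramer's rule the system has a rational solution with polynomially many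
  bits as soon as it has a real one, and the certificate for \<open>\<exists>X\<close> consists of such a solution.
  The certificate also contains the instance in tabular form: encoding it and comparing with the
  input replaces parsing.  Every fraction in it carries Bezout coefficients and its cofactor in a
  common denominator, so that checking needs neither gcd nor division.

  As polynomial time refers to concrete Turing machines, the verifier is a function in a calculus
  of polynomial-time functions on tree-coded data, closed under iteration over lists with bounded
  growth.  Its functions are realised by structured stack programs, one stack per tape.
  The number \<open>K\<close> is obtained by simulating its machine inside the calculus.
\<close>

section \<open>Structured stack programs\<close>

text \<open>The scenario set depends on \<open>x\<close>, so replacing a real solution by a rational
  one could let new scenarios in. Therefore the choices of one real solution are frozen: for each
  integral \<open>u\<close> in the box, either the index of the recourse vector that serves it or
  the index of a row that excludes it. The result is one linear system, every solution of which is a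
  witness. Exclusion is a strict inequality, so the solution set may lack vertices; this is why it
  is homogenized. The number of inequalities does not matter because Cramer's rule uses only as many
  of them as there are unknowns, that is \<open>n_x + K * n_y\<close> and one more for
  homogenization. Here the polynomial bound on \<open>K\<close> enters. Integral unknowns are pinned
  to the integers that they take, all at most \<open>R\<close>, so the four cases are treated at
  once. The value of \<open>K\<close> is promised only on encodings of valid instances. So the
  certificate proposes the list of recourse vectors, and the simulated machine only has to confirm
  its length, an answer that counts after the input has been recognized as an encoding.\<close>

text \<open>
  A register \<open>r\<close> is a stack of bits, stored on tape \<open>r\<close> from the head (the top) to the right up to
  the first blank.  Cells to the left of the head may hold garbage: a push overwrites them.
  Tape 1, the output tape, is not used as a register.
\<close>

datatype prog =
    Skip
  | Push nat bool
  | Pop nat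
  | Seq prog prog
  | If nat sym prog prog
  | While nat sym prog

definition top_sym :: "bool list \<Rightarrow> sym" where
  "top_sym l = (case l of [] \<Rightarrow> None | b # _ \<Rightarrow> Some b)"

lemma top_sym_simps [simp]: "top_sym [] = None" "top_sym (b # l) = Some b"
  by (simp_all add: top_sym_def)

text \<open>The counter is exactly the number of machine steps of the compiled code: a push first
  moves left and then writes, each test takes one step, and the jump back at the end of a loop body
  is free.\<close>

inductive run :: "prog \<Rightarrow> (nat \<Rightarrow> bool list) \<Rightarrow> (nat \<Rightarrow> bool list) \<Rightarrow> nat \<Rightarrow> bool" where
  run_Skip: "run Skip \<sigma> \<sigma> 1"
| run_Push: "run (Push r b) \<sigma> (\<sigma>(r := b # \<sigma> r)) 2"
| run_Pop: "\<sigma> r \<noteq> [] \<Longrightarrow> run (Pop r) \<sigma> (\<sigma>(r := tl (\<sigma> r))) 1"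
| run_Seq: "run p \<sigma> \<sigma>' m \<Longrightarrow> run q \<sigma>' \<sigma>'' n \<Longrightarrow> run (Seq p q) \<sigma> \<sigma>'' (m + n)"
| run_If1: "top_sym (\<sigma> r) = s \<Longrightarrow> run p \<sigma> \<sigma>' n \<Longrightarrow> run (If r s p q) \<sigma> \<sigma>' (n + 1)"
| run_If2: "top_sym (\<sigma> r) \<noteq> s \<Longrightarrow> run q \<sigma> \<sigma>' n \<Longrightarrow> run (If r s p q) \<sigma> \<sigma>' (n + 1)"
| run_While1: "top_sym (\<sigma> r) = s \<Longrightarrow> run p \<sigma> \<sigma>' m \<Longrightarrow> run (While r s p) \<sigma>' \<sigma>'' n \<Longrightarrow>
    run (While r s p) \<sigma> \<sigma>'' (m + n + 1)"
| run_While2: "top_sym (\<sigma> r) \<noteq> s \<Longrightarrow> run (While r s p) \<sigma> \<sigma> 1"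

fun regs :: "prog \<Rightarrow> nat set" where
  "regs Skip = {}"
| "regs (Push r b) = {r}"
| "regs (Pop r) = {r}"
| "regs (Seq p q) = regs p \<union> regs q"
| "regs (If r s p q) = insert r (regs p \<union> regs q)"
| "regs (While r s p) = insert r (regs p)"


section \<open>Compilation to Turing machines\<close>

fun code_len :: "prog \<Rightarrow> nat" where
  "code_len Skip = 1"
| "code_len (Push r b) = 2"
| "code_len (Pop r) = 1"
| "code_len (Seq p q) = code_len p + code_len q"
| "code_len (If r s p q) = 1 + code_len p + code_len q"
| "code_len (While r s p) = 1 + code_len p"

abbreviation keep :: "sym list \<Rightarrow> (sym \<times> dir) list" where
  "keep ss \<equiv> map (\<lambda>s. (s, Stay)) ss"

text \<open>\<open>code p b e\<close> occupies the states \<open>b, \<dots>, b + code_len p - 1\<close> and leaves to state \<open>e\<close>.\<close>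

fun code :: "prog \<Rightarrow> nat \<Rightarrow> nat \<Rightarrow> nat \<Rightarrow> sym list \<Rightarrow> nat \<times> (sym \<times> dir) list" where
  "code Skip b e q ss = (e, keep ss)"
| "code (Push r x) b e q ss =
    (if q = b then (Suc b, (keep ss)[r := (ss ! r, MoveLeft)]) else (e, (keep ss)[r := (Some x, Stay)]))"
| "code (Pop r) b e q ss = (e, (keep ss)[r := (ss ! r, MoveRight)])"
| "code (Seq p p') b e q ss =
    (if q < b + code_len p then code p b (b + code_len p) q ss else code p' (b + code_len p) e q ss)"
| "code (If r s p p') b e q ss =
    (if q = b then (if ss ! r = s then Suc b else Suc b + code_len p, keep ss)
     else if q < Suc b + code_len p then code p (Suc b) e q ss
     else code p' (Suc b + code_len p) e q ss)"
| "code (While r s p) b e q ss =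
    (if q = b then (if ss ! r = s then Suc b else e, keep ss) else code p (Suc b) b q ss)"

lemma length_code: "length (snd (code p b e q ss)) = length ss"
  by (induction p b e q ss rule: code.induct) auto

definition tape_stack :: "tape \<Rightarrow> bool list \<Rightarrow> bool" where
  "tape_stack t l \<longleftrightarrow> (\<forall>i < length l. fst t (snd t + int i) = Some (l ! i)) \<and>
     fst t (snd t + int (length l)) = None"

lemma tape_stack_read: "tape_stack t l \<Longrightarrow> read_sym t = top_sym l"
  by (cases l) (auto simp: tape_stack_def read_sym_def)

lemma act_keep: "act (read_sym t, Stay) t = t"
  by (simp add: act_def read_sym_def)

lemma tape_stack_pop:
  assumes "tape_stack t l" "l \<noteq> []"
  shows "tape_stack (act (read_sym t, MoveRight) t) (tl l)"
proof -
  obtain b l' where l: "l = b # l'" using assms(2) by (cases l) auto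
  have "fst t (snd t + int (Suc i)) = Some (l' ! i)" if "i < length l'" for i
  proof -
    have "Suc i < length l" using that l by simp
    then have "fst t (snd t + int (Suc i)) = Some (l ! Suc i)"
      using assms(1) unfolding tape_stack_def by blast
    then show ?thesis by (simp add: l)
  qed
  then show ?thesis using assms(1)
    by (simp add: l tape_stack_def act_def read_sym_def add.assoc)
qed

lemma tape_stack_push:
  assumes "tape_stack t l"
  shows "tape_stack (act (Some b, Stay) (act (read_sym t, MoveLeft) t)) (b # l)"
proof -
  have "fst t (snd t - 1 + int i) = Some ((b # l) ! i)" if "0 < i" "i \<le> length l" for i
  proof -
    obtain j where i: "i = Suc j" using \<open>0 < i\<close> by (cases i) auto
    with that assms have "fst t (snd t + int j) = Some (l ! j)" by (simp add: tape_stack_def)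
    then show ?thesis by (simp add: i add.commute)
  qed
  then show ?thesis using assms
    by (auto simp: tape_stack_def act_def read_sym_def less_Suc_eq_le)
qed

text \<open>Tape 1 has to stay wholly blank: the verdict is a single bit written there at the end,
  and \<open>tape_holds\<close> demands a blank behind it.\<close>

definition tapes_rep :: "nat \<Rightarrow> tape list \<Rightarrow> (nat \<Rightarrow> bool list) \<Rightarrow> bool" where
  "tapes_rep k ts \<sigma> \<longleftrightarrow> length ts = k \<and> ts ! 1 = blank_tape \<and>
     (\<forall>r < k. r \<noteq> 1 \<longrightarrow> tape_stack (ts ! r) (\<sigma> r))"

lemma step_keep:
  assumes "delta M q (map read_sym ts) = (q', keep (map read_sym ts))" "q < num_states M"
  shows "step M (q, ts) = (q', ts)"
proof -
  have "map2 act (keep (map read_sym ts)) ts = ts"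
    by (rule nth_equalityI) (auto simp: act_keep)
  then show ?thesis using assms by (simp add: step_def)
qed

lemma step_update:
  assumes "delta M q (map read_sym ts) = (q', (keep (map read_sym ts))[r := a])"
    "q < num_states M"
  shows "step M (q, ts) = (q', ts[r := act a (ts ! r)])"
proof -
  have "map2 act ((keep (map read_sym ts))[r := a]) ts ! i = ts[r := act a (ts ! r)] ! i"
    if "i < length ts" for i
    using that by (cases "i = r") (simp_all add: act_keep)
  then have "map2 act ((keep (map read_sym ts))[r := a]) ts = ts[r := act a (ts ! r)]"
    by (intro nth_equalityI) auto
  then show ?thesis using assms by (simp add: step_def)
qed

lemma funpow_step_trans:
  assumes "(step M ^^ m) c = c'" "(step M ^^ n) c' = c''"
  shows "(step M ^^ (m + n)) c = c''"
proof -
  have "(step M ^^ (n + m)) c = c''" using assms by (simp add: funpow_add)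
  then show ?thesis by (simp add: add.commute)
qed

text \<open>Agreement of \<open>delta\<close> with \<open>code\<close> is required only on the
  states of the block, and entry and exit are arbitrary, so that the induction can descend into
  subprograms.\<close>

lemma run_code:
  assumes "run p \<sigma> \<sigma>' n"
    and "regs p \<subseteq> {..<k} - {1}"
    and "b + code_len p \<le> num_states M"
    and "\<And>q ss. b \<le> q \<Longrightarrow> q < b + code_len p \<Longrightarrow> length ss = k \<Longrightarrow> delta M q ss = code p b e q ss"
    and "tapes_rep k ts \<sigma>"
  shows "\<exists>ts'. (step M ^^ n) (b, ts) = (e, ts') \<and> tapes_rep k ts' \<sigma>'"
  using assms
proof (induction arbitrary: b e ts rule: run.induct)
  case (run_Skip \<sigma>)
  have "step M (b, ts) = (e, ts)"
    using run_Skip by (intro step_keep) (auto simp: tapes_rep_def)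
  then show ?case using run_Skip by auto
next
  case (run_Push r x \<sigma>)
  have len: "length ts = k" and r: "r < k" "r \<noteq> 1" using run_Push by (auto simp: tapes_rep_def)
  define ts1 where "ts1 = ts[r := act (read_sym (ts ! r), MoveLeft) (ts ! r)]"
  define ts2 where "ts2 = ts1[r := act (Some x, Stay) (ts1 ! r)]"
  have "step M (b, ts) = (Suc b, ts1)"
    unfolding ts1_def using run_Push.prems len r by (intro step_update) auto
  moreover have "step M (Suc b, ts1) = (e, ts2)"
    unfolding ts2_def using run_Push.prems len r by (intro step_update) (auto simp: ts1_def)
  ultimately have "(step M ^^ 2) (b, ts) = (e, ts2)" by (simp add: numeral_2_eq_2)
  moreover have "tapes_rep k ts2 (\<sigma>(r := x # \<sigma> r))"
    using run_Push.prems r unfolding tapes_rep_def ts2_def ts1_def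
    by (auto intro!: tape_stack_push)
  ultimately show ?case by blast
next
  case (run_Pop \<sigma> r)
  have len: "length ts = k" and r: "r < k" "r \<noteq> 1" using run_Pop by (auto simp: tapes_rep_def)
  have "step M (b, ts) = (e, ts[r := act (read_sym (ts ! r), MoveRight) (ts ! r)])"
    using run_Pop.prems len r by (intro step_update) auto
  moreover have "tapes_rep k (ts[r := act (read_sym (ts ! r), MoveRight) (ts ! r)]) (\<sigma>(r := tl (\<sigma> r)))"
    using run_Pop r unfolding tapes_rep_def by (auto intro!: tape_stack_pop)
  ultimately show ?case by (metis One_nat_def comp_id funpow.simps)
next
  case (run_Seq p \<sigma> \<sigma>' m q \<sigma>'' n)
  have "\<exists>ts'. (step M ^^ m) (b, ts) = (b + code_len p, ts') \<and> tapes_rep k ts' \<sigma>'"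
    using run_Seq.prems by (intro run_Seq.IH(1)) auto
  then obtain ts' where 1: "(step M ^^ m) (b, ts) = (b + code_len p, ts')" "tapes_rep k ts' \<sigma>'" by blast
  have "\<exists>ts''. (step M ^^ n) (b + code_len p, ts') = (e, ts'') \<and> tapes_rep k ts'' \<sigma>''"
    using run_Seq.prems 1(2) by (intro run_Seq.IH(2)) auto
  then show ?case using funpow_step_trans[OF 1(1)] by blast
next
  case (run_If1 \<sigma> r s p \<sigma>' n q)
  have "map read_sym ts ! r = s" 
    using run_If1.prems run_If1.hyps by (auto simp: tapes_rep_def tape_stack_read)
  then have 1: "(step M ^^ 1) (b, ts) = (Suc b, ts)"
    using run_If1.prems by (auto intro!: step_keep simp: tapes_rep_def)
  have "\<exists>ts'. (step M ^^ n) (Suc b, ts) = (e, ts') \<and> tapes_rep k ts' \<sigma>'"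
    using run_If1.prems by (intro run_If1.IH) auto
  then show ?case using funpow_step_trans[OF 1, of n] by (auto simp: add.commute)
next
  case (run_If2 \<sigma> r s q \<sigma>' n p)
  have "map read_sym ts ! r \<noteq> s" 
    using run_If2.prems run_If2.hyps by (auto simp: tapes_rep_def tape_stack_read)
  then have 1: "(step M ^^ 1) (b, ts) = (Suc b + code_len p, ts)"
    using run_If2.prems by (auto intro!: step_keep simp: tapes_rep_def)
  have "\<exists>ts'. (step M ^^ n) (Suc b + code_len p, ts) = (e, ts') \<and> tapes_rep k ts' \<sigma>'"
    using run_If2.prems by (intro run_If2.IH) auto
  then show ?case using funpow_step_trans[OF 1, of n] by (auto simp: add.commute)
next
  case (run_While1 \<sigma> r s p \<sigma>' m \<sigma>'' n)
  have "map read_sym ts ! r = s" 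
    using run_While1.prems run_While1.hyps by (auto simp: tapes_rep_def tape_stack_read)
  then have 1: "(step M ^^ 1) (b, ts) = (Suc b, ts)"
    using run_While1.prems by (auto intro!: step_keep simp: tapes_rep_def)
  have "\<exists>ts'. (step M ^^ m) (Suc b, ts) = (b, ts') \<and> tapes_rep k ts' \<sigma>'"
    using run_While1.prems by (intro run_While1.IH(1)) auto
  then obtain ts' where 2: "(step M ^^ m) (Suc b, ts) = (b, ts')" "tapes_rep k ts' \<sigma>'" by blast
  have "\<exists>ts''. (step M ^^ n) (b, ts') = (e, ts'') \<and> tapes_rep k ts'' \<sigma>''"
    using run_While1.prems 2(2) by (intro run_While1.IH(2)) auto
  then show ?case
    using funpow_step_trans[OF funpow_step_trans[OF 1 2(1)], of n] by (auto simp: add_ac)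
next
  case (run_While2 \<sigma> r s p)
  have "map read_sym ts ! r \<noteq> s" 
    using run_While2.prems run_While2.hyps by (auto simp: tapes_rep_def tape_stack_read)
  then have "step M (b, ts) = (e, ts)"
    using run_While2.prems by (auto intro!: step_keep simp: tapes_rep_def)
  then show ?case using run_While2.prems by auto
qed

text \<open>The exit state of the program is the only state that changes tape 1; its successor
  equals \<open>num_states\<close> and therefore halts.\<close>

definition decider :: "nat \<Rightarrow> prog \<Rightarrow> tm" where
  "decider k p = \<lparr>num_tapes = k, num_states = Suc (code_len p),
     delta = (\<lambda>q ss. if q < code_len p then code p 0 (code_len p) q ss
       else (Suc (code_len p), (keep ss)[1 := (Some (ss ! 0 = Some True), Stay)]))\<rparr>"

lemma turing_machine_decider: "2 \<le> k \<Longrightarrow> turing_machine (decider k p)"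
  by (auto simp: turing_machine_def decider_def length_code)

lemma tape_stack_input: "tape_stack (input_tape w) w"
  by (auto simp: tape_stack_def input_tape_def)

lemma tapes_rep_start:
  assumes "2 \<le> num_tapes M"
  shows "tapes_rep (num_tapes M) (snd (start_config M w)) ((\<lambda>_. [])(0 := w))"
proof -
  have "tape_stack (snd (start_config M w) ! r) (((\<lambda>_. [])(0 := w)) r)"
    if "r < num_tapes M" for r
    using that tape_stack_input[of w]
    by (cases r) (simp_all add: start_config_def tape_stack_def blank_tape_def)
  then show ?thesis
    using assms by (auto simp: tapes_rep_def start_config_def nth_Cons')
qed

text \<open>A halting configuration is a fixed point of \<open>step\<close>. Hence upper bounds on
  the running time suffice, although \<open>computes_within\<close> looks at one exact
  moment.\<close>

lemma computes_within_mono: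
  assumes "computes_within M w v m" "m \<le> n"
  shows "computes_within M w v n"
proof -
  let ?c = "(step M ^^ m) (start_config M w)"
  have "(step M ^^ j) ?c = ?c" for j
  proof (induction j)
    case (Suc j)
    have "step M ?c = ?c" using assms(1) by (simp add: computes_within_def step_def Let_def)
    with Suc show ?case by simp
  qed simp
  then have "(step M ^^ n) (start_config M w) = ?c"
    using funpow_step_trans[of m M "start_config M w" ?c "n - m" ?c] assms(2) by simp
  then show ?thesis using assms(1) by (simp add: computes_within_def)
qed

lemma computes_within_decider:
  assumes "run p ((\<lambda>_. [])(0 := w)) \<sigma> n" and "regs p \<subseteq> {..<k} - {1}" and "2 \<le> k"
  shows "computes_within (decider k p) w [top_sym (\<sigma> 0) = Some True] (n + 1)"
proof -
  let ?M = "decider k p"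
  have M: "num_tapes ?M = k" "num_states ?M = Suc (code_len p)" by (simp_all add: decider_def)
  have "\<exists>ts. (step ?M ^^ n) (0, snd (start_config ?M w)) = (code_len p, ts) \<and> tapes_rep k ts \<sigma>"
    using assms tapes_rep_start[of ?M w] M
    by (intro run_code[OF assms(1,2)]) (auto simp: decider_def)
  then obtain ts where ts: "(step ?M ^^ n) (start_config ?M w) = (code_len p, ts)" "tapes_rep k ts \<sigma>"
    by (auto simp: start_config_def)
  define b where "b = (top_sym (\<sigma> 0) = Some True)"
  have "read_sym (ts ! 0) = top_sym (\<sigma> 0)" "length ts = k" "ts ! 1 = blank_tape"
    using ts(2) assms(3) by (auto simp: tapes_rep_def tape_stack_read)
  then have "step ?M (code_len p, ts) = (Suc (code_len p), ts[1 := act (Some b, Stay) (ts ! 1)])"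
    using assms(3) by (intro step_update) (auto simp: decider_def b_def)
  then have "(step ?M ^^ (n + 1)) (start_config ?M w) =
      (Suc (code_len p), ts[1 := act (Some b, Stay) blank_tape])"
    using ts(1) \<open>ts ! 1 = blank_tape\<close> by simp
  then show ?thesis using \<open>length ts = k\<close> assms(3)
    unfolding computes_within_def b_def[symmetric]
    by (simp add: M tape_holds_def act_def blank_tape_def)
qed


section \<open>Polynomial bounds\<close>

definition poly_bounded :: "(nat \<Rightarrow> nat) \<Rightarrow> bool" where
  "poly_bounded g \<longleftrightarrow> (\<exists>p :: nat poly. \<forall>n. g n \<le> poly p n)"

text \<open>Coefficients in \<open>nat\<close> make polynomials monotone; on this rests every
  composition of size and time bounds.\<close>

lemma poly_mono_nat: "m \<le> n \<Longrightarrow> poly p m \<le> poly (p :: nat poly) n"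
proof (induction p)
  case (pCons a p)
  then show ?case by (simp add: mult_mono)
qed simp

named_theorems pb_intros

lemma poly_boundedI: "(\<And>n. g n \<le> poly p n) \<Longrightarrow> poly_bounded g"
  unfolding poly_bounded_def by blast

lemma poly_bounded_le: "poly_bounded g \<Longrightarrow> (\<And>n. f n \<le> g n) \<Longrightarrow> poly_bounded f"
  unfolding poly_bounded_def by (meson le_trans)

lemma pb_const [pb_intros]: "poly_bounded (\<lambda>_. c)"
  by (rule poly_boundedI[of _ "[:c:]"]) simp

lemma pb_id [pb_intros]: "poly_bounded (\<lambda>n. n)"
  by (rule poly_boundedI[of _ "[:0, 1:]"]) simp

lemma pb_add [pb_intros]: "poly_bounded f \<Longrightarrow> poly_bounded g \<Longrightarrow> poly_bounded (\<lambda>n. f n + g n)"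
  unfolding poly_bounded_def by (metis poly_add add_mono)

lemma pb_mult [pb_intros]: "poly_bounded f \<Longrightarrow> poly_bounded g \<Longrightarrow> poly_bounded (\<lambda>n. f n * g n)"
  unfolding poly_bounded_def by (metis poly_mult mult_le_mono)

lemma pb_Suc [pb_intros]: "poly_bounded f \<Longrightarrow> poly_bounded (\<lambda>n. Suc (f n))"
  using pb_add[OF _ pb_const[of 1]] by simp

lemma pb_poly [pb_intros]: "poly_bounded f \<Longrightarrow> poly_bounded (\<lambda>n. poly p (f n))"
proof -
  assume "poly_bounded f"
  then obtain q where "\<And>n. f n \<le> poly q n" by (auto simp: poly_bounded_def)
  then have "poly p (f n) \<le> poly (p \<circ>\<^sub>p q) n" for n
    by (simp add: poly_pcompose poly_mono_nat)
  then show ?thesis by (rule poly_boundedI)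
qed


section \<open>Binary trees as data\<close>

datatype tree = L | N tree tree

text \<open>This preorder code is self-delimiting: counting the subtrees still to be read finds its
  end. Trees can thus be stacked on one register without separators.\<close>

fun bits :: "tree \<Rightarrow> bool list" where
  "bits L = [False]"
| "bits (N a b) = True # bits a @ bits b"

fun tleft :: "tree \<Rightarrow> tree" where
  "tleft L = L"
| "tleft (N a b) = a"

fun tright :: "tree \<Rightarrow> tree" where
  "tright L = L"
| "tright (N a b) = b"

class coded =
  fixes tr :: "'a \<Rightarrow> tree"
  assumes tr_inj: "tr x = tr y \<Longrightarrow> x = y"

definition sz :: "'a :: coded \<Rightarrow> nat" where
  "sz x = length (bits (tr x))"

instantiation tree :: coded
begin
definition "tr_tree (t :: tree) = t"
instance by standard (simp add: tr_tree_def)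
end

instantiation prod :: (coded, coded) coded
begin
definition "tr_prod z = N (tr (fst z)) (tr (snd z))"
instance by standard (auto simp: tr_prod_def dest: tr_inj intro: prod_eqI)
end

text \<open>Both truth values get trees of the same size, so that sizes of bit lists depend only on their lengths.\<close>

instantiation bool :: coded
begin
definition "tr_bool b = (if b then N (N L L) L else N L (N L L))"
instance by standard (auto simp: tr_bool_def split: if_splits)
end

fun tr_spine :: "('a \<Rightarrow> tree) \<Rightarrow> 'a list \<Rightarrow> tree" where
  "tr_spine e [] = L"
| "tr_spine e (x # xs) = N (e x) (tr_spine e xs)"

instantiation list :: (coded) coded
begin
definition "tr_list \<equiv> tr_spine tr"
instance
proof
  fix xs ys :: "'a list"
  assume "tr xs = tr ys"
  then show "xs = ys" unfolding tr_list_def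
  proof (induction xs arbitrary: ys)
    case Nil
    then show ?case by (cases ys) auto
  next
    case (Cons x xs)
    then show ?case by (cases ys) (auto dest: tr_inj)
  qed
qed
end

lemma tr_list_simps [simp]:
  "tr ([] :: 'a :: coded list) = L" "tr (x # xs) = N (tr x) (tr xs)"
  by (simp_all add: tr_list_def)

lemma tr_Pair [simp]: "tr (a, b) = N (tr a) (tr b)"
  by (simp add: tr_prod_def)

lemma tr_tree [simp]: "tr t = t"
  by (simp add: tr_tree_def)

lemma sz_simps [simp]:
  "sz (a, b) = 1 + sz a + sz b"
  "sz ([] :: 'a :: coded list) = 1"
  "sz (x # xs) = 1 + sz (x :: 'a) + sz xs"
  "sz (c :: bool) = 5"
  by (auto simp: sz_def tr_bool_def)

lemma sz_pos: "0 < sz x"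
  unfolding sz_def by (cases "tr x") auto

lemma sz_append [simp]: "sz (xs @ ys) = sz xs + sz ys - 1"
proof -
  have "sz (xs @ ys) + 1 = sz xs + sz ys" by (induction xs) auto
  then show ?thesis by simp
qed

lemma sz_rev [simp]: "sz (rev xs) = sz xs"
  by (induction xs) auto

lemma length_le_sz: "length xs \<le> sz xs"
  by (induction xs) auto

lemma sz_snd: "sz (snd z) \<le> sz z"
  by (cases z) simp


section \<open>Stack programs on trees\<close>

definition runs :: "prog \<Rightarrow> (nat \<Rightarrow> bool list) \<Rightarrow> (nat \<Rightarrow> bool list) \<Rightarrow> nat \<Rightarrow> bool" where
  "runs p \<sigma> \<sigma>' n \<longleftrightarrow> (\<exists>m \<le> n. run p \<sigma> \<sigma>' m)"

lemma runs_mono: "runs p \<sigma> \<sigma>' m \<Longrightarrow> m \<le> n \<Longrightarrow> runs p \<sigma> \<sigma>' n"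
  unfolding runs_def by (meson le_trans)

lemma runs_Skip: "runs Skip \<sigma> \<sigma> 1"
  unfolding runs_def by (blast intro: run_Skip)

lemma runs_Push: "\<sigma>' = \<sigma>(r := b # \<sigma> r) \<Longrightarrow> runs (Push r b) \<sigma> \<sigma>' 2"
  unfolding runs_def by (blast intro: run_Push)

lemma runs_Pop: "\<sigma> r = b # l \<Longrightarrow> \<sigma>' = \<sigma>(r := l) \<Longrightarrow> runs (Pop r) \<sigma> \<sigma>' 1"
  unfolding runs_def using run_Pop[of \<sigma> r] by auto

lemma runs_Pop': "\<sigma> r \<noteq> [] \<Longrightarrow> \<sigma>' = \<sigma>(r := tl (\<sigma> r)) \<Longrightarrow> runs (Pop r) \<sigma> \<sigma>' 1"
  unfolding runs_def using run_Pop[of \<sigma> r] by auto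

lemma runs_Seq: "runs p \<sigma> \<sigma>' m \<Longrightarrow> runs q \<sigma>' \<sigma>'' n \<Longrightarrow> runs (Seq p q) \<sigma> \<sigma>'' (m + n)"
  unfolding runs_def by (metis add_mono run_Seq)

lemma runs_If1: "top_sym (\<sigma> r) = s \<Longrightarrow> runs p \<sigma> \<sigma>' n \<Longrightarrow> runs (If r s p q) \<sigma> \<sigma>' (n + 1)"
  unfolding runs_def by (meson add_le_mono1 run_If1)

lemma runs_If2: "top_sym (\<sigma> r) \<noteq> s \<Longrightarrow> runs q \<sigma> \<sigma>' n \<Longrightarrow> runs (If r s p q) \<sigma> \<sigma>' (n + 1)"
  unfolding runs_def by (meson add_le_mono1 run_If2)

lemma runs_While1: "top_sym (\<sigma> r) = s \<Longrightarrow> runs p \<sigma> \<sigma>' m \<Longrightarrow> runs (While r s p) \<sigma>' \<sigma>'' n \<Longrightarrow>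
    runs (While r s p) \<sigma> \<sigma>'' (m + n + 1)"
  unfolding runs_def by (meson add_le_mono add_le_mono1 run_While1)

lemma runs_While2: "top_sym (\<sigma> r) \<noteq> s \<Longrightarrow> runs (While r s p) \<sigma> \<sigma> 1"
  unfolding runs_def by (blast intro: run_While2)

fun pushes :: "bool list \<Rightarrow> prog" where
  "pushes [] = Skip"
| "pushes (b # bs) = Seq (pushes bs) (Push 0 b)"

lemma runs_pushes: "runs (pushes bs) \<sigma> (\<sigma>(0 := bs @ \<sigma> 0)) (1 + 2 * length bs)"
proof (induction bs)
  case Nil
  show ?case using runs_Skip[of \<sigma>] by simp
next
  case (Cons b bs)
  show ?case
    by (rule runs_mono, simp only: pushes.simps, rule runs_Seq, rule Cons.IH, rule runs_Push) auto
qed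

lemma regs_pushes: "regs (pushes bs) \<subseteq> {0}"
  by (induction bs) auto

text \<open>
  A word parked on an auxiliary stack is stored reversed, each bit announced by a 1, with a 0 below
  the whole word.
\<close>

fun parked :: "bool list \<Rightarrow> bool list" where
  "parked [] = []"
| "parked (b # bs) = parked bs @ [True, b]"

lemma parked_snoc: "parked (bs @ [b]) = True # b # parked bs"
  by (induction bs) auto

fun emit :: "nat list \<Rightarrow> bool \<Rightarrow> prog" where
  "emit [] b = Skip"
| "emit (r # rs) b = Seq (Push r b) (Seq (Push r True) (emit rs b))"

definition emitted :: "nat list \<Rightarrow> bool list \<Rightarrow> (nat \<Rightarrow> bool list) \<Rightarrow> nat \<Rightarrow> bool list" where
  "emitted rs bs \<sigma> = (\<lambda>r. if r \<in> set rs then parked bs @ \<sigma> r else \<sigma> r)"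

lemma runs_emit: "distinct rs \<Longrightarrow> runs (emit rs b) \<sigma> (emitted rs [b] \<sigma>) (1 + 4 * length rs)"
proof (induction rs arbitrary: \<sigma>)
  case Nil
  show ?case using runs_Skip[of \<sigma>] by (simp add: emitted_def)
next
  case (Cons r rs)
  have "emitted rs [b] (\<sigma>(r := True # b # \<sigma> r)) = emitted (r # rs) [b] \<sigma>"
    using Cons.prems by (auto simp: emitted_def)
  with Cons have IH: "runs (emit rs b) (\<sigma>(r := True # b # \<sigma> r)) (emitted (r # rs) [b] \<sigma>) (1 + 4 * length rs)"
    by (metis distinct.simps(2))
  show ?case
    by (rule runs_mono, simp only: emit.simps, (rule runs_Seq, rule runs_Push, rule refl)+, rule runs_mono[of _ _ _ "1 + 4 * length rs"])
      (use IH in auto)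
qed

lemma regs_emit: "regs (emit rs b) \<subseteq> set rs"
  by (induction rs) auto

text \<open>Register 4 counts, in unary, the subtrees that remain to be read.\<close>

definition scan_loop :: "nat list \<Rightarrow> prog" where
  "scan_loop rs = While 4 (Some True) (If 0 (Some True)
     (Seq (Pop 0) (Seq (Push 4 True) (emit rs True)))
     (Seq (Pop 0) (Seq (Pop 4) (emit rs False))))"

text \<open>The remainder of the loop is a premise, because reading a left subtree is a stretch of
  iterations within the loop and not a complete run of it.\<close>

lemma runs_scan_loop:
  assumes "distinct rs" "set rs \<subseteq> {2, 3}"
    and "\<sigma> 0 = bits t @ r" "\<sigma> 4 = True # k"
    and "runs (scan_loop rs) (emitted rs (bits t) (\<sigma>(0 := r, 4 := k))) \<sigma>' n"
  shows "runs (scan_loop rs) \<sigma> \<sigma>' (n + (6 + 4 * length rs) * length (bits t))"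
  using assms(3-)
proof (induction t arbitrary: \<sigma> r k n)
  case L
  let ?c = "1 + (1 + (1 + 4 * length rs)) + 1"
  have "runs (emit rs False) (\<sigma>(0 := r, 4 := k)) (emitted rs [False] (\<sigma>(0 := r, 4 := k))) (1 + 4 * length rs)"
    by (rule runs_emit) fact
  then have 1: "runs (If 0 (Some True)
     (Seq (Pop 0) (Seq (Push 4 True) (emit rs True)))
     (Seq (Pop 0) (Seq (Pop 4) (emit rs False)))) \<sigma> (emitted rs [False] (\<sigma>(0 := r, 4 := k))) ?c"
    using L by (intro runs_If2 runs_Seq[OF runs_Pop[OF _ refl, where b = False] runs_Seq[OF runs_Pop[OF _ refl, where b = True]]]) simp_all
  have 2: "runs (scan_loop rs) (emitted rs [False] (\<sigma>(0 := r, 4 := k))) \<sigma>' n"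
    using L.prems(3) by (simp only: bits.simps)
  have "runs (scan_loop rs) \<sigma> \<sigma>' (?c + n + 1)"
    unfolding scan_loop_def by (rule runs_While1[OF _ 1 2[unfolded scan_loop_def]]) (simp add: L.prems)
  then show ?case by (rule runs_mono) auto
next
  case (N a b)
  let ?c = "1 + (2 + (1 + 4 * length rs)) + 1"
  define \<sigma>1 where "\<sigma>1 = emitted rs [True] (\<sigma>(0 := bits a @ bits b @ r, 4 := True # True # k))"
  define \<sigma>2 where "\<sigma>2 = emitted rs (bits a) (\<sigma>1(0 := bits b @ r, 4 := True # k))"
  have rs: "0 \<notin> set rs" "4 \<notin> set rs" using assms(2) by auto
  have "emitted rs (bits b) (\<sigma>2(0 := r, 4 := k)) = emitted rs (bits (N a b)) (\<sigma>(0 := r, 4 := k))"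
  proof -
    have "parked (u @ v) = parked v @ parked u" for u v
      by (induction u) auto
    then show ?thesis using rs by (auto simp: emitted_def \<sigma>1_def \<sigma>2_def)
  qed
  with N.prems(3) have 3: "runs (scan_loop rs) (emitted rs (bits b) (\<sigma>2(0 := r, 4 := k))) \<sigma>' n"
    by (simp only:)
  have "\<sigma>2 0 = bits b @ r" "\<sigma>2 4 = True # k"
    using rs by (simp_all add: \<sigma>2_def emitted_def)
  from N.IH(2)[OF this 3]
  have 4: "runs (scan_loop rs) (emitted rs (bits a) (\<sigma>1(0 := bits b @ r, 4 := True # k))) \<sigma>'
      (n + (6 + 4 * length rs) * length (bits b))"
    unfolding \<sigma>2_def .
  have "\<sigma>1 0 = bits a @ bits b @ r" "\<sigma>1 4 = True # True # k"
    using rs by (simp_all add: \<sigma>1_def emitted_def)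
  from N.IH(1)[OF this 4] have 1: "runs (scan_loop rs) \<sigma>1 \<sigma>'
      (n + (6 + 4 * length rs) * length (bits b) + (6 + 4 * length rs) * length (bits a))" .
  have "runs (emit rs True) (\<sigma>(0 := bits a @ bits b @ r, 4 := True # True # k)) \<sigma>1 (1 + 4 * length rs)"
    unfolding \<sigma>1_def by (rule runs_emit) fact
  then have 5: "runs (If 0 (Some True)
     (Seq (Pop 0) (Seq (Push 4 True) (emit rs True)))
     (Seq (Pop 0) (Seq (Pop 4) (emit rs False)))) \<sigma> \<sigma>1 ?c"
    using N.prems by (intro runs_If1 runs_Seq[OF runs_Pop[OF _ refl, where b = True] runs_Seq[OF runs_Push[OF refl]]]) simp_all
  have "runs (scan_loop rs) \<sigma> \<sigma>' (?c +
      (n + (6 + 4 * length rs) * length (bits b) + (6 + 4 * length rs) * length (bits a)) + 1)"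
    unfolding scan_loop_def by (rule runs_While1[OF _ 5 1[unfolded scan_loop_def]]) (simp add: N.prems)
  then show ?case by (rule runs_mono) (auto simp: algebra_simps)
qed

definition scan :: "nat list \<Rightarrow> prog" where
  "scan rs = Seq (Push 4 True) (scan_loop rs)"

lemma runs_scan:
  assumes "distinct rs" "set rs \<subseteq> {2, 3}" "\<sigma> 0 = bits t @ r" "\<sigma> 4 = []"
  shows "runs (scan rs) \<sigma> (emitted rs (bits t) (\<sigma>(0 := r))) (3 + (6 + 4 * length rs) * length (bits t))"
proof -
  have rs: "0 \<notin> set rs" "4 \<notin> set rs" using assms(2) by auto
  let ?\<sigma>' = "emitted rs (bits t) (\<sigma>(0 := r))"
  have eq: "emitted rs (bits t) ((\<sigma>(4 := [True]))(0 := r, 4 := [])) = ?\<sigma>'"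
    using assms rs by (auto simp: emitted_def)
  have "runs (scan_loop rs) ?\<sigma>' ?\<sigma>' 1"
    unfolding scan_loop_def using assms rs by (intro runs_While2) (auto simp: emitted_def)
  then have "runs (scan_loop rs) (\<sigma>(4 := [True])) ?\<sigma>' (1 + (6 + 4 * length rs) * length (bits t))"
    using assms eq by (intro runs_scan_loop[where r = r and k = "[]"]) auto
  then show ?thesis unfolding scan_def
    by (intro runs_mono[OF runs_Seq[OF runs_Push]]) (use assms in auto)
qed

definition restore :: "nat \<Rightarrow> prog" where
  "restore a = Seq (While a (Some True)
     (Seq (Pop a) (Seq (If a (Some True) (Push 0 True) (Push 0 False)) (Pop a)))) (Pop a)"

lemma runs_restore:
  assumes "a \<noteq> 0" "\<sigma> a = parked bs @ False # k"
  shows "runs (restore a) \<sigma> (\<sigma>(a := k, 0 := bs @ \<sigma> 0)) (2 + 6 * length bs)"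
proof -
  let ?B = "Seq (Pop a) (Seq (If a (Some True) (Push 0 True) (Push 0 False)) (Pop a))"
  have "runs (While a (Some True) ?B) \<sigma> (\<sigma>(a := False # k, 0 := bs @ \<sigma> 0)) (1 + 6 * length bs)"
    using assms
  proof (induction bs arbitrary: \<sigma> rule: rev_induct)
    case Nil
    then have eq: "\<sigma>(a := False # k, 0 := [] @ \<sigma> 0) = \<sigma>" by auto
    show ?case unfolding eq using Nil by (intro runs_mono[OF runs_While2]) auto
  next
    case (snoc b bs)
    let ?\<sigma>1 = "\<sigma>(a := b # parked bs @ False # k)"
    let ?\<sigma>2 = "?\<sigma>1(0 := b # \<sigma> 0)"
    let ?\<sigma>3 = "?\<sigma>2(a := parked bs @ False # k)"
    have "runs (If a (Some True) (Push 0 True) (Push 0 False)) ?\<sigma>1 ?\<sigma>2 (2 + 1)"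
    proof (cases b)
      case True
      show ?thesis by (rule runs_If1) (use True \<open>a \<noteq> 0\<close> in \<open>auto intro!: runs_Push\<close>)
    next
      case False
      show ?thesis by (rule runs_If2) (use False \<open>a \<noteq> 0\<close> in \<open>auto intro!: runs_Push\<close>)
    qed
    then have "runs ?B \<sigma> ?\<sigma>3 (1 + ((2 + 1) + 1))"
      using snoc.prems by (intro runs_Seq) (auto intro!: runs_Pop'[simplified] simp: parked_snoc)
    moreover have "runs (While a (Some True) ?B) ?\<sigma>3 (?\<sigma>3(a := False # k, 0 := bs @ ?\<sigma>3 0)) (1 + 6 * length bs)"
      using snoc.prems by (intro snoc.IH) auto
    moreover have "?\<sigma>3(a := False # k, 0 := bs @ ?\<sigma>3 0) = \<sigma>(a := False # k, 0 := (bs @ [b]) @ \<sigma> 0)"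
      using snoc.prems by auto
    ultimately have "runs (While a (Some True) ?B) \<sigma> (\<sigma>(a := False # k, 0 := (bs @ [b]) @ \<sigma> 0))
        ((1 + ((2 + 1) + 1)) + (1 + 6 * length bs) + 1)"
      using snoc.prems by (intro runs_While1) (auto simp: parked_snoc)
    then show ?case by (rule runs_mono) auto
  qed
  moreover have "runs (Pop a) (\<sigma>(a := False # k, 0 := bs @ \<sigma> 0)) (\<sigma>(a := k, 0 := bs @ \<sigma> 0)) 1"
    using assms by (auto intro!: runs_Pop'[simplified])
  ultimately show ?thesis unfolding restore_def
    by (intro runs_mono[OF runs_Seq]) auto
qed

definition drop_top :: prog where
  "drop_top = scan []"

definition park_top :: prog where
  "park_top = Seq (Push 2 False) (scan [2])"

definition dup_top :: prog where
  "dup_top = Seq (Push 2 False) (Seq (Push 3 False) (Seq (scan [2, 3]) (Seq (restore 2) (restore 3))))"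

lemma runs_drop_top:
  assumes "\<sigma> 0 = bits t @ r" "\<sigma> 4 = []"
  shows "runs drop_top \<sigma> (\<sigma>(0 := r)) (3 + 6 * length (bits t))"
proof -
  have "emitted [] (bits t) (\<sigma>(0 := r)) = \<sigma>(0 := r)" by (auto simp: emitted_def)
  then show ?thesis using runs_scan[of "[]", OF _ _ assms] by (simp add: drop_top_def)
qed

lemma runs_park_top:
  assumes "\<sigma> 0 = bits t @ r" "\<sigma> 4 = []"
  shows "runs park_top \<sigma> (\<sigma>(0 := r, 2 := parked (bits t) @ False # \<sigma> 2)) (5 + 10 * length (bits t))"
proof -
  have "runs (scan [2]) (\<sigma>(2 := False # \<sigma> 2)) (emitted [2] (bits t) (\<sigma>(2 := False # \<sigma> 2, 0 := r)))
      (3 + 10 * length (bits t))"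
    using runs_scan[of "[2]" "\<sigma>(2 := False # \<sigma> 2)"] assms by simp
  moreover have "emitted [2] (bits t) (\<sigma>(2 := False # \<sigma> 2, 0 := r)) =
      \<sigma>(0 := r, 2 := parked (bits t) @ False # \<sigma> 2)"
    by (auto simp: emitted_def)
  ultimately show ?thesis unfolding park_top_def
    by (intro runs_mono[OF runs_Seq[OF runs_Push[OF refl]]]) auto
qed

lemma runs_dup_top:
  assumes "\<sigma> 0 = bits t @ r" "\<sigma> 4 = []"
  shows "runs dup_top \<sigma> (\<sigma>(0 := bits t @ bits t @ r)) (11 + 26 * length (bits t))"
proof -
  define \<sigma>1 where "\<sigma>1 = \<sigma>(2 := False # \<sigma> 2)"
  define \<sigma>2 where "\<sigma>2 = \<sigma>1(3 := False # \<sigma> 3)"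
  define \<sigma>3 where "\<sigma>3 = \<sigma>(0 := r, 2 := parked (bits t) @ False # \<sigma> 2, 3 := parked (bits t) @ False # \<sigma> 3)"
  define \<sigma>4 where "\<sigma>4 = \<sigma>3(2 := \<sigma> 2, 0 := bits t @ r)"
  have "runs (Push 2 False) \<sigma> \<sigma>1 2" "runs (Push 3 False) \<sigma>1 \<sigma>2 2"
    by (auto intro!: runs_Push simp: \<sigma>1_def \<sigma>2_def)
  moreover have "runs (scan [2, 3]) \<sigma>2 \<sigma>3 (3 + 14 * length (bits t))"
  proof -
    have "emitted [2, 3] (bits t) (\<sigma>2(0 := r)) = \<sigma>3"
      by (auto simp: emitted_def \<sigma>1_def \<sigma>2_def \<sigma>3_def)
    then show ?thesis using runs_scan[of "[2, 3]" \<sigma>2 t r] assms by (simp add: \<sigma>1_def \<sigma>2_def)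
  qed
  moreover have "runs (restore 2) \<sigma>3 \<sigma>4 (2 + 6 * length (bits t))"
    using runs_restore[of 2 \<sigma>3 "bits t" "\<sigma> 2"] by (simp add: \<sigma>3_def \<sigma>4_def)
  moreover have "runs (restore 3) \<sigma>4 (\<sigma>(0 := bits t @ bits t @ r)) (2 + 6 * length (bits t))"
  proof -
    have "\<sigma>4(3 := \<sigma> 3, 0 := bits t @ \<sigma>4 0) = \<sigma>(0 := bits t @ bits t @ r)"
      by (auto simp: \<sigma>3_def \<sigma>4_def)
    then show ?thesis
      using runs_restore[of 3 \<sigma>4 "bits t" "\<sigma> 3"] by (simp add: \<sigma>3_def \<sigma>4_def)
  qed
  ultimately show ?thesis unfolding dup_top_def
    by (intro runs_mono[OF runs_Seq[OF _ runs_Seq[OF _ runs_Seq[OF _ runs_Seq]]]]) auto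
qed

lemma regs_tree_progs:
  "regs drop_top \<subseteq> {0, 2, 3, 4}" "regs park_top \<subseteq> {0, 2, 3, 4}" "regs dup_top \<subseteq> {0, 2, 3, 4}"
  "regs (restore 2) \<subseteq> {0, 2, 3, 4}"
  using regs_emit[of "[]"] regs_emit[of "[2]"] regs_emit[of "[2, 3]"]
  by (auto simp: drop_top_def park_top_def dup_top_def restore_def scan_def scan_loop_def)


section \<open>Polynomial-time functions on coded types\<close>

text \<open>The frame condition makes programs composable: whatever lies below the argument or on
  registers 2 and 3 survives, so intermediate results can be parked there while another program
  runs, and all functions share the same tapes. Register 4 is the counter of \<open>scan\<close> and
  has to start empty. The bound on the size of the result is what makes the running times
  compose.\<close>

definition PT :: "('a :: coded \<Rightarrow> 'b :: coded) \<Rightarrow> bool" where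
  "PT f \<longleftrightarrow> (\<exists>P (p :: nat poly). regs P \<subseteq> {0, 2, 3, 4} \<and>
     (\<forall>x. sz (f x) \<le> poly p (sz x) \<and>
        (\<forall>\<sigma> r. \<sigma> 0 = bits (tr x) @ r \<longrightarrow> \<sigma> 4 = [] \<longrightarrow>
           runs P \<sigma> (\<sigma>(0 := bits (tr (f x)) @ r)) (poly p (sz x)))))"

lemma PT_I:
  assumes "regs P \<subseteq> {0, 2, 3, 4}" "poly_bounded g" "poly_bounded h"
    and "\<And>x. sz (f x) \<le> g (sz x)"
    and "\<And>x \<sigma> r. \<sigma> 0 = bits (tr x) @ r \<Longrightarrow> \<sigma> 4 = [] \<Longrightarrow>
      runs P \<sigma> (\<sigma>(0 := bits (tr (f x)) @ r)) (h (sz x))"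
  shows "PT f"
proof -
  obtain p q where p: "\<And>n. g n \<le> poly p n" and q: "\<And>n. h n \<le> poly q n"
    using assms(2,3) by (auto simp: poly_bounded_def)
  have "sz (f x) \<le> poly (p + q) (sz x)" for x
    using assms(4)[of x] p[of "sz x"] by simp
  moreover have "runs P \<sigma> (\<sigma>(0 := bits (tr (f x)) @ r)) (poly (p + q) (sz x))"
    if "\<sigma> 0 = bits (tr x) @ r" "\<sigma> 4 = []" for x \<sigma> r
    using q[of "sz x"] by (intro runs_mono[OF assms(5)[OF that]]) simp
  ultimately show ?thesis using assms(1) unfolding PT_def by blast
qed

lemma PT_E:
  assumes "PT f"
  obtains P p where "regs P \<subseteq> {0, 2, 3, 4}" "\<And>x. sz (f x) \<le> poly p (sz x)"
    "\<And>x \<sigma> r n. \<sigma> 0 = bits (tr x) @ r \<Longrightarrow> \<sigma> 4 = [] \<Longrightarrow> sz x \<le> n \<Longrightarrow>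
      runs P \<sigma> (\<sigma>(0 := bits (tr (f x)) @ r)) (poly p n)"
  using assms unfolding PT_def by (metis runs_mono poly_mono_nat)

lemma PT_size: "PT f \<Longrightarrow> \<exists>p. \<forall>x. sz (f x) \<le> poly p (sz x)"
  unfolding PT_def by blast

lemma PT_cong: "PT f \<Longrightarrow> (\<And>x. f x = g x) \<Longrightarrow> PT g"
  by (metis ext)

named_theorems PT_intros

lemma PT_id [PT_intros]: "PT (\<lambda>x. x)"
proof (rule PT_I[of Skip "\<lambda>n. n" "\<lambda>_. 1"])
  fix x :: 'a and \<sigma> :: "nat \<Rightarrow> bool list" and r assume "\<sigma> 0 = bits (tr x) @ r"
  then have "\<sigma>(0 := bits (tr x) @ r) = \<sigma>" by auto
  then show "runs Skip \<sigma> (\<sigma>(0 := bits (tr x) @ r)) 1" using runs_Skip[of \<sigma>] by (simp only:)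
qed (auto intro!: pb_intros)

text \<open>Programs see only codes, so constructors and conversions that leave the code unchanged
  cost nothing.\<close>

lemma PT_recode: "PT h \<Longrightarrow> (\<And>x. tr (f x) = tr (h x)) \<Longrightarrow> PT f"
  unfolding PT_def sz_def by simp

lemma PT_const [PT_intros]: "PT (\<lambda>_. c)"
proof (rule PT_I[of "Seq drop_top (pushes (bits (tr c)))" "\<lambda>_. sz c" "\<lambda>n. 4 + 2 * sz c + 6 * n"])
  fix x :: 'a and \<sigma> :: "nat \<Rightarrow> bool list" and r assume *: "\<sigma> 0 = bits (tr x) @ r" "\<sigma> 4 = []"
  have "runs (pushes (bits (tr c))) (\<sigma>(0 := r)) (\<sigma>(0 := bits (tr c) @ r)) (1 + 2 * length (bits (tr c)))"
    using runs_pushes[of "bits (tr c)" "\<sigma>(0 := r)"] by simp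
  from runs_Seq[OF runs_drop_top[OF *] this]
  show "runs (Seq drop_top (pushes (bits (tr c)))) \<sigma> (\<sigma>(0 := bits (tr c) @ r)) (4 + 2 * sz c + 6 * sz x)"
    by (rule runs_mono) (simp add: sz_def)
qed (use regs_tree_progs(1) regs_pushes[of "bits (tr c)"] in \<open>auto intro!: pb_intros\<close>)

lemma PT_compose:
  assumes "PT g" "PT f"
  shows "PT (\<lambda>x. g (f x))"
proof -
  obtain P p where P: "regs P \<subseteq> {0, 2, 3, 4}" "\<And>x. sz (f x) \<le> poly p (sz x)"
    "\<And>x \<sigma> r n. \<sigma> 0 = bits (tr x) @ r \<Longrightarrow> \<sigma> 4 = [] \<Longrightarrow> sz x \<le> n \<Longrightarrow>
      runs P \<sigma> (\<sigma>(0 := bits (tr (f x)) @ r)) (poly p n)"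
    by (rule PT_E[OF assms(2)]) (rule that)
  obtain Q q where Q: "regs Q \<subseteq> {0, 2, 3, 4}" "\<And>x. sz (g x) \<le> poly q (sz x)"
    "\<And>x \<sigma> r n. \<sigma> 0 = bits (tr x) @ r \<Longrightarrow> \<sigma> 4 = [] \<Longrightarrow> sz x \<le> n \<Longrightarrow>
      runs Q \<sigma> (\<sigma>(0 := bits (tr (g x)) @ r)) (poly q n)"
    by (rule PT_E[OF assms(1)]) (rule that)
  show ?thesis
  proof (rule PT_I[of "Seq P Q" "\<lambda>n. poly q (poly p n)" "\<lambda>n. poly p n + poly q (poly p n)"])
    fix x
    show "sz (g (f x)) \<le> poly q (poly p (sz x))"
      using Q(2)[of "f x"] poly_mono_nat[OF P(2)[of x], of q] by linarith
    fix \<sigma> :: "nat \<Rightarrow> bool list" and r assume *: "\<sigma> 0 = bits (tr x) @ r" "\<sigma> 4 = []"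
    have "runs Q (\<sigma>(0 := bits (tr (f x)) @ r)) (\<sigma>(0 := bits (tr (g (f x))) @ r)) (poly q (poly p (sz x)))"
      using Q(3)[of "\<sigma>(0 := bits (tr (f x)) @ r)" "f x" r] P(2) *(2) by simp
    from runs_Seq[OF P(3)[OF * le_refl] this]
    show "runs (Seq P Q) \<sigma> (\<sigma>(0 := bits (tr (g (f x))) @ r)) (poly p (sz x) + poly q (poly p (sz x)))" .
  qed (use P Q in \<open>auto intro!: pb_intros\<close>)
qed

text \<open>After duplicating the argument, the first result waits on register 2 while the second is
  computed. A final 1 turns the two adjacent codes into that of a node.\<close>

lemma PT_Pair [PT_intros]:
  assumes "PT f" "PT g"
  shows "PT (\<lambda>x. (f x, g x))"
proof -
  obtain P p where P: "regs P \<subseteq> {0, 2, 3, 4}" "\<And>x. sz (f x) \<le> poly p (sz x)"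
    "\<And>x \<sigma> r n. \<sigma> 0 = bits (tr x) @ r \<Longrightarrow> \<sigma> 4 = [] \<Longrightarrow> sz x \<le> n \<Longrightarrow>
      runs P \<sigma> (\<sigma>(0 := bits (tr (f x)) @ r)) (poly p n)"
    by (rule PT_E[OF assms(1)]) (rule that)
  obtain Q q where Q: "regs Q \<subseteq> {0, 2, 3, 4}" "\<And>x. sz (g x) \<le> poly q (sz x)"
    "\<And>x \<sigma> r n. \<sigma> 0 = bits (tr x) @ r \<Longrightarrow> \<sigma> 4 = [] \<Longrightarrow> sz x \<le> n \<Longrightarrow>
      runs Q \<sigma> (\<sigma>(0 := bits (tr (g x)) @ r)) (poly q n)"
    by (rule PT_E[OF assms(2)]) (rule that)
  let ?R = "Seq dup_top (Seq P (Seq park_top (Seq Q (Seq (restore 2) (Push 0 True)))))"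
  show ?thesis
  proof (rule PT_I[of ?R "\<lambda>n. 1 + poly p n + poly q n"
        "\<lambda>n. (11 + 26 * n) + (poly p n + ((5 + 10 * poly p n) + (poly q n + ((2 + 6 * poly p n) + 2))))"])
    fix x
    show "sz (f x, g x) \<le> 1 + poly p (sz x) + poly q (sz x)"
      using P(2)[of x] Q(2)[of x] by simp
    fix \<sigma> :: "nat \<Rightarrow> bool list" and r assume *: "\<sigma> 0 = bits (tr x) @ r" "\<sigma> 4 = []"
    let ?X = "bits (tr x)" and ?F = "bits (tr (f x))" and ?G = "bits (tr (g x))"
    define \<sigma>1 where "\<sigma>1 = \<sigma>(0 := ?X @ ?X @ r)"
    define \<sigma>2 where "\<sigma>2 = \<sigma>1(0 := ?F @ ?X @ r)"
    define \<sigma>3 where "\<sigma>3 = \<sigma>2(0 := ?X @ r, 2 := parked ?F @ False # \<sigma>2 2)"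
    define \<sigma>4 where "\<sigma>4 = \<sigma>3(0 := ?G @ r)"
    define \<sigma>5 where "\<sigma>5 = \<sigma>4(2 := \<sigma> 2, 0 := ?F @ \<sigma>4 0)"
    have 1: "runs dup_top \<sigma> \<sigma>1 (11 + 26 * sz x)"
      unfolding \<sigma>1_def sz_def by (rule runs_dup_top[OF *])
    have 2: "runs P \<sigma>1 \<sigma>2 (poly p (sz x))"
      unfolding \<sigma>2_def by (rule P(3)) (auto simp: \<sigma>1_def *)
    have 3: "runs park_top \<sigma>2 \<sigma>3 (5 + 10 * poly p (sz x))"
      unfolding \<sigma>3_def using P(2)[of x]
      by (intro runs_mono[OF runs_park_top]) (auto simp: \<sigma>1_def \<sigma>2_def sz_def *)
    have 4: "runs Q \<sigma>3 \<sigma>4 (poly q (sz x))"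
      unfolding \<sigma>4_def by (rule Q(3)) (auto simp: \<sigma>1_def \<sigma>2_def \<sigma>3_def *)
    have 5: "runs (restore 2) \<sigma>4 \<sigma>5 (2 + 6 * poly p (sz x))"
      unfolding \<sigma>5_def using P(2)[of x]
      by (intro runs_mono[OF runs_restore]) (auto simp: \<sigma>1_def \<sigma>2_def \<sigma>3_def \<sigma>4_def sz_def)
    have 6: "runs (Push 0 True) \<sigma>5 (\<sigma>(0 := bits (tr (f x, g x)) @ r)) 2"
      by (rule runs_Push) (auto simp: \<sigma>1_def \<sigma>2_def \<sigma>3_def \<sigma>4_def \<sigma>5_def)
    show "runs ?R \<sigma> (\<sigma>(0 := bits (tr (f x, g x)) @ r)) ((11 + 26 * sz x) + (poly p (sz x) +
        ((5 + 10 * poly p (sz x)) + (poly q (sz x) + ((2 + 6 * poly p (sz x)) + 2)))))"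
      by (rule runs_Seq[OF 1 runs_Seq[OF 2 runs_Seq[OF 3 runs_Seq[OF 4 runs_Seq[OF 5 6]]]]])
  qed (use P(1) Q(1) regs_tree_progs in \<open>auto intro!: pb_intros\<close>)
qed

lemma PT_tleft_raw:
  fixes f :: "'a :: coded \<Rightarrow> 'b :: coded"
  assumes "\<And>x. tr (f x) = tleft (tr x)"
  shows "PT f"
proof (rule PT_I[of "If 0 (Some True) (Seq (Pop 0) (Seq park_top (Seq drop_top (restore 2)))) Skip"
      "\<lambda>n. n" "\<lambda>n. (1 + ((5 + 10 * n) + ((3 + 6 * n) + (2 + 6 * n)))) + 1"])
  fix x
  show "sz (f x) \<le> sz x" unfolding sz_def assms by (cases "tr x") auto
  fix \<sigma> :: "nat \<Rightarrow> bool list" and r assume *: "\<sigma> 0 = bits (tr x) @ r" "\<sigma> 4 = []"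
  show "runs (If 0 (Some True) (Seq (Pop 0) (Seq park_top (Seq drop_top (restore 2)))) Skip) \<sigma>
      (\<sigma>(0 := bits (tr (f x)) @ r)) ((1 + ((5 + 10 * sz x) + ((3 + 6 * sz x) + (2 + 6 * sz x)))) + 1)"
  proof (cases "tr x")
    case L
    then have eq: "\<sigma>(0 := bits (tr (f x)) @ r) = \<sigma>" using * by (auto simp: assms)
    show ?thesis unfolding eq
      by (rule runs_mono[OF runs_If2[OF _ runs_Skip]]) (use * L in auto)
  next
    case (N a b)
    define \<sigma>1 where "\<sigma>1 = \<sigma>(0 := bits a @ bits b @ r)"
    define \<sigma>2 where "\<sigma>2 = \<sigma>1(0 := bits b @ r, 2 := parked (bits a) @ False # \<sigma>1 2)"
    define \<sigma>3 where "\<sigma>3 = \<sigma>2(0 := r)"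
    have 1: "runs (Pop 0) \<sigma> \<sigma>1 1"
      by (rule runs_Pop) (auto simp: * N \<sigma>1_def)
    have 2: "runs park_top \<sigma>1 \<sigma>2 (5 + 10 * sz x)"
      unfolding \<sigma>2_def
      by (intro runs_mono[OF runs_park_top]) (auto simp: \<sigma>1_def sz_def * N)
    have 3: "runs drop_top \<sigma>2 \<sigma>3 (3 + 6 * sz x)"
      unfolding \<sigma>3_def
      by (intro runs_mono[OF runs_drop_top]) (auto simp: \<sigma>1_def \<sigma>2_def sz_def * N)
    have eq: "\<sigma>(0 := bits (tr (f x)) @ r) = \<sigma>3(2 := \<sigma> 2, 0 := bits a @ \<sigma>3 0)"
      by (auto simp: assms N \<sigma>1_def \<sigma>2_def \<sigma>3_def)
    have 4: "runs (restore 2) \<sigma>3 (\<sigma>(0 := bits (tr (f x)) @ r)) (2 + 6 * sz x)"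
      unfolding eq
      by (intro runs_mono[OF runs_restore]) (auto simp: \<sigma>1_def \<sigma>2_def \<sigma>3_def sz_def N)
    show ?thesis
      by (rule runs_If1[OF _ runs_Seq[OF 1 runs_Seq[OF 2 runs_Seq[OF 3 4]]]]) (simp add: * N)
  qed
qed (use regs_tree_progs in \<open>auto intro!: pb_intros\<close>)

lemma PT_tright_raw:
  fixes f :: "'a :: coded \<Rightarrow> 'b :: coded"
  assumes "\<And>x. tr (f x) = tright (tr x)"
  shows "PT f"
proof (rule PT_I[of "If 0 (Some True) (Seq (Pop 0) drop_top) Skip" "\<lambda>n. n" "\<lambda>n. (1 + (3 + 6 * n)) + 1"])
  fix x
  show "sz (f x) \<le> sz x" unfolding sz_def assms by (cases "tr x") auto
  fix \<sigma> :: "nat \<Rightarrow> bool list" and r assume *: "\<sigma> 0 = bits (tr x) @ r" "\<sigma> 4 = []"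
  show "runs (If 0 (Some True) (Seq (Pop 0) drop_top) Skip) \<sigma>
      (\<sigma>(0 := bits (tr (f x)) @ r)) ((1 + (3 + 6 * sz x)) + 1)"
  proof (cases "tr x")
    case L
    then have eq: "\<sigma>(0 := bits (tr (f x)) @ r) = \<sigma>" using * by (auto simp: assms)
    show ?thesis unfolding eq
      by (rule runs_mono[OF runs_If2[OF _ runs_Skip]]) (use * L in auto)
  next
    case (N a b)
    define \<sigma>1 where "\<sigma>1 = \<sigma>(0 := bits a @ bits b @ r)"
    have 1: "runs (Pop 0) \<sigma> \<sigma>1 1"
      by (rule runs_Pop) (auto simp: * N \<sigma>1_def)
    have eq: "\<sigma>(0 := bits (tr (f x)) @ r) = \<sigma>1(0 := bits b @ r)"
      by (auto simp: assms N \<sigma>1_def)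
    have 2: "runs drop_top \<sigma>1 (\<sigma>(0 := bits (tr (f x)) @ r)) (3 + 6 * sz x)"
      unfolding eq
      by (intro runs_mono[OF runs_drop_top]) (auto simp: \<sigma>1_def sz_def * N)
    show ?thesis
      by (rule runs_If1[OF _ runs_Seq[OF 1 2]]) (simp add: * N)
  qed
qed (use regs_tree_progs in \<open>auto intro!: pb_intros\<close>)

lemma PT_is_leaf_raw:
  fixes f :: "'a :: coded \<Rightarrow> bool"
  assumes "\<And>x. f x \<longleftrightarrow> tr x = L"
  shows "PT f"
proof (rule PT_I[of "If 0 (Some True) (Seq drop_top (pushes (bits (tr False)))) (Seq drop_top (pushes (bits (tr True))))"
      "\<lambda>n. 5" "\<lambda>n. ((3 + 6 * n) + 11) + 1"])
  fix x
  show "sz (f x) \<le> 5" by simp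
  have p: "runs (pushes (bits (tr b))) \<sigma> (\<sigma>(0 := bits (tr b) @ \<sigma> 0)) 11" for b :: bool and \<sigma>
    by (rule runs_mono[OF runs_pushes]) (simp add: tr_bool_def)
  fix \<sigma> :: "nat \<Rightarrow> bool list" and r assume *: "\<sigma> 0 = bits (tr x) @ r" "\<sigma> 4 = []"
  have d: "runs drop_top \<sigma> (\<sigma>(0 := r)) (3 + 6 * sz x)"
    using runs_drop_top[OF *] by (simp add: sz_def)
  have s: "runs (Seq drop_top (pushes (bits (tr b)))) \<sigma> (\<sigma>(0 := bits (tr b) @ r)) ((3 + 6 * sz x) + 11)" for b :: bool
    using runs_Seq[OF d p[of b "\<sigma>(0 := r)"]] by simp
  show "runs (If 0 (Some True) (Seq drop_top (pushes (bits (tr False)))) (Seq drop_top (pushes (bits (tr True)))))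
     \<sigma> (\<sigma>(0 := bits (tr (f x)) @ r)) (((3 + 6 * sz x) + 11) + 1)"
  proof (cases "tr x")
    case L
    then have "f x = True" by (simp add: assms)
    then show ?thesis by (simp only:) (rule runs_If2[OF _ s], simp add: * L)
  next
    case (N a b)
    then have "f x = False" by (simp add: assms)
    then show ?thesis by (simp only:) (rule runs_If1[OF _ s], simp add: * N)
  qed
qed (use regs_tree_progs regs_pushes[of "bits (tr True)"] regs_pushes[of "bits (tr False)"]
    in \<open>auto intro!: pb_intros\<close>)

lemma PT_fst [PT_intros]: "PT f \<Longrightarrow> PT (\<lambda>x. fst (f x))"
  by (rule PT_compose[of fst], rule PT_tleft_raw) (simp_all add: tr_prod_def)

lemma PT_snd [PT_intros]: "PT f \<Longrightarrow> PT (\<lambda>x. snd (f x))"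
  by (rule PT_compose[of snd], rule PT_tright_raw) (simp_all add: tr_prod_def)

lemma PT_tleft [PT_intros]: "PT f \<Longrightarrow> PT (\<lambda>x. tleft (f x))"
  by (rule PT_compose[of tleft], rule PT_tleft_raw) simp_all

lemma PT_tright [PT_intros]: "PT f \<Longrightarrow> PT (\<lambda>x. tright (f x))"
  by (rule PT_compose[of tright], rule PT_tright_raw) simp_all

lemma PT_tr [PT_intros]: "PT f \<Longrightarrow> PT (\<lambda>x. tr (f x))"
  by (erule PT_recode) simp

lemma PT_is_leaf [PT_intros]: "PT f \<Longrightarrow> PT (\<lambda>x. f x = L)"
  by (rule PT_compose[of "\<lambda>t. t = L"], rule PT_is_leaf_raw) simp_all

lemma PT_N [PT_intros]: "PT f \<Longrightarrow> PT g \<Longrightarrow> PT (\<lambda>x. N (f x) (g x))"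
  by (rule PT_recode[of "\<lambda>x. (f x, g x)"], rule PT_Pair) auto

lemma PT_Cons [PT_intros]: "PT f \<Longrightarrow> PT g \<Longrightarrow> PT (\<lambda>x. f x # g x)"
  by (rule PT_recode[of "\<lambda>x. (f x, g x)"], rule PT_Pair) auto

lemma tr_list_L: "tr (xs :: 'a :: coded list) = L \<longleftrightarrow> xs = []"
  by (cases xs) auto

lemma PT_Nil_test [PT_intros]: "PT f \<Longrightarrow> PT (\<lambda>x. f x = [])"
  by (rule PT_compose[of "\<lambda>xs. xs = []"], rule PT_is_leaf_raw) (simp_all add: tr_list_L)

lemma PT_tl [PT_intros]: "PT f \<Longrightarrow> PT (\<lambda>x. tl (f x))"
proof (rule PT_compose[of tl], rule PT_tright_raw)
  show "tr (tl xs) = tright (tr xs)" for xs :: "'b list" by (cases xs) auto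
qed

fun popn :: "nat \<Rightarrow> prog" where
  "popn 0 = Skip"
| "popn (Suc n) = Seq (Pop 0) (popn n)"

lemma runs_popn: "\<sigma> 0 = xs @ r \<Longrightarrow> runs (popn (length xs)) \<sigma> (\<sigma>(0 := r)) (1 + length xs)"
proof (induction xs arbitrary: \<sigma>)
  case Nil
  then have "\<sigma>(0 := r) = \<sigma>" by auto
  then show ?case using runs_Skip[of \<sigma>] by simp
next
  case (Cons x xs)
  define \<sigma>1 where "\<sigma>1 = \<sigma>(0 := xs @ r)"
  have 1: "\<sigma>1(0 := r) = \<sigma>(0 := r)" by (simp add: \<sigma>1_def)
  have 2: "runs (popn (length xs)) \<sigma>1 (\<sigma>(0 := r)) (1 + length xs)"
    unfolding 1[symmetric] by (rule Cons.IH) (simp add: \<sigma>1_def)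
  have 3: "runs (Pop 0) \<sigma> \<sigma>1 1"
    using Cons.prems by (intro runs_Pop') (simp_all add: \<sigma>1_def)
  from runs_Seq[OF 3 2] show ?case by (simp del: fun_upd_apply)
qed

lemma regs_popn: "regs (popn n) \<subseteq> {0}"
  by (induction n) auto

lemma PT_if [PT_intros]:
  assumes "PT b" "PT f" "PT g"
  shows "PT (\<lambda>x. if b x then f x else g x)"
proof -
  obtain B b' where B: "regs B \<subseteq> {0, 2, 3, 4}" "\<And>x. sz (b x, x) \<le> poly b' (sz x)"
    "\<And>x \<sigma> r n. \<sigma> 0 = bits (tr x) @ r \<Longrightarrow> \<sigma> 4 = [] \<Longrightarrow> sz x \<le> n \<Longrightarrow>
      runs B \<sigma> (\<sigma>(0 := bits (tr (b x, x)) @ r)) (poly b' n)"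
    by (rule PT_E[OF PT_Pair[OF assms(1) PT_id]]) (rule that)
  obtain P p where P: "regs P \<subseteq> {0, 2, 3, 4}" "\<And>x. sz (f x) \<le> poly p (sz x)"
    "\<And>x \<sigma> r n. \<sigma> 0 = bits (tr x) @ r \<Longrightarrow> \<sigma> 4 = [] \<Longrightarrow> sz x \<le> n \<Longrightarrow>
      runs P \<sigma> (\<sigma>(0 := bits (tr (f x)) @ r)) (poly p n)"
    by (rule PT_E[OF assms(2)]) (rule that)
  obtain Q q where Q: "regs Q \<subseteq> {0, 2, 3, 4}" "\<And>x. sz (g x) \<le> poly q (sz x)"
    "\<And>x \<sigma> r n. \<sigma> 0 = bits (tr x) @ r \<Longrightarrow> \<sigma> 4 = [] \<Longrightarrow> sz x \<le> n \<Longrightarrow>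
      runs Q \<sigma> (\<sigma>(0 := bits (tr (g x)) @ r)) (poly q n)"
    by (rule PT_E[OF assms(3)]) (rule that)
  let ?R = "Seq B (Seq (popn 2) (If 0 (Some True) (Seq (popn 4) P) (Seq (popn 4) Q)))"
  show ?thesis
  proof (rule PT_I[of ?R "\<lambda>n. poly p n + poly q n" "\<lambda>n. poly b' n + (3 + ((5 + (poly p n + poly q n)) + 1))"])
    fix x
    show "sz (if b x then f x else g x) \<le> poly p (sz x) + poly q (sz x)"
      using P(2)[of x] Q(2)[of x] by simp
    fix \<sigma> :: "nat \<Rightarrow> bool list" and r assume *: "\<sigma> 0 = bits (tr x) @ r" "\<sigma> 4 = []"
    \<comment> \<open>The third bit of the code of \<open>(b x, x)\<close> is the truth value. Two
      bits precede it, and four bits, itself included, separate it from the code of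
      \<open>x\<close>; these counts are the same for both truth values.\<close>
    define w where "w = b x # (if b x then [False, False, False] else [True, False, False]) @ bits (tr x) @ r"
    define \<sigma>1 where "\<sigma>1 = \<sigma>(0 := bits (tr (b x, x)) @ r)"
    define \<sigma>2 where "\<sigma>2 = \<sigma>1(0 := w)"
    have w: "bits (tr (b x, x)) @ r = True # True # w"
      by (simp add: w_def tr_bool_def)
    have 1: "runs B \<sigma> \<sigma>1 (poly b' (sz x))"
      unfolding \<sigma>1_def by (rule B(3)[OF * le_refl])
    have 2: "runs (popn 2) \<sigma>1 \<sigma>2 3"
    proof -
      have "\<sigma>1 0 = [True, True] @ w" unfolding \<sigma>1_def using w by simp
      from runs_popn[of \<sigma>1 "[True, True]" w, OF this] show ?thesis unfolding \<sigma>2_def by (simp only: list.size) (simp add: numeral_2_eq_2 numeral_3_eq_3)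
    qed
    have 3: "runs (popn 4) \<sigma>2 \<sigma> 5"
    proof -
      have "\<sigma>2(0 := bits (tr x) @ r) = \<sigma>" using * by (auto simp: \<sigma>2_def \<sigma>1_def)
      then show ?thesis
        using runs_popn[of \<sigma>2 "b x # (if b x then [False, False, False] else [True, False, False])" "bits (tr x) @ r"]
        by (simp add: \<sigma>2_def w_def numeral_eq_Suc split: if_splits)
    qed
    have 4: "runs (If 0 (Some True) (Seq (popn 4) P) (Seq (popn 4) Q)) \<sigma>2
       (\<sigma>(0 := bits (tr (if b x then f x else g x)) @ r)) ((5 + (poly p (sz x) + poly q (sz x))) + 1)"
    proof (cases "b x")
      case True
      then show ?thesis
        by (simp only: if_True) (rule runs_If1, simp add: \<sigma>2_def w_def,
            rule runs_Seq[OF 3 runs_mono[OF P(3)[OF * le_refl]]], simp)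
    next
      case False
      then show ?thesis
        by (simp only: if_False) (rule runs_If2, simp add: \<sigma>2_def w_def,
            rule runs_Seq[OF 3 runs_mono[OF Q(3)[OF * le_refl]]], simp)
    qed
    show "runs ?R \<sigma> (\<sigma>(0 := bits (tr (if b x then f x else g x)) @ r))
        (poly b' (sz x) + (3 + ((5 + (poly p (sz x) + poly q (sz x))) + 1)))"
      by (rule runs_Seq[OF 1 runs_Seq[OF 2 4]])
  qed (use B(1) P(1) Q(1) regs_popn[of 2] regs_popn[of 4] in \<open>auto intro!: pb_intros\<close>)
qed

lemma PT_hd [PT_intros]:
  assumes "PT f"
  shows "PT (\<lambda>x. hd (f x))"
proof -
  \<comment> \<open>The value \<open>hd []\<close> is unspecified but fixed, so its code can be a
    constant of the program.\<close>
  have "PT (\<lambda>xs :: 'b list. if xs = [] then tr (hd [] :: 'b) else tleft (tr xs))"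
    by (intro PT_intros)
  then have "PT (hd :: 'b list \<Rightarrow> 'b)"
    by (rule PT_recode) (auto simp: neq_Nil_conv)
  from PT_compose[OF this assms] show ?thesis .
qed

lemma PT_bool_ops [PT_intros]:
  assumes "PT f"
  shows "PT (\<lambda>x. \<not> f x)" "PT g \<Longrightarrow> PT (\<lambda>x. f x \<and> g x)" "PT g \<Longrightarrow> PT (\<lambda>x. f x \<or> g x)"
    "PT g \<Longrightarrow> PT (\<lambda>x. f x \<longrightarrow> g x)" "PT g \<Longrightarrow> PT (\<lambda>x. f x = g x)"
proof -
  show "PT (\<lambda>x. \<not> f x)"
    by (rule PT_cong[OF PT_if[OF assms PT_const[of False] PT_const[of True]]]) auto
  assume g: "PT g"
  show "PT (\<lambda>x. f x \<and> g x)"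
    by (rule PT_cong[OF PT_if[OF assms g PT_const[of False]]]) auto
  show "PT (\<lambda>x. f x \<or> g x)"
    by (rule PT_cong[OF PT_if[OF assms PT_const[of True] g]]) auto
  show "PT (\<lambda>x. f x \<longrightarrow> g x)"
    by (rule PT_cong[OF PT_if[OF assms g PT_const[of True]]]) auto
  show "PT (\<lambda>x. f x = g x)"
    by (rule PT_cong[OF PT_if[OF assms g PT_if[OF g PT_const[of False] PT_const[of True]]]]) auto
qed

text \<open>The loop keeps the triple of remaining list, parameter and accumulator on register 0
  without its leading 1. The top bit is then the first bit of the code of the list and tells whether
  the list is empty; the body puts the 1 back before the step and removes it afterwards. The size
  bound concerns only accumulators that occur after a prefix of the actual list.\<close>

lemma PT_foldl_bound:
  fixes f :: "'z :: coded \<Rightarrow> 'acc :: coded \<Rightarrow> 'e :: coded \<Rightarrow> 'acc"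
  assumes "PT (\<lambda>t :: 'z \<times> 'acc \<times> 'e. f (fst t) (fst (snd t)) (snd (snd t)))"
    and "PT a" "PT xs" "poly_bounded B"
    and bound: "\<And>z pre post. xs z = pre @ post \<Longrightarrow> sz (foldl (f z) (a z) pre) \<le> B (sz z)"
  shows "PT (\<lambda>z. foldl (f z) (a z) (xs z))"
proof -
  let ?st = "\<lambda>t :: 'e list \<times> 'z \<times> 'acc.
    (tl (fst t), fst (snd t), f (fst (snd t)) (snd (snd t)) (hd (fst t)))"
  have "PT (\<lambda>t :: 'e list \<times> 'z \<times> 'acc. (\<lambda>t :: 'z \<times> 'acc \<times> 'e. f (fst t) (fst (snd t)) (snd (snd t)))
      (fst (snd t), snd (snd t), hd (fst t)))"
    by (rule PT_compose[OF assms(1)]) (intro PT_intros)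
  then have "PT ?st" by (intro PT_intros) simp
  then obtain S s where S: "regs S \<subseteq> {0, 2, 3, 4}"
    "\<And>x \<sigma> r n. \<sigma> 0 = bits (tr x) @ r \<Longrightarrow> \<sigma> 4 = [] \<Longrightarrow> sz x \<le> n \<Longrightarrow>
      runs S \<sigma> (\<sigma>(0 := bits (tr (?st x)) @ r)) (poly s n)"
    by (metis (no_types, lifting) PT_E)
  obtain Q q where Q: "regs Q \<subseteq> {0, 2, 3, 4}" "\<And>z. sz (xs z, z, a z) \<le> poly q (sz z)"
    "\<And>x \<sigma> r n. \<sigma> 0 = bits (tr x) @ r \<Longrightarrow> \<sigma> 4 = [] \<Longrightarrow> sz x \<le> n \<Longrightarrow>
      runs Q \<sigma> (\<sigma>(0 := bits (tr (xs x, x, a x)) @ r)) (poly q n)"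
    by (rule PT_E[OF PT_Pair[OF assms(3) PT_Pair[OF PT_id assms(2)]]]) (rule that)
  obtain b where b: "\<And>n. B n \<le> poly b n" using assms(4) by (auto simp: poly_bounded_def)
  define body where "body = Seq (Push 0 True) (Seq S (Pop 0))"
  define F where "F = Seq Q (Seq (Pop 0) (Seq (While 0 (Some True) body) (Pop 0)))"
  define c where "c n = 2 + (poly s (poly q n + n + B n + 2) + 1) + 1" for n
  have "PT (\<lambda>z. (z, foldl (f z) (a z) (xs z)))"
  proof (rule PT_I[of F "\<lambda>n. 1 + n + B n" "\<lambda>n. poly q n + (1 + ((poly q n * c n + 1) + 1))"])
    fix z
    show "sz (z, foldl (f z) (a z) (xs z)) \<le> 1 + sz z + B (sz z)"
      using bound[of z "xs z" "[]"] by simp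
    fix \<sigma> :: "nat \<Rightarrow> bool list" and r assume *: "\<sigma> 0 = bits (tr z) @ r" "\<sigma> 4 = []"
    have loop: "runs (While 0 (Some True) body) (\<sigma>(0 := bits (tr es) @ bits (tr (z, foldl (f z) (a z) pre)) @ r))
       (\<sigma>(0 := False # bits (tr (z, foldl (f z) (a z) (xs z))) @ r)) (length es * c (sz z) + 1)"
      if "xs z = pre @ es" for es pre
      using that
    proof (induction es arbitrary: pre)
      case Nil
      then have "bits (tr ([] :: 'e list)) @ bits (tr (z, foldl (f z) (a z) pre)) @ r =
          False # bits (tr (z, foldl (f z) (a z) (xs z))) @ r" by simp
      then show ?case by (simp only:) (rule runs_mono[OF runs_While2], simp_all)
    next
      case (Cons e es)
      let ?acc = "foldl (f z) (a z) pre"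
      let ?acc' = "foldl (f z) (a z) (pre @ [e])"
      define \<sigma>1 where "\<sigma>1 = \<sigma>(0 := bits (tr (e # es)) @ bits (tr (z, ?acc)) @ r)"
      define \<sigma>2 where "\<sigma>2 = \<sigma>(0 := bits (tr (e # es, z, ?acc)) @ r)"
      define \<sigma>3 where "\<sigma>3 = \<sigma>2(0 := bits (tr (?st (e # es, z, ?acc))) @ r)"
      define \<sigma>4 where "\<sigma>4 = \<sigma>(0 := bits (tr es) @ bits (tr (z, ?acc')) @ r)"
      have "sz (e # es) \<le> poly q (sz z)"
        using Q(2)[of z] Cons.prems sz_pos[of pre] by simp
      moreover have "sz ?acc \<le> B (sz z)" using bound[OF Cons.prems] .
      ultimately have sz: "sz (e # es, z, ?acc) \<le> poly q (sz z) + sz z + B (sz z) + 2"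
        by simp
      have 1: "runs (Push 0 True) \<sigma>1 \<sigma>2 2"
        by (rule runs_Push) (auto simp: \<sigma>1_def \<sigma>2_def)
      have 2: "runs S \<sigma>2 \<sigma>3 (poly s (poly q (sz z) + sz z + B (sz z) + 2))"
        unfolding \<sigma>3_def by (rule S(2)[OF _ _ sz]) (simp_all add: \<sigma>2_def *)
      have 3: "runs (Pop 0) \<sigma>3 \<sigma>4 1"
        by (rule runs_Pop[where b = True]) (auto simp: \<sigma>3_def \<sigma>2_def \<sigma>4_def)
      have 4: "runs (While 0 (Some True) body) \<sigma>4 (\<sigma>(0 := False # bits (tr (z, foldl (f z) (a z) (xs z))) @ r))
          (length es * c (sz z) + 1)"
        unfolding \<sigma>4_def using Cons.prems by (intro Cons.IH) auto
      have "runs body \<sigma>1 \<sigma>4 (2 + (poly s (poly q (sz z) + sz z + B (sz z) + 2) + 1))"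
        unfolding body_def by (rule runs_Seq[OF 1 runs_Seq[OF 2 3]])
      from runs_While1[OF _ this 4] show ?case
        unfolding \<sigma>1_def[symmetric] by (rule runs_mono) (auto simp: c_def \<sigma>1_def)
    qed
    define \<sigma>1 where "\<sigma>1 = \<sigma>(0 := bits (tr (xs z, z, a z)) @ r)"
    define \<sigma>2 where "\<sigma>2 = \<sigma>(0 := bits (tr (xs z)) @ bits (tr (z, a z)) @ r)"
    define \<sigma>3 where "\<sigma>3 = \<sigma>(0 := False # bits (tr (z, foldl (f z) (a z) (xs z))) @ r)"
    have 1: "runs Q \<sigma> \<sigma>1 (poly q (sz z))"
      unfolding \<sigma>1_def by (rule Q(3)[OF * le_refl])
    have 2: "runs (Pop 0) \<sigma>1 \<sigma>2 1"
      by (rule runs_Pop[where b = True]) (auto simp: \<sigma>1_def \<sigma>2_def)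
    have "length (xs z) \<le> poly q (sz z)"
      using Q(2)[of z] length_le_sz[of "xs z"] by simp
    then have 3: "runs (While 0 (Some True) body) \<sigma>2 \<sigma>3 (poly q (sz z) * c (sz z) + 1)"
      unfolding \<sigma>2_def \<sigma>3_def using runs_mono[OF loop[of "[]" "xs z"], of "poly q (sz z) * c (sz z) + 1"]
      by simp
    have 4: "runs (Pop 0) \<sigma>3 (\<sigma>(0 := bits (tr (z, foldl (f z) (a z) (xs z))) @ r)) 1"
      by (rule runs_Pop[where b = False]) (auto simp: \<sigma>3_def)
    show "runs F \<sigma> (\<sigma>(0 := bits (tr (z, foldl (f z) (a z) (xs z))) @ r))
        (poly q (sz z) + (1 + ((poly q (sz z) * c (sz z) + 1) + 1)))"
      unfolding F_def by (rule runs_Seq[OF 1 runs_Seq[OF 2 runs_Seq[OF 3 4]]])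
  next
    show "poly_bounded (\<lambda>n. poly q n + (1 + ((poly q n * c n + 1) + 1)))"
      unfolding c_def by (intro pb_intros assms(4))
  qed (use S(1) Q(1) in \<open>auto intro!: pb_intros assms(4) simp: F_def body_def\<close>)
  then have "PT (\<lambda>z. snd (z, foldl (f z) (a z) (xs z)))" by (rule PT_snd)
  then show ?thesis by simp
qed

text \<open>
  The growth condition of bounded recursion: up to a polynomial change of size measure, each step
  adds an amount that does not depend on the accumulator.
\<close>

lemma PT_foldl_measure:
  fixes f :: "'z :: coded \<Rightarrow> 'acc :: coded \<Rightarrow> 'e :: coded \<Rightarrow> 'acc"
  assumes "PT (\<lambda>t :: 'z \<times> 'acc \<times> 'e. f (fst t) (fst (snd t)) (snd (snd t)))"
    and "PT a" "PT xs"
    and "poly_bounded g" "poly_bounded h"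
    and \<mu>: "\<And>acc. sz acc \<le> c * \<mu> acc" "\<And>acc. \<mu> acc \<le> h (sz acc)"
    and step: "\<And>z acc e. \<mu> (f z acc e) \<le> \<mu> acc + g (sz z + sz e)"
  shows "PT (\<lambda>z. foldl (f z) (a z) (xs z))"
proof -
  obtain g' where g': "\<And>n. g n \<le> poly g' n" using assms(4) by (auto simp: poly_bounded_def)
  obtain h' where h': "\<And>n. h n \<le> poly h' n" using assms(5) by (auto simp: poly_bounded_def)
  obtain p where p: "\<And>z. sz (xs z) \<le> poly p (sz z)" using PT_size[OF assms(3)] by blast
  obtain q where q: "\<And>z. sz (a z) \<le> poly q (sz z)" using PT_size[OF assms(2)] by blast
  define B where "B n = c * (poly h' (poly q n) + poly p n * poly g' (n + poly p n))" for n
  show ?thesis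
  proof (rule PT_foldl_bound[OF assms(1-3)])
    show "poly_bounded B" unfolding B_def by (intro pb_intros)
    fix z pre post assume xs: "xs z = pre @ post"
    have "\<mu> (foldl (f z) (a z) pre) \<le> \<mu> (a z) + length pre * poly g' (sz z + poly p (sz z))"
      using xs
    proof (induction pre arbitrary: post rule: rev_induct)
      case (snoc e pre)
      have "sz e \<le> poly p (sz z)"
        using p[of z] snoc.prems sz_pos[of pre] sz_pos[of post] by simp
      then have "g (sz z + sz e) \<le> poly g' (sz z + poly p (sz z))"
        using g'[of "sz z + sz e"] poly_mono_nat[of "sz z + sz e" "sz z + poly p (sz z)" g'] by linarith
      then show ?case using snoc.IH[of "e # post"] snoc.prems step[of z "foldl (f z) (a z) pre" e] by simp
    qed simp
    moreover have "\<mu> (a z) \<le> poly h' (poly q (sz z))"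
      using \<mu>(2)[of "a z"] h'[of "sz (a z)"] poly_mono_nat[OF q[of z], of h'] by linarith
    moreover have "length pre \<le> poly p (sz z)"
      using p[of z] length_le_sz[of "xs z"] xs by simp
    ultimately have "\<mu> (foldl (f z) (a z) pre) \<le> poly h' (poly q (sz z)) + poly p (sz z) * poly g' (sz z + poly p (sz z))"
      by (meson add_mono le_trans mult_le_mono1)
    then show "sz (foldl (f z) (a z) pre) \<le> B (sz z)"
      unfolding B_def using \<mu>(1)[of "foldl (f z) (a z) pre"] by (meson le_trans mult_le_mono2)
  qed
qed

lemma PT_foldl:
  fixes f :: "'z :: coded \<Rightarrow> 'acc :: coded \<Rightarrow> 'e :: coded \<Rightarrow> 'acc"
  assumes "PT (\<lambda>t :: 'z \<times> 'acc \<times> 'e. f (fst t) (fst (snd t)) (snd (snd t)))"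
    and "PT a" "PT xs" "poly_bounded g"
    and step: "\<And>z acc e. sz (f z acc e) \<le> sz acc + g (sz z + sz e)"
  shows "PT (\<lambda>z. foldl (f z) (a z) (xs z))"
  using assms by (intro PT_foldl_measure[where g = g and h = "\<lambda>n. n" and \<mu> = sz and c = 1]) (auto intro!: pb_intros)


section \<open>List functions\<close>

lemma PT_rev [PT_intros]:
  assumes "PT f"
  shows "PT (\<lambda>z. rev (f z))"
proof -
  have *: "foldl (\<lambda>acc e. e # acc) acc xs = rev xs @ acc" for acc and xs :: "'c list"
    by (induction xs arbitrary: acc) auto
  have "PT (\<lambda>z. foldl (\<lambda>acc e. e # acc) [] (f z))"
    by (rule PT_foldl[where g = "\<lambda>n. n + 1"]) (auto intro!: PT_intros assms pb_intros)
  then show ?thesis by (simp add: *)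
qed

lemma PT_append [PT_intros]:
  assumes "PT f" "PT g"
  shows "PT (\<lambda>z. f z @ g z)"
proof -
  have *: "foldl (\<lambda>acc e. e # acc) acc xs = rev xs @ acc" for acc and xs :: "'c list"
    by (induction xs arbitrary: acc) auto
  have "PT (\<lambda>z. foldl (\<lambda>acc e. e # acc) (g z) (rev (f z)))"
    by (rule PT_foldl[where g = "\<lambda>n. n + 1"]) (auto intro!: PT_intros assms pb_intros)
  then show ?thesis by (simp add: *)
qed

lemma PT_map [PT_intros]:
  assumes "PT (\<lambda>t. f (fst t) (snd t))" "PT g"
  shows "PT (\<lambda>z. map (f z) (g z))"
proof -
  have *: "foldl (\<lambda>acc e. h e # acc) acc xs = rev (map h xs) @ acc" for h :: "'b \<Rightarrow> 'c" and acc xs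
    by (induction xs arbitrary: acc) auto
  have "PT (\<lambda>t :: 'a \<times> 'c list \<times> 'b. (\<lambda>t. f (fst t) (snd t)) (fst t, snd (snd t)))"
    by (rule PT_compose[OF assms(1)]) (intro PT_intros)
  then have f: "PT (\<lambda>t :: 'a \<times> 'c list \<times> 'b. f (fst t) (snd (snd t)))" by simp
  obtain p where p: "\<And>t. sz (f (fst t) (snd t)) \<le> poly p (sz t)"
    using PT_size[OF assms(1)] by blast
  have "PT (\<lambda>z. foldl (\<lambda>acc e. f z e # acc) [] (g z))"
  proof (rule PT_foldl[where g = "\<lambda>n. 1 + poly p (1 + n)"])
    show "sz (f z e # acc) \<le> sz acc + (1 + poly p (1 + (sz z + sz e)))" for z acc e
      using p[of "(z, e)"] by simp
  qed (intro PT_intros f assms(2) pb_intros)+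
  then have "PT (\<lambda>z. rev (foldl (\<lambda>acc e. f z e # acc) [] (g z)))" by (rule PT_rev)
  then show ?thesis by (simp add: *)
qed

lemma PT_list_all [PT_intros]:
  assumes "PT (\<lambda>t. f (fst t) (snd t))" "PT g"
  shows "PT (\<lambda>z. list_all (f z) (g z))"
proof -
  have *: "foldl (\<lambda>acc e. acc \<and> h e) b xs \<longleftrightarrow> b \<and> list_all h xs" for h :: "'b \<Rightarrow> bool" and b xs
    by (induction xs arbitrary: b) auto
  have "PT (\<lambda>t :: 'a \<times> bool \<times> 'b. (\<lambda>t. f (fst t) (snd t)) (fst t, snd (snd t)))"
    by (rule PT_compose[OF assms(1)]) (intro PT_intros)
  then have f: "PT (\<lambda>t :: 'a \<times> bool \<times> 'b. f (fst t) (snd (snd t)))" by simp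
  have "PT (\<lambda>z. foldl (\<lambda>acc e. acc \<and> f z e) True (g z))"
    by (rule PT_foldl[where g = "\<lambda>n. 0"]) ((intro PT_intros f assms(2) pb_intros)+, simp)
  then show ?thesis by (simp add: *)
qed

lemma PT_list_ex [PT_intros]:
  assumes "PT (\<lambda>t. f (fst t) (snd t))" "PT g"
  shows "PT (\<lambda>z. list_ex (f z) (g z))"
proof -
  have "PT (\<lambda>z. \<not> list_all (\<lambda>e. \<not> f z e) (g z))"
    by (intro PT_intros assms)
  then show ?thesis by (rule PT_cong) (auto simp: list_all_iff list_ex_iff)
qed

lemma PT_concat [PT_intros]:
  assumes "PT f"
  shows "PT (\<lambda>z. concat (f z))"
proof -
  have *: "foldl (@) acc xs = acc @ concat xs" for acc and xs :: "'c list list"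
    by (induction xs arbitrary: acc) auto
  have "PT (\<lambda>z. foldl (@) [] (f z))"
    by (rule PT_foldl[where g = "\<lambda>n. n"]) (auto intro!: PT_intros assms pb_intros)
  then show ?thesis by (simp add: *)
qed

lemma PT_drop_length [PT_intros]:
  fixes f :: "'a :: coded \<Rightarrow> 'c :: coded list" and g :: "'a \<Rightarrow> 'd :: coded list"
  assumes "PT f" "PT g"
  shows "PT (\<lambda>z. drop (length (f z)) (g z))"
proof -
  have *: "foldl (\<lambda>acc e. tl acc) acc xs = drop (length xs) acc" for acc :: "'d list" and xs :: "'c list"
    by (induction xs arbitrary: acc) (auto simp: drop_Suc)
  have le: "sz (tl acc) \<le> sz acc" for acc :: "'d :: coded list" by (cases acc) auto
  have "PT (\<lambda>z. foldl (\<lambda>acc e. tl acc) (g z) (f z))"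
    by (rule PT_foldl[where g = "\<lambda>n. 0"]) (auto intro!: PT_intros assms pb_intros simp: le)
  then show ?thesis by (simp add: *)
qed

lemma PT_length_eq [PT_intros]:
  assumes "PT f" "PT g"
  shows "PT (\<lambda>z. length (f z) = length (g z))"
proof -
  have "PT (\<lambda>z. drop (length (f z)) (g z) = [] \<and> drop (length (g z)) (f z) = [])"
    by (intro PT_intros assms)
  then show ?thesis by (rule PT_cong) auto
qed

lemma PT_zip [PT_intros]:
  fixes f :: "'a :: coded \<Rightarrow> 'c :: coded list" and g :: "'a \<Rightarrow> 'd :: coded list"
  assumes "PT f" "PT g"
  shows "PT (\<lambda>z. zip (f z) (g z))"
proof -
  let ?st = "\<lambda>(acc :: 'd list \<times> ('c \<times> 'd) list) (e :: 'c). if fst acc = [] then acc else (tl (fst acc), (e, hd (fst acc)) # snd acc)"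
  have Nil: "foldl ?st ([], out) xs = ([], out)" for out xs
    by (induction xs) auto
  have *: "snd (foldl ?st (ys, out) xs) = rev (zip xs ys) @ out" for ys out xs
  proof (induction xs arbitrary: ys out)
    case (Cons x xs)
    then show ?case by (cases ys) (auto simp: Nil)
  qed simp
  have "PT (\<lambda>z. foldl ?st (g z, []) (f z))"
  proof (rule PT_foldl[where g = "\<lambda>n. 2 + n"])
    show "sz (?st acc e) \<le> sz acc + (2 + (sz z + sz e))" for z :: 'a and acc e
      by (cases acc; cases "fst acc") auto
  qed (intro PT_intros assms pb_intros)+
  then have "PT (\<lambda>z. rev (snd (foldl ?st (g z, []) (f z))))" by (intro PT_intros)
  then show ?thesis by (simp add: *)
qed

lemma PT_bool_list_eq [PT_intros]:
  fixes f g :: "'a :: coded \<Rightarrow> bool list"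
  assumes "PT f" "PT g"
  shows "PT (\<lambda>z. f z = g z)"
proof -
  have "PT (\<lambda>z. length (f z) = length (g z) \<and> list_all (\<lambda>t. fst t = snd t) (zip (f z) (g z)))"
    by (intro PT_intros assms)
  then show ?thesis
    by (rule PT_cong) (auto simp: list_all_iff list_eq_iff_zip_eq)
qed


section \<open>Natural numbers in binary\<close>

instantiation nat :: coded
begin
definition "tr_nat n = tr (digits n)"
instance by standard (auto simp: tr_nat_def dest: tr_inj digits_inj)
end

definition bl :: "nat \<Rightarrow> nat" where
  "bl n = length (digits n)"

lemma digits_0 [simp]: "digits 0 = []"
  by (simp add: digits.simps)

lemma digits_pos: "0 < n \<Longrightarrow> digits n = odd n # digits (n div 2)"
  by (subst digits.simps) simp

lemma digits_eq_Nil [simp]: "digits n = [] \<longleftrightarrow> n = 0"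
  by (subst digits.simps) simp

lemma bl_0 [simp]: "bl 0 = 0"
  by (simp add: bl_def)

lemma bl_le_iff: "bl n \<le> k \<longleftrightarrow> n < 2 ^ k"
proof (induction k arbitrary: n)
  case 0
  then show ?case by (simp add: bl_def)
next
  case (Suc k)
  show ?case
  proof (cases "n = 0")
    case False
    then have "bl n = Suc (bl (n div 2))" by (simp add: bl_def digits_pos)
    then show ?thesis using Suc[of "n div 2"] by auto
  qed simp
qed

lemma less_2_bl: "n < 2 ^ bl n"
  using bl_le_iff[of n "bl n"] by simp

lemma bl_mono: "m \<le> n \<Longrightarrow> bl m \<le> bl n"
  using less_2_bl[of n] by (simp add: bl_le_iff)

lemma bl_add: "bl (m + n) \<le> max (bl m) (bl n) + 1"
proof -
  have "m < 2 ^ max (bl m) (bl n)" "n < 2 ^ max (bl m) (bl n)"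
    by (rule bl_le_iff[THEN iffD1], simp)+
  then have "m + n < 2 ^ (max (bl m) (bl n) + 1)" by simp
  then show ?thesis unfolding bl_le_iff .
qed

lemma bl_mult: "bl (m * n) \<le> bl m + bl n"
  unfolding bl_le_iff power_add using less_2_bl[of m] less_2_bl[of n]
  by (intro mult_strict_mono') auto

lemma bl_power: "bl (m ^ k) \<le> k * bl m + 1"
proof (induction k)
  case 0
  show ?case by (simp add: bl_le_iff)
next
  case (Suc k)
  then show ?case using bl_mult[of m "m ^ k"] by simp
qed

lemma sz_bool_list: "sz (bs :: bool list) = 1 + 6 * length bs"
  by (induction bs) auto

lemma sz_nat: "sz (n :: nat) = 1 + 6 * bl n"
proof -
  have "sz n = sz (digits n)" by (simp add: sz_def tr_nat_def)
  then show ?thesis by (simp add: sz_bool_list bl_def)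
qed

lemma PT_digits [PT_intros]: "PT f \<Longrightarrow> PT (\<lambda>z. digits (f z))"
  by (erule PT_recode) (simp add: tr_nat_def)

lemma PT_nat_eq [PT_intros]:
  fixes f g :: "'a :: coded \<Rightarrow> nat"
  assumes "PT f" "PT g"
  shows "PT (\<lambda>z. f z = g z)"
proof -
  have "PT (\<lambda>z. digits (f z) = digits (g z))" by (intro PT_intros assms)
  then show ?thesis by (rule PT_cong) (auto dest: digits_inj)
qed

lemma PT_even [PT_intros]:
  assumes "PT f"
  shows "PT (\<lambda>z. even (f z :: nat))"
proof -
  have "PT (\<lambda>z. if digits (f z) = [] then True else \<not> hd (digits (f z)))" by (intro PT_intros assms)
  moreover have "(if digits n = [] then True else \<not> hd (digits n)) = even n" for n
    by (cases "n = 0") (simp_all add: digits_pos)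
  ultimately show ?thesis by (rule PT_cong)
qed

lemma PT_div2 [PT_intros]:
  assumes "PT f"
  shows "PT (\<lambda>z. f z div (2 :: nat))"
proof -
  have 1: "PT (\<lambda>z. tl (digits (f z)))" by (intro PT_intros assms)
  have 2: "tl (digits n) = digits (n div 2)" for n
    by (cases "n = 0") (simp_all add: digits_pos)
  show ?thesis by (rule PT_recode[OF 1]) (simp only: tr_nat_def 2)
qed

text \<open>Zero has no digits, so shifting a 0 into it must not create a leading zero.\<close>

lemma digits_shift: "digits (2 * n + of_bool b) = (if n = 0 \<and> \<not> b then [] else b # digits n)"
  by (cases b; cases "n = 0") (simp_all add: digits_pos)

lemma PT_shift_bit:
  assumes "PT f" "PT b"
  shows "PT (\<lambda>z. 2 * f z + of_bool (b z) :: nat)"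
proof -
  have 1: "PT (\<lambda>z. if f z = 0 \<and> \<not> b z then [] else b z # digits (f z))"
    by (intro PT_intros assms)
  show ?thesis by (rule PT_recode[OF 1]) (simp only: tr_nat_def digits_shift)
qed

text \<open>The most significant bit comes first, opposite to \<open>digits\<close>, so that
  evaluation is a Horner scheme from the left.\<close>

definition bits_val :: "bool list \<Rightarrow> nat" where
  "bits_val bs = foldl (\<lambda>n b. 2 * n + of_bool b) 0 bs"

lemma bits_val_simps [simp]: "bits_val [] = 0" "bits_val (bs @ [b]) = 2 * bits_val bs + of_bool b"
  by (simp_all add: bits_val_def)

lemma bits_val_Cons: "bits_val (b # bs) = of_bool b * 2 ^ length bs + bits_val bs"
  by (induction bs rule: rev_induct) (simp_all flip: append_Cons add: bits_val_def[of "[b]"])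

lemma bits_val_digits: "bits_val (rev (digits n)) = n"
proof (induction n rule: less_induct)
  case (less n)
  then show ?case by (cases "n = 0") (auto simp: digits_pos)
qed

lemma PT_bits_val [PT_intros]:
  assumes "PT f"
  shows "PT (\<lambda>z. bits_val (f z))"
  unfolding bits_val_def
proof (rule PT_foldl[where g = "\<lambda>_. 6"])
  fix acc :: nat and e :: bool
  have "bl (2 * acc + of_bool e) \<le> bl acc + 1"
    using less_2_bl[of acc] by (simp add: bl_le_iff)
  then show "sz (2 * acc + of_bool e) \<le> sz acc + 6"
    unfolding sz_nat by linarith
qed (intro PT_intros PT_shift_bit assms pb_intros)+

text \<open>A ripple-carry adder. The state consists of the unread parts of both summands, the
  carry, and the sum bits found so far with the most significant first. The nested equality is the
  exclusive or of three bits, the conditional their majority.\<close>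

definition add_step :: "nat \<times> nat \<times> bool \<times> bool list \<Rightarrow> nat \<times> nat \<times> bool \<times> bool list" where
  "add_step s = (fst s div 2, fst (snd s) div 2,
     (if fst (snd (snd s)) then odd (fst s) \<or> odd (fst (snd s)) else odd (fst s) \<and> odd (fst (snd s))),
     ((odd (fst s) = odd (fst (snd s))) = fst (snd (snd s))) # snd (snd (snd s)))"

text \<open>The invariant identifies the carry as the difference between the shifted sum and the sum
  of the shifted summands.\<close>

lemma add_steps:
  fixes m n :: nat
  assumes "foldl (\<lambda>s _. add_step s) (m, n, False, []) es = (a, b, c, out)"
  shows "a = m div 2 ^ length es \<and> b = n div 2 ^ length es \<and> length out = length es \<and>
    a + b + of_bool c = (m + n) div 2 ^ length es \<and> bits_val out = (m + n) mod 2 ^ length es"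
  using assms
proof (induction es arbitrary: a b c out rule: rev_induct)
  case (snoc e es)
  obtain a' b' c' out' where s: "foldl (\<lambda>s _. add_step s) (m, n, False, []) es = (a', b', c', out')"
    by (metis surj_pair)
  note IH = snoc.IH[OF s]
  let ?x = "((odd a' = odd b') = c')"
  have eq: "a = a' div 2" "b = b' div 2" "c = (if c' then odd a' \<or> odd b' else odd a' \<and> odd b')"
    "out = ?x # out'"
    using snoc.prems s by (auto simp: add_step_def)
  let ?q = "(m + n) div 2 ^ length es"
  have q: "?q div 2 = a + b + of_bool c" "?q mod 2 = of_bool ?x"
    unfolding IH[THEN conjunct2, THEN conjunct2, THEN conjunct2, THEN conjunct1, symmetric] eq
    by (cases c'; cases "odd a'"; cases "odd b'"; auto elim!: oddE evenE)+
  have "(m + n) div 2 ^ length (es @ [e]) = ?q div 2"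
    by (simp add: div_mult2_eq[symmetric] mult.commute)
  moreover have "(m + n) mod 2 ^ length (es @ [e]) = 2 ^ length es * (?q mod 2) + (m + n) mod 2 ^ length es"
  proof -
    have k: "2 ^ length (es @ [e]) = 2 ^ length es * (2 :: nat)" by simp
    show ?thesis unfolding k mod_mult2_eq by simp
  qed
  ultimately show ?case using IH q
    by (simp add: eq(4) bits_val_Cons) (simp add: eq(1,2) div_mult2_eq[symmetric] mult.commute)
qed simp

lemma PT_add [PT_intros]:
  fixes f g :: "'a :: coded \<Rightarrow> nat"
  assumes "PT f" "PT g"
  shows "PT (\<lambda>z. f z + g z)"
proof -
  \<comment> \<open>The list is only a clock; its additional entry provides for the last
    carry.\<close>
  let ?F = "\<lambda>z. foldl (\<lambda>s _. add_step s) (f z, g z, False, []) (digits (f z) @ digits (g z) @ [True])"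
  have eq: "bits_val (snd (snd (snd (?F z)))) = f z + g z" for z
  proof -
    obtain a b c out where s: "?F z = (a, b, c, out)" by (metis surj_pair)
    have "f z + g z < 2 ^ length (digits (f z) @ digits (g z) @ [True])"
      by (rule bl_le_iff[THEN iffD1], rule le_trans[OF bl_add]) (simp add: bl_def)
    with add_steps[OF s] s show ?thesis by simp
  qed
  have "PT ?F"
  proof (rule PT_foldl[where g = "\<lambda>_. 6"])
    have "sz (n div 2) \<le> sz n" for n :: nat by (simp add: sz_nat bl_mono)
    then show "sz (add_step acc) \<le> sz acc + 6" for acc
      by (cases acc) (simp add: add_step_def add_mono)
  qed (unfold add_step_def, (intro PT_intros assms pb_intros)+)
  then have "PT (\<lambda>z. bits_val (snd (snd (snd (?F z)))))" by (intro PT_intros)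
  then show ?thesis by (rule PT_cong) (rule eq)
qed

text \<open>Bits arrive from the least significant end, so the verdict so far stands unless the
  current bits differ, and then these overrule it.\<close>

definition le_step :: "nat \<times> nat \<times> bool \<Rightarrow> nat \<times> nat \<times> bool" where
  "le_step s = (fst s div 2, fst (snd s) div 2,
     if odd (fst s) = odd (fst (snd s)) then snd (snd s) else odd (fst (snd s)))"

lemma le_steps:
  fixes m n :: nat
  shows "foldl (\<lambda>s _. le_step s) (m, n, True) es =
    (m div 2 ^ length es, n div 2 ^ length es, m mod 2 ^ length es \<le> n mod 2 ^ length es)"
proof (induction es rule: rev_induct)
  case (snoc e es)
  let ?k = "2 ^ length es :: nat"
  have mods: "x mod (?k * 2) = ?k * of_bool (odd (x div ?k)) + x mod ?k" for x :: nat
    by (simp only: mod_mult2_eq mod_2_eq_odd)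
  have "(if odd p = odd q then x \<le> y else odd q) \<longleftrightarrow> k * of_bool (odd p) + x \<le> k * of_bool (odd q) + y"
    if "x < k" "y < k" for k x y p q :: nat
    using that by (cases "odd p"; cases "odd q") simp_all
  from this[of "m mod ?k" ?k "n mod ?k" "m div ?k" "n div ?k"]
  have "(if odd (m div ?k) = odd (n div ?k) then m mod ?k \<le> n mod ?k else odd (n div ?k))
      \<longleftrightarrow> m mod (?k * 2) \<le> n mod (?k * 2)"
    unfolding mods by simp
  moreover have "2 ^ length (es @ [e]) = ?k * 2" by simp
  ultimately show ?case using snoc by (simp only: foldl_append foldl.simps le_step_def div_mult2_eq fst_conv snd_conv)
qed simp

lemma PT_le [PT_intros]:
  fixes f g :: "'a :: coded \<Rightarrow> nat"
  assumes "PT f" "PT g"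
  shows "PT (\<lambda>z. f z \<le> g z)"
proof -
  let ?F = "\<lambda>z. foldl (\<lambda>s _. le_step s) (f z, g z, True) (digits (f z) @ digits (g z))"
  have eq: "snd (snd (?F z)) \<longleftrightarrow> f z \<le> g z" for z
  proof -
    have "f z < 2 ^ length (digits (f z) @ digits (g z))" "g z < 2 ^ length (digits (f z) @ digits (g z))"
      by (rule bl_le_iff[THEN iffD1], simp add: bl_def)+
    then show ?thesis unfolding le_steps by simp
  qed
  have "PT ?F"
  proof (rule PT_foldl[where g = "\<lambda>_. 0"])
    have "sz (n div 2) \<le> sz n" for n :: nat by (simp add: sz_nat bl_mono)
    then show "sz (le_step acc) \<le> sz acc + 0" for acc
      by (cases acc) (simp add: le_step_def add_mono)
  qed (unfold le_step_def, (intro PT_intros assms pb_intros)+)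
  then have "PT (\<lambda>z. snd (snd (?F z)))" by (intro PT_intros)
  then show ?thesis by (rule PT_cong) (rule eq)
qed

lemma PT_less [PT_intros]:
  fixes f g :: "'a :: coded \<Rightarrow> nat"
  assumes "PT f" "PT g"
  shows "PT (\<lambda>z. f z < g z)"
  by (rule PT_cong[of "\<lambda>z. \<not> g z \<le> f z"]) (auto intro!: PT_intros assms)

text \<open>Horner scheme over the digits of one factor: doubling adds one bit and the summand does
  not depend on the accumulator, so the growth condition of \<open>PT_foldl\<close> holds.\<close>

lemma PT_mult [PT_intros]:
  fixes f g :: "'a :: coded \<Rightarrow> nat"
  assumes "PT f" "PT g"
  shows "PT (\<lambda>z. f z * g z)"
proof -
  have *: "foldl (\<lambda>acc b. acc + acc + (if b then m else 0)) 0 bs = bits_val bs * m" for m :: nat and bs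
    by (induction bs rule: rev_induct) (auto simp: algebra_simps)
  obtain p where p: "\<And>z. sz (f z) \<le> poly p (sz z)" using PT_size[OF assms(1)] by blast
  have "PT (\<lambda>t :: 'a \<times> nat \<times> bool. f (fst t))"
    by (rule PT_compose[OF assms(1)]) (intro PT_intros)
  note f = this
  have "PT (\<lambda>z. foldl (\<lambda>acc b. acc + acc + (if b then f z else 0)) 0 (rev (digits (g z))))"
  proof (rule PT_foldl[where g = "\<lambda>n. poly p n + 12"])
    fix z :: 'a and acc :: nat and e :: bool
    have "bl (acc + acc) \<le> bl acc + 1" using bl_add[of acc acc] by simp
    moreover have "bl (acc + acc + (if e then f z else 0)) \<le> max (bl (acc + acc)) (bl (f z)) + 1"
      by (rule le_trans[OF bl_add]) (auto simp: le_max_iff_disj)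
    ultimately have "bl (acc + acc + (if e then f z else 0)) \<le> bl acc + bl (f z) + 2" by linarith
    moreover have "6 * bl (f z) \<le> poly p (sz z + sz e)"
      using p[of z] poly_mono_nat[of "sz z" "sz z + sz e" p] by (simp add: sz_nat)
    ultimately show "sz (acc + acc + (if e then f z else 0)) \<le> sz acc + (poly p (sz z + sz e) + 12)"
      unfolding sz_nat[of acc] sz_nat[of "acc + acc + (if e then f z else 0)"] by linarith
  qed (intro PT_intros f assms pb_intros)+
  then show ?thesis by (simp add: * bits_val_digits mult.commute)
qed


lemma PT_length [PT_intros]:
  assumes "PT f"
  shows "PT (\<lambda>z. length (f z))"
proof -
  have *: "foldl (\<lambda>n e. n + 1) n xs = n + length xs" for n and xs :: "'c list"
    by (induction xs arbitrary: n) auto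
  have "PT (\<lambda>z. foldl (\<lambda>n e. n + 1) (0 :: nat) (f z))"
  proof (rule PT_foldl[where g = "\<lambda>_. 6"])
    fix acc :: nat
    have "bl (acc + 1) \<le> bl acc + 1"
      using less_2_bl[of acc] by (simp add: bl_le_iff)
    then show "sz (acc + 1) \<le> sz acc + 6"
      unfolding sz_nat by linarith
  qed (intro PT_intros assms pb_intros)+
  then show ?thesis by (simp only: *) simp
qed


section \<open>Decoding\<close>

text \<open>Both quantified words are arbitrary, so decoding is total: every tree is read as some
  value, and no test for well-formed codes has to be carried along.\<close>

class decodable = coded +
  fixes dc :: "tree \<Rightarrow> 'a"
  assumes dc_tr [simp]: "dc (tr x) = x"
    and PT_norm: "PT (\<lambda>t. tr (dc t))"

lemma PT_dc [PT_intros]: "PT f \<Longrightarrow> PT (\<lambda>x. dc (f x) :: 'a :: decodable)"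
  by (rule PT_compose[of dc], rule PT_recode[OF PT_norm]) simp

instantiation tree :: decodable
begin
definition "dc_tree (t :: tree) = t"
instance by standard (simp_all add: dc_tree_def PT_id)
end

instantiation bool :: decodable
begin
definition "dc_bool t = (tleft t \<noteq> L)"
instance
proof
  show "dc (tr x) = x" for x :: bool
    by (simp add: dc_bool_def tr_bool_def)
  show "PT (\<lambda>t. tr (dc t :: bool))"
    unfolding dc_bool_def by (intro PT_intros)
qed
end

instantiation prod :: (decodable, decodable) decodable
begin
definition "dc_prod t = (dc (tleft t), dc (tright t))"
instance
proof
  show "dc (tr x) = x" for x :: "'a \<times> 'b"
    by (cases x) (simp add: dc_prod_def)
  show "PT (\<lambda>t. tr (dc t :: 'a \<times> 'b))"
    unfolding dc_prod_def by (intro PT_intros)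
qed
end

text \<open>Every tree is the code of exactly one list of trees, hence lists can be decoded from any
  tree.\<close>

fun spine :: "tree \<Rightarrow> tree list" where
  "spine L = []"
| "spine (N a b) = a # spine b"

lemma tr_spine [simp]: "tr (spine t) = t"
  by (induction t) auto

lemma PT_spine [PT_intros]: "PT f \<Longrightarrow> PT (\<lambda>x. spine (f x))"
  by (erule PT_recode) simp

lemma spine_tr [simp]: "spine (tr xs) = map tr xs"
  by (induction xs) auto

instantiation list :: (decodable) decodable
begin
definition "dc_list t = map dc (spine t)"
instance
proof
  show "dc (tr x) = x" for x :: "'a list"
    by (simp add: dc_list_def comp_def)
  show "PT (\<lambda>t. tr (dc t :: 'a list))"
    unfolding dc_list_def by (intro PT_intros)
qed
end

instantiation nat :: decodable
begin
definition "dc_nat t = bits_val (rev (dc t))"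
instance
proof
  show "dc (tr x) = x" for x :: nat
    by (simp add: dc_nat_def tr_nat_def bits_val_digits)
  show "PT (\<lambda>t. tr (dc t :: nat))"
    unfolding dc_nat_def by (intro PT_intros)
qed
end

text \<open>A preorder code read backwards is postfix notation and is evaluated on a stack. An
  operator with too few operands counts as a leaf, which gives malformed words a meaning
  too.\<close>

definition parse_step :: "tree list \<Rightarrow> bool \<Rightarrow> tree list" where
  "parse_step st b = (if b \<and> tl st \<noteq> [] then N (hd st) (hd (tl st)) # tl (tl st) else L # st)"

definition parse :: "bool list \<Rightarrow> tree" where
  "parse bs = hd (foldl parse_step [] (rev bs))"

lemma parse_bits [simp]: "parse (bits t) = t"
proof -
  have "foldl parse_step st (rev (bits t)) = t # st" for st
    by (induction t arbitrary: st) (auto simp: parse_step_def)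
  then show ?thesis by (simp add: parse_def)
qed

lemma PT_parse [PT_intros]:
  assumes "PT f"
  shows "PT (\<lambda>z. parse (f z))"
proof -
  have "PT (\<lambda>z. foldl parse_step [] (rev (f z)))"
  proof (rule PT_foldl[where g = "\<lambda>_. 2"])
    show "sz (parse_step acc e) \<le> sz acc + 2" for acc e
    proof -
      have "sz (N a b) = 1 + sz a + sz b" "sz L = 1" for a b by (simp_all add: sz_def)
      then show ?thesis by (cases acc; cases "tl acc") (auto simp: parse_step_def)
    qed
    show "PT (\<lambda>t. parse_step (fst (snd t)) (snd (snd t)))"
      unfolding parse_step_def by (intro PT_intros)
  qed (intro PT_intros assms pb_intros)+
  then show ?thesis unfolding parse_def by (intro PT_intros)
qed

type_synonym split_state = "bool \<times> bool list \<times> bool list"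

text \<open>The state is a flag for being finished, the letters found so far in reverse, and the
  unread rest. The word itself serves as the clock, since one iteration reads at least one of its
  symbols until the end marker is met.\<close>

definition split_step :: "split_state \<Rightarrow> split_state" where
  "split_step s = (let out = fst (snd s); w = snd (snd s) in
     if fst s then s
     else if w = [] then (True, out, w)
     else if hd w then (False, hd (tl w) # out, tl (tl w))
     else (True, out, tl w))"

definition split_string :: "bool list \<Rightarrow> bool list \<times> bool list" where
  "split_string z = (let s = snd (foldl (\<lambda>s _. split_step s) (False, [], z) z) in (rev (fst s), snd s))"

lemma split_string_enc: "split_string (enc_string w @ r) = (w, r)"
proof -
  have [simp]: "split_step (True, out, v) = (True, out, v)"
    "split_step (False, out, False # v) = (True, out, v)"
    "split_step (False, out, True # b # v) = (False, b # out, v)" for b out v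
    by (simp_all add: split_step_def)
  have stable: "foldl (\<lambda>s _. split_step s) (True, out, r) es = (True, out, r)" for out es
    by (induction es) simp_all
  have run: "foldl (\<lambda>s _. split_step s) (False, out, enc_string w @ r) es = (True, rev w @ out, r)"
    if "length w < length es" for out es
    using that
  proof (induction w arbitrary: out es)
    case Nil
    then obtain e es' where "es = e # es'" by (cases es) auto
    then show ?case by (simp add: enc_string_def stable)
  next
    case (Cons b w)
    then obtain e es' where "es = e # es'" by (cases es) auto
    with Cons show ?case by (simp add: enc_string_def)
  qed
  have len: "length w < length (enc_string w @ r)"
    by (induction w) (auto simp: enc_string_def)
  show ?thesis unfolding split_string_def run[OF len] by simp
qed

lemma PT_split_string [PT_intros]:
  assumes "PT f"
  shows "PT (\<lambda>z. split_string (f z))"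
proof -
  have "PT (\<lambda>z. foldl (\<lambda>s _. split_step s) (False, [], f z) (f z))"
  proof (rule PT_foldl[where g = "\<lambda>_. 12"])
    fix acc :: split_state
    obtain d out w where acc: "acc = (d, out, w)" by (metis surj_pair)
    have "sz (tl (tl w)) \<le> sz w" by (simp add: sz_bool_list)
    moreover have "sz (tl w) \<le> sz w" by (simp add: sz_bool_list)
    ultimately show "sz (split_step acc) \<le> sz acc + 12"
      by (auto simp: acc split_step_def Let_def)
  next
    show "PT (\<lambda>t. split_step (fst (snd t)))"
      unfolding split_step_def Let_def by (intro PT_intros)
  qed (intro PT_intros assms pb_intros)+
  then show ?thesis unfolding split_string_def Let_def by (intro PT_intros)
qed


section \<open>From polynomial-time functions to Turing machines\<close>

text \<open>A loop tests for a single symbol, whereas register \<open>a\<close> may show either bit.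
  The loop condition is therefore a 1 on register 4, removed when \<open>a\<close> is empty.\<close>

definition transfer :: "nat \<Rightarrow> (bool \<Rightarrow> prog) \<Rightarrow> prog" where
  "transfer a p = Seq (Push 4 True) (While 4 (Some True)
     (If a (Some True) (Seq (Pop a) (p True))
       (If a (Some False) (Seq (Pop a) (p False)) (Pop 4))))"

lemma runs_transfer:
  assumes "a \<noteq> b" "a \<noteq> 4" "b \<noteq> 4" "\<sigma> 4 = []"
    and p: "\<And>x \<sigma>. runs (p x) \<sigma> (\<sigma>(b := h x @ \<sigma> b)) c"
  shows "runs (transfer a p) \<sigma> (\<sigma>(a := [], b := concat (map h (rev (\<sigma> a))) @ \<sigma> b)) (7 + (c + 4) * length (\<sigma> a))"
proof -
  let ?B = "If a (Some True) (Seq (Pop a) (p True)) (If a (Some False) (Seq (Pop a) (p False)) (Pop 4))"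
  have loop: "runs (While 4 (Some True) ?B) (\<sigma>(a := w, 4 := [True], b := v))
      (\<sigma>(a := [], b := concat (map h (rev w)) @ v)) (5 + (c + 4) * length w)" for w v
  proof (induction w arbitrary: v)
    case Nil
    let ?\<sigma>0 = "\<sigma>(a := [], 4 := [True], b := v)" and ?\<sigma>1 = "\<sigma>(a := [], b := v)"
    have eq: "?\<sigma>1 = ?\<sigma>0(4 := [])" using assms by auto
    have "runs (Pop 4) ?\<sigma>0 ?\<sigma>1 1"
      by (rule runs_Pop[OF _ eq]) (use assms in auto)
    then have 1: "runs ?B ?\<sigma>0 ?\<sigma>1 (1 + 1 + 1)"
      by (intro runs_If2) (use assms in auto)
    have eq2: "\<sigma>(a := [], b := concat (map h (rev [])) @ v) = ?\<sigma>1" by simp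
    show ?case unfolding eq2
      by (rule runs_mono[OF runs_While1[OF _ 1 runs_While2]]) (use assms in auto)
  next
    case (Cons x w)
    let ?\<sigma>0 = "\<sigma>(a := x # w, 4 := [True], b := v)" and ?\<sigma>1 = "\<sigma>(a := w, 4 := [True], b := v)"
    let ?\<sigma>2 = "\<sigma>(a := w, 4 := [True], b := h x @ v)"
    have 1: "runs (Pop a) ?\<sigma>0 ?\<sigma>1 1"
      by (rule runs_Pop[where b = x and l = w]) (use assms in auto)
    have 2: "runs (p x) ?\<sigma>1 ?\<sigma>2 c"
    proof -
      have "?\<sigma>2 = ?\<sigma>1(b := h x @ ?\<sigma>1 b)" by auto
      then show ?thesis using p[of x ?\<sigma>1] by (simp only:)
    qed
    have 3: "runs ?B ?\<sigma>0 ?\<sigma>2 (1 + c + 1 + 1)"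
    proof (cases x)
      case True
      then have px: "p x = p True" by simp
      have "runs ?B ?\<sigma>0 ?\<sigma>2 (1 + c + 1)"
        by (rule runs_If1[OF _ runs_Seq[OF 1 2[unfolded px]]]) (use assms True in auto)
      then show ?thesis by (rule runs_mono) simp
    next
      case False
      then have px: "p x = p False" by simp
      show ?thesis
        by (rule runs_If2[OF _ runs_If1[OF _ runs_Seq[OF 1 2[unfolded px]]]]) (use assms False in auto)
    qed
    have eq: "concat (map h (rev (x # w))) @ v = concat (map h (rev w)) @ h x @ v" by simp
    show ?case unfolding eq
      by (rule runs_mono[OF runs_While1[OF _ 3 Cons.IH]]) (use assms in auto)
  qed
  have "\<sigma>(4 := True # \<sigma> 4) = \<sigma>(a := \<sigma> a, 4 := [True], b := \<sigma> b)" using assms by auto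
  from runs_Seq[OF runs_Push[OF refl] loop[of "\<sigma> a" "\<sigma> b", folded this]]
  show ?thesis unfolding transfer_def by (rule runs_mono) simp
qed

text \<open>The raw input first has to become the code of a list of bits. Two transfers are used
  because each reverses the word, and the 0 pushed between them is the code of the empty list. In
  the code of a truth value the second bit is the value itself, hence the final pop.\<close>

lemma polytime_decidable_PT:
  fixes f :: "bool list \<Rightarrow> bool"
  assumes "PT f"
  shows "polytime_decidable {w. f w}"
proof -
  obtain P p where P: "regs P \<subseteq> {0, 2, 3, 4}"
    "\<And>x \<sigma> r n. \<sigma> 0 = bits (tr x) @ r \<Longrightarrow> \<sigma> 4 = [] \<Longrightarrow> sz x \<le> n \<Longrightarrow>
      runs P \<sigma> (\<sigma>(0 := bits (tr (f x)) @ r)) (poly p n)"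
    by (rule PT_E[OF assms]) (rule that)
  define Q where "Q = Seq (transfer 0 (Push 2)) (Seq (Push 0 False)
    (Seq (transfer 2 (\<lambda>b. pushes (True # bits (tr b)))) (Seq P (Pop 0))))"
  define g where "g n = (7 + (2 + 4) * n) + (2 + ((7 + (13 + 4) * n) + (poly p (1 + 6 * n) + 1)))" for n
  have "poly_bounded (\<lambda>n. g n + 1)" unfolding g_def by (intro pb_intros)
  then obtain q where q: "\<And>n. g n + 1 \<le> poly q n" by (auto simp: poly_bounded_def)
  have "computes_within (decider 5 Q) w [w \<in> {w. f w}] (poly q (length w))" for w
  proof -
    define \<sigma>0 :: "nat \<Rightarrow> bool list" where "\<sigma>0 = (\<lambda>_. [])(0 := w)"
    define \<sigma>1 where "\<sigma>1 = \<sigma>0(0 := [], 2 := concat (map (\<lambda>b. [b]) (rev (\<sigma>0 0))) @ \<sigma>0 2)"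
    define \<sigma>2 where "\<sigma>2 = \<sigma>1(0 := False # \<sigma>1 0)"
    define \<sigma>3 where "\<sigma>3 = \<sigma>2(2 := [], 0 := concat (map (\<lambda>b. True # bits (tr b)) (rev (\<sigma>2 2))) @ \<sigma>2 0)"
    define \<sigma>4 where "\<sigma>4 = \<sigma>3(0 := bits (tr (f w)))"
    define \<sigma>5 where "\<sigma>5 = \<sigma>4(0 := tl (\<sigma>4 0))"
    have 1: "runs (transfer 0 (Push 2)) \<sigma>0 \<sigma>1 (7 + (2 + 4) * length w)"
      unfolding \<sigma>1_def
      by (rule runs_mono[OF runs_transfer[where c = 2]]) (auto simp: \<sigma>0_def intro!: runs_Push)
    have 2: "runs (Push 0 False) \<sigma>1 \<sigma>2 2"
      unfolding \<sigma>2_def by (rule runs_Push) simp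
    have l2: "length (\<sigma>2 2) = length w" by (simp add: \<sigma>2_def \<sigma>1_def \<sigma>0_def)
    have push: "runs (pushes (True # bits (tr b))) \<sigma> (\<sigma>(0 := (True # bits (tr b)) @ \<sigma> 0)) 13" for b :: bool and \<sigma>
      by (rule runs_mono[OF runs_pushes]) (simp add: tr_bool_def)
    have 3: "runs (transfer 2 (\<lambda>b. pushes (True # bits (tr b)))) \<sigma>2 \<sigma>3 (7 + (13 + 4) * length w)"
      unfolding \<sigma>3_def l2[symmetric]
      by (rule runs_transfer[where c = 13 and h = "\<lambda>b. True # bits (tr b)", OF _ _ _ _ push])
        (simp_all add: \<sigma>2_def \<sigma>1_def \<sigma>0_def)
    have "bits (tr w) = concat (map (\<lambda>b. True # bits (tr b)) w) @ [False]"
      by (induction w) auto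
    moreover have "concat (map (\<lambda>b. [b]) v) = v" for v :: "bool list"
      by (induction v) auto
    ultimately have "\<sigma>3 0 = bits (tr w) @ []" "\<sigma>3 4 = []"
      by (simp_all add: \<sigma>3_def \<sigma>2_def \<sigma>1_def \<sigma>0_def)
    then have 4: "runs P \<sigma>3 \<sigma>4 (poly p (1 + 6 * length w))"
      unfolding \<sigma>4_def using P(2)[of \<sigma>3 w "[]" "1 + 6 * length w"] by (simp add: sz_bool_list)
    have 5: "runs (Pop 0) \<sigma>4 \<sigma>5 1"
      unfolding \<sigma>5_def by (rule runs_Pop') (auto simp: \<sigma>4_def tr_bool_def)
    have "runs Q \<sigma>0 \<sigma>5 (g (length w))"
      unfolding Q_def g_def by (rule runs_Seq[OF 1 runs_Seq[OF 2 runs_Seq[OF 3 runs_Seq[OF 4 5]]]])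
    then obtain n where n: "n \<le> g (length w)" "run Q \<sigma>0 \<sigma>5 n" by (auto simp: runs_def)
    have "regs Q \<subseteq> {..<5} - {1}"
      using P(1) regs_pushes[of "True # bits (tr True)"] regs_pushes[of "True # bits (tr False)"]
      by (auto simp: Q_def transfer_def simp del: pushes.simps)
    from computes_within_decider[OF n(2)[unfolded \<sigma>0_def] this]
    have "computes_within (decider 5 Q) w [top_sym (\<sigma>5 0) = Some True] (n + 1)" by simp
    moreover have "(top_sym (\<sigma>5 0) = Some True) = f w"
      by (simp add: \<sigma>5_def \<sigma>4_def tr_bool_def)
    moreover have "n + 1 \<le> poly q (length w)" using n(1) q[of "length w"] by simp
    ultimately show ?thesis using computes_within_mono by simp
  qed
  then show ?thesis
    unfolding polytime_decidable_def polytime_computable_on_def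
    using turing_machine_decider[of 5 Q] by auto
qed

text \<open>A single polynomial bounds both quantified words, so the universal word may be longer
  than \<open>h\<close> intends. This does no harm: completeness provides acceptance of every
  \<open>b\<close>, and soundness draws on short ones only.\<close>

theorem Sigma2pI:
  fixes V :: "bool list \<Rightarrow> 'a :: decodable \<Rightarrow> 'b :: decodable \<Rightarrow> bool"
  assumes V: "PT (\<lambda>t. V (fst t) (fst (snd t)) (snd (snd t)))"
    and "poly_bounded g" "poly_bounded h"
    and complete: "\<And>w. w \<in> A \<Longrightarrow> \<exists>a. sz a \<le> g (length w) \<and> (\<forall>b. V w a b)"
    and sound: "\<And>w a. (\<And>b. sz b \<le> h (length w) \<Longrightarrow> V w a b) \<Longrightarrow> w \<in> A"
  shows "A \<in> Sigma2p"
proof -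
  let ?f = "\<lambda>z. (let s = split_string z; s' = split_string (snd s) in
    V (fst s) (dc (parse (fst s'))) (dc (parse (fst (split_string (snd s'))))))"
  obtain p q where p: "\<And>n. g n \<le> poly p n" and q: "\<And>n. h n \<le> poly q n"
    using assms(2,3) by (auto simp: poly_bounded_def)
  have "PT (\<lambda>z. (\<lambda>t. V (fst t) (fst (snd t)) (snd (snd t)))
     (fst (split_string z), dc (parse (fst (split_string (snd (split_string z))))),
      dc (parse (fst (split_string (snd (split_string (snd (split_string z)))))))))"
    by (rule PT_compose[OF V]) (intro PT_intros)
  then have "PT ?f" by (simp add: Let_def)
  then have "polytime_decidable {z. ?f z}" by (rule polytime_decidable_PT)
  moreover have f: "?f (enc_triple w X Y) = V w (dc (parse X)) (dc (parse Y))" for w X Y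
    using split_string_enc[of Y "[]"] by (simp add: enc_triple_def split_string_enc)
  have "w \<in> A \<longleftrightarrow> (\<exists>X. length X \<le> poly (p + q) (length w) \<and>
      (\<forall>Y. length Y \<le> poly (p + q) (length w) \<longrightarrow> enc_triple w X Y \<in> {z. ?f z}))" for w
  proof
    assume "w \<in> A"
    from complete[OF this] obtain a where a: "sz a \<le> g (length w)" "\<And>b. V w a b" by blast
    have "length (bits (tr a)) \<le> poly (p + q) (length w)"
      using a(1) p[of "length w"] by (simp add: sz_def)
    moreover have "enc_triple w (bits (tr a)) Y \<in> {z. ?f z}" for Y
      using a(2) by (simp only: mem_Collect_eq f) simp
    ultimately show "\<exists>X. length X \<le> poly (p + q) (length w) \<and>
      (\<forall>Y. length Y \<le> poly (p + q) (length w) \<longrightarrow> enc_triple w X Y \<in> {z. ?f z})" by blast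
  next
    assume "\<exists>X. length X \<le> poly (p + q) (length w) \<and>
      (\<forall>Y. length Y \<le> poly (p + q) (length w) \<longrightarrow> enc_triple w X Y \<in> {z. ?f z})"
    then obtain X where X: "\<And>Y. length Y \<le> poly (p + q) (length w) \<Longrightarrow> V w (dc (parse X)) (dc (parse Y))"
      by (simp only: mem_Collect_eq f) blast
    show "w \<in> A"
    proof (rule sound)
      fix b :: 'b assume "sz b \<le> h (length w)"
      then have "length (bits (tr b)) \<le> poly (p + q) (length w)"
        using q[of "length w"] by (simp add: sz_def)
      from X[OF this] show "V w (dc (parse X)) b" by simp
    qed
  qed
  ultimately show ?thesis unfolding Sigma2p_def by blast
qed


section \<open>Simulation of arbitrary Turing machines\<close>

lemma PT_tree_eq_const:
  assumes "PT f"
  shows "PT (\<lambda>x. f x = (c :: tree))"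
  using assms
proof (induction c arbitrary: f)
  case L
  then show ?case by (rule PT_is_leaf)
next
  case (N a b)
  have "PT (\<lambda>x. f x \<noteq> L \<and> tleft (f x) = a \<and> tright (f x) = b)"
    by (intro PT_bool_ops PT_is_leaf N PT_tleft PT_tright)
  moreover have "(t \<noteq> L \<and> tleft t = a \<and> tright t = b) = (t = N a b)" for t
    by (cases t) auto
  ultimately show ?case by (rule PT_cong)
qed

lemma PT_eq_const:
  assumes "PT f"
  shows "PT (\<lambda>x. f x = c)"
  by (rule PT_cong[OF PT_tree_eq_const[OF PT_tr[OF assms], of "tr c"]]) (auto dest: tr_inj)

text \<open>Table lookup. Only a finite part of a transition function matters, and this makes it
  available without any assumption on how it is given.\<close>

lemma PT_finite:
  fixes g :: "'a :: coded \<Rightarrow> 'b :: coded"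
  assumes "finite S"
  shows "\<exists>h. PT h \<and> (\<forall>x\<in>S. h x = g x)"
  using assms
proof (induction S)
  case empty
  show ?case using PT_const by blast
next
  case (insert a S)
  then obtain h where h: "PT h" "\<forall>x\<in>S. h x = g x" by blast
  have "PT (\<lambda>x. if x = a then g a else h x)"
    by (intro PT_intros PT_eq_const h(1))
  moreover have "\<forall>x\<in>insert a S. (if x = a then g a else h x) = g x"
    using h(2) by simp
  ultimately show ?case by blast
qed

text \<open>Supplies the clock of the simulation: a list as long as the time bound, built by a
  Horner scheme in which concatenation multiplies by the input length.\<close>

lemma PT_unary_poly:
  fixes p :: "nat poly"
  shows "\<exists>u :: 'a :: coded list \<Rightarrow> bool list. PT u \<and> (\<forall>w. length (u w) = poly p (length w))"
proof (induction p)
  case 0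
  show ?case by (intro exI[of _ "\<lambda>_. []"]) (simp add: PT_const)
next
  case (pCons a p)
  then obtain u :: "'a list \<Rightarrow> bool list" where u: "PT u" "\<And>w. length (u w) = poly p (length w)" by blast
  have "PT (\<lambda>t :: 'a list \<times> 'a. u (fst t))" by (rule PT_compose[OF u(1)]) (intro PT_intros)
  then have "PT (\<lambda>w :: 'a list. replicate a True @ concat (map (\<lambda>_. u w) w))"
    by (intro PT_intros)
  moreover have "length (replicate a True @ concat (map (\<lambda>_. u w) w)) = poly (pCons a p) (length w)" for w :: "'a list"
    by (simp add: length_concat comp_def sum_list_triv u(2))
  ultimately show ?case by blast
qed

instantiation option :: (coded) coded
begin
definition "tr_option x = (case x of None \<Rightarrow> L | Some y \<Rightarrow> N (tr y) L)"
instance by standard (auto simp: tr_option_def dest: tr_inj split: option.splits)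
end

lemma PT_Some [PT_intros]: "PT f \<Longrightarrow> PT (\<lambda>x. Some (f x))"
  by (rule PT_recode[of "\<lambda>x. N (tr (f x)) L"]) (auto intro: PT_intros simp: tr_option_def)

lemma PT_sym_eq:
  fixes f g :: "'a :: coded \<Rightarrow> sym"
  assumes "PT f" "PT g"
  shows "PT (\<lambda>x. f x = g x)"
proof -
  have "PT (\<lambda>x. (f x = None \<longrightarrow> g x = None) \<and> (f x = Some True \<longrightarrow> g x = Some True) \<and>
      (f x = Some False \<longrightarrow> g x = Some False))"
    by (intro PT_bool_ops PT_eq_const assms)
  moreover have "((a = None \<longrightarrow> b = None) \<and> (a = Some True \<longrightarrow> b = Some True) \<and>
      (a = Some False \<longrightarrow> b = Some False)) = (a = b)" for a b :: sym
    by (cases a; cases "the a") auto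
  ultimately show ?thesis by (rule PT_cong)
qed

text \<open>
  A simulated tape is the log of all writes (most recent first) together with the head position;
  a pair \<open>(i, j)\<close> stands for the position \<open>i - j\<close>.
\<close>

type_synonym wlog = "((nat \<times> nat) \<times> sym) list"
type_synonym ltape = "wlog \<times> (nat \<times> nat)"

definition pos :: "nat \<times> nat \<Rightarrow> int" where
  "pos p = int (fst p) - int (snd p)"

definition log_cell :: "wlog \<Rightarrow> int \<Rightarrow> sym" where
  "log_cell l = foldl (\<lambda>c e. c(pos (fst e) := snd e)) (\<lambda>_. None) (rev l)"

lemma log_cell_simps [simp]:
  "log_cell [] = (\<lambda>_. None)" "log_cell (e # l) = (log_cell l)(pos (fst e) := snd e)"
  by (simp_all add: log_cell_def)

text \<open>Positions are differences of natural numbers; cross addition compares them without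
  subtraction. The fold ends with the most recent write to the cell.\<close>

definition log_read :: "wlog \<Rightarrow> nat \<times> nat \<Rightarrow> sym" where
  "log_read l p = foldl (\<lambda>c e. if fst (fst e) + snd p = fst p + snd (fst e) then snd e else c) None (rev l)"

lemma log_read: "log_read l p = log_cell l (pos p)"
  by (induction l) (auto simp: log_read_def pos_def)

lemma PT_log_read [PT_intros]:
  assumes "PT f" "PT g"
  shows "PT (\<lambda>z. log_read (f z) (g z))"
proof -
  have "PT (\<lambda>t :: 'a \<times> sym \<times> ((nat \<times> nat) \<times> sym). g (fst t))"
    by (rule PT_compose[OF assms(2)]) (intro PT_intros)
  note g = this
  show ?thesis unfolding log_read_def
  proof (rule PT_foldl[where g = "\<lambda>n. n"])
    show "sz (if fst (fst e) + snd (g z) = fst (g z) + snd (fst e) then snd e else acc) \<le> sz acc + (sz z + sz e)"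
      for z acc and e :: "(nat \<times> nat) \<times> sym"
      using sz_snd[of e] by simp
  qed (intro PT_intros assms g pb_intros)+
qed

definition input_log_step :: "nat \<times> wlog \<Rightarrow> bool \<Rightarrow> nat \<times> wlog" where
  "input_log_step s b = (fst s + 1, ((fst s, 0), Some b) # snd s)"

definition input_log :: "bool list \<Rightarrow> wlog" where
  "input_log w = snd (foldl input_log_step (0, []) w)"

lemma input_log_aux: "foldl input_log_step (0, []) w = (length w, input_log w)"
proof -
  have "fst (foldl input_log_step (0, []) w) = length w"
    by (induction w rule: rev_induct) (simp_all add: input_log_step_def)
  then show ?thesis by (simp add: input_log_def prod_eq_iff)
qed

lemma input_log_Nil [simp]: "input_log [] = []"
  by (simp add: input_log_def)

lemma input_log_snoc [simp]: "input_log (w @ [b]) = ((length w, 0), Some b) # input_log w"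
proof -
  have "input_log (w @ [b]) = snd (input_log_step (foldl input_log_step (0, []) w) b)"
    by (simp add: input_log_def)
  then show ?thesis unfolding input_log_aux by (simp add: input_log_step_def)
qed

lemma set_input_log: "set (input_log w) = {((i, 0), Some (w ! i)) |i. i < length w}"
proof (induction w rule: rev_induct)
  case (snoc b w)
  have "{((i, 0), Some ((w @ [b]) ! i)) |i. i < length (w @ [b])} =
      insert ((length w, 0), Some b) {((i, 0), Some ((w @ [b]) ! i)) |i. i < length w}"
    using less_Suc_eq by auto
  also have "{((i, 0), Some ((w @ [b]) ! i)) |i. i < length w} = {((i, 0), Some (w ! i)) |i. i < length w}"
    by (metis (no_types, lifting) nth_append_left)
  finally show ?case unfolding input_log_snoc list.set snoc by (rule sym)
qed simp

lemma length_input_log [simp]: "length (input_log w) = length w"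
  by (induction w rule: rev_induct) auto

lemma log_cell_input: "log_cell (input_log w) = fst (input_tape w)"
proof (induction w rule: rev_induct)
  case Nil
  show ?case by (auto simp: input_tape_def)
next
  case (snoc b w)
  show ?case
  proof
    fix z :: int
    have nat: "nat z < length w \<longleftrightarrow> z < int (length w)" if "0 \<le> z"
      using that by linarith
    consider "z = int (length w)" | "0 \<le> z" "z < int (length w)" | "z < 0 \<or> int (length w) < z" by linarith
    then show "log_cell (input_log (w @ [b])) z = fst (input_tape (w @ [b])) z"
      by cases (auto simp: snoc input_tape_def pos_def nth_append nat)
  qed
qed

text \<open>A new log entry repeats the head position, so the growth in one step depends on the
  accumulator and \<open>PT_foldl\<close> does not apply. The parameter \<open>m\<close> increases
  by one per step, which bounds the whole run through \<open>PT_foldl_bound\<close>.\<close>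

definition log_small :: "nat \<Rightarrow> ltape \<Rightarrow> bool" where
  "log_small m t \<longleftrightarrow> length (fst t) \<le> m \<and>
     (\<forall>p \<in> insert (snd t) (fst ` set (fst t)). fst p \<le> m \<and> snd p \<le> m)"

lemma bl_le_self: "bl n \<le> n"
  unfolding bl_le_iff by (rule less_exp)

lemma sz_option_sym: "sz (s :: sym) \<le> 7"
  by (cases s) (auto simp: sz_def tr_option_def tr_bool_def)

lemma sz_prod: "sz z = 1 + sz (fst z) + sz (snd z)"
  by (cases z) simp

lemma sz_list_le: "(\<And>x. x \<in> set xs \<Longrightarrow> sz x \<le> c) \<Longrightarrow> length xs \<le> m \<Longrightarrow> sz xs \<le> 1 + m * (1 + c)"
proof -
  assume *: "\<And>x. x \<in> set xs \<Longrightarrow> sz x \<le> c" and "length xs \<le> m"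
  from * have "sz xs \<le> 1 + length xs * (1 + c)"
  proof (induction xs)
    case (Cons a xs)
    then have "sz xs \<le> 1 + length xs * (1 + c)" "sz a \<le> c" by simp_all
    then show ?case by simp
  qed simp
  also have "\<dots> \<le> 1 + m * (1 + c)"
    using \<open>length xs \<le> m\<close> by (intro add_mono mult_le_mono) auto
  finally show ?thesis .
qed

lemma sz_ltape:
  assumes "log_small m t"
  shows "sz t \<le> 5 + 12 * m + m * (12 + 12 * m)"
proof -
  have p: "sz p \<le> 3 + 12 * m" if "fst p \<le> m" "snd p \<le> m" for p :: "nat \<times> nat"
    using that bl_le_self[of "fst p"] bl_le_self[of "snd p"] by (cases p) (simp add: sz_nat)
  have "sz e \<le> 11 + 12 * m" if "e \<in> set (fst t)" for e
  proof -
    have "sz (fst e) \<le> 3 + 12 * m"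
      using that assms by (intro p) (auto simp: log_small_def)
    then show ?thesis using sz_option_sym[of "snd e"] by (simp add: sz_prod)
  qed
  from sz_list_le[OF this] have "sz (fst t) \<le> 1 + m * (1 + (11 + 12 * m))"
    using assms by (simp add: log_small_def)
  moreover have "sz (snd t) \<le> 3 + 12 * m"
    using assms p[of "snd t"] by (simp add: log_small_def)
  ultimately show ?thesis by (cases t) simp
qed

lemma PT_input_log [PT_intros]:
  assumes "PT f"
  shows "PT (\<lambda>z. input_log (f z))"
proof -
  obtain p where p: "\<And>z. sz (f z) \<le> poly p (sz z)" using PT_size[OF assms] by blast
  have "PT (\<lambda>z. foldl input_log_step (0, []) (f z))"
  proof (rule PT_foldl_bound[where B = "\<lambda>n. 2 + 6 * poly p n + (5 + 12 * poly p n + poly p n * (12 + 12 * poly p n))"])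
    fix z pre post assume z: "f z = pre @ post"
    let ?m = "poly p (sz z)"
    have le: "length pre \<le> ?m"
      using p[of z] length_le_sz[of "f z"] z by simp
    then have "log_small ?m (input_log pre, (0, 0))"
      by (auto simp: log_small_def set_input_log)
    then have "sz (input_log pre, (0 :: nat, 0 :: nat)) \<le> 5 + 12 * ?m + ?m * (12 + 12 * ?m)"
      by (rule sz_ltape)
    moreover have "sz (length pre) \<le> 1 + 6 * ?m"
      using bl_le_self[of "length pre"] le by (simp add: sz_nat)
    ultimately show "sz (foldl input_log_step (0, []) pre)
        \<le> 2 + 6 * ?m + (5 + 12 * ?m + ?m * (12 + 12 * ?m))"
      unfolding input_log_aux by simp
  qed (unfold input_log_step_def, (intro PT_intros assms pb_intros)+)
  then show ?thesis unfolding input_log_def by (rule PT_snd)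
qed

fun dir_pair :: "dir \<Rightarrow> nat \<times> nat" where
  "dir_pair MoveLeft = (0, 1)"
| "dir_pair Stay = (0, 0)"
| "dir_pair MoveRight = (1, 0)"

lemma pos_dir_pair: "pos (dir_pair d) = offset d"
  by (cases d) (auto simp: pos_def)

lemma dir_pair_le: "fst (dir_pair d) \<le> 1" "snd (dir_pair d) \<le> 1"
  by (cases d; simp)+

definition tape_of :: "ltape \<Rightarrow> tape" where
  "tape_of t = (log_cell (fst t), pos (snd t))"

definition log_act :: "sym \<times> (nat \<times> nat) \<Rightarrow> ltape \<Rightarrow> ltape" where
  "log_act a t = ((snd t, fst a) # fst t, (fst (snd t) + fst (snd a), snd (snd t) + snd (snd a)))"

lemma tape_of_act: "tape_of (log_act (s, dir_pair d) t) = act (s, d) (tape_of t)"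
  by (simp add: tape_of_def log_act_def act_def pos_dir_pair[symmetric]) (simp add: pos_def)

lemma log_small_act: "log_small m t \<Longrightarrow> log_small (Suc m) (log_act (s, dir_pair d) t)"
  using dir_pair_le[of d] by (auto simp: log_small_def log_act_def)

text \<open>The blank that ends one word would lie inside any longer one, so the lengths
  agree.\<close>

lemma tape_holds_unique:
  assumes "tape_holds t v" "tape_holds t v'"
  shows "v = v'"
proof -
  have le: "length y \<le> length x" if "tape_holds t x" "tape_holds t y" for x y
    using that unfolding tape_holds_def by (metis not_le option.distinct(1))
  have "length v = length v'" using le[OF assms] le[OF assms(2,1)] by simp
  moreover from this have "v ! i = v' ! i" if "i < length v" for i
    using assms that unfolding tape_holds_def by (metis option.inject)
  ultimately show ?thesis by (rule nth_equalityI)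
qed

text \<open>The output tape is compared with a proposed word instead of being read off, which
  suffices to decide the graph of the computed function.\<close>

definition log_holds :: "wlog \<Rightarrow> bool list \<Rightarrow> bool" where
  "log_holds l v \<longleftrightarrow> list_all (\<lambda>e. log_read l (fst e) = snd e) (input_log v) \<and> log_read l (length v, 0) = None"

lemma log_holds: "log_holds (fst t) v = tape_holds (tape_of t) v"
  by (auto simp: log_holds_def tape_holds_def list_all_iff set_input_log log_read tape_of_def pos_def)

lemma PT_weaken: "PT f \<Longrightarrow> PT (\<lambda>t. f (fst t))"
  by (rule PT_compose[of f fst], assumption, intro PT_intros)

lemma PT_log_holds:
  assumes "PT f" "PT g"
  shows "PT (\<lambda>z. log_holds (f z) (g z))"
  unfolding log_holds_def
  by (intro PT_bool_ops(2) PT_list_all PT_sym_eq PT_log_read PT_input_log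
      PT_Pair PT_const PT_length PT_fst PT_snd PT_id PT_weaken[OF assms(1)] assms)

theorem polytime_computable_on_graph:
  assumes "polytime_computable_on D f"
  shows "\<exists>g. PT (\<lambda>t. g (fst t) (snd t)) \<and> (\<forall>w \<in> D. \<forall>v. g w v \<longleftrightarrow> v = f w)"
proof -
  obtain M and p :: "nat poly" where M: "turing_machine M"
    and comp: "\<And>w. w \<in> D \<Longrightarrow> computes_within M w (f w) (poly p (length w))"
    using assms unfolding polytime_computable_on_def by auto
  define k where "k = num_tapes M"
  have k: "2 \<le> k" using M by (simp add: turing_machine_def k_def)
  define tab where "tab x = (let r = delta M (fst x) (snd x) in
    (fst r, map (\<lambda>a. (fst a, dir_pair (snd a))) (snd r)))" for x :: "nat \<times> sym list"
  define S where "S = {..<num_states M} \<times> {ss :: sym list. set ss \<subseteq> UNIV \<and> length ss = k}"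
  have fin: "finite S" unfolding S_def
    by (intro finite_cartesian_product finite_lists_length_eq) simp_all
  obtain h where h: "PT h" "\<And>x. x \<in> S \<Longrightarrow> h x = tab x" using PT_finite[OF fin, of tab] by auto
  \<comment> \<open>Successor states are arbitrary natural numbers, but only finitely many occur in
    the table, so their sizes have a common bound; the summand 1 covers the start state 0.\<close>
  define C where "C = 1 + (\<Sum>x\<in>S. sz (fst (tab x)))"
  have C: "sz (fst (tab x)) \<le> C" if "x \<in> S" for x
    using member_le_sum[of x S "\<lambda>x. sz (fst (tab x))"] that fin by (simp add: C_def)
  define sim where "sim c = (if fst c < num_states M then
      (let r = h (fst c, map (\<lambda>t. log_read (fst t) (snd t)) (snd c)) in
       (fst r, map (\<lambda>t. log_act (fst t) (snd t)) (zip (snd r) (snd c)))) else c)" for c :: "nat \<times> ltape list"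
  define conf where "conf c = (fst c, map tape_of (snd c))" for c :: "nat \<times> ltape list"
  define small where "small m c \<longleftrightarrow> sz (fst c) \<le> C \<and> length (snd c) = k \<and> (\<forall>t \<in> set (snd c). log_small m t)"
    for m and c :: "nat \<times> ltape list"
  have sim: "conf (sim c) = step M (conf c) \<and> small (Suc m) (sim c)" if "small m c" for m c
  proof (cases "fst c < num_states M")
    case False
    have "log_small (Suc m) t" if "log_small m t" for t
      using that by (auto simp: log_small_def)
    then have "small (Suc m) c" using that by (simp add: small_def)
    moreover have "sim c = c" using False by (simp only: sim_def if_False)
    moreover have "step M (conf c) = conf c" using False by (simp add: step_def conf_def)
    ultimately show ?thesis by simp
  next
    case True
    let ?ss = "map read_sym (map tape_of (snd c))"
    have len: "length (snd c) = k" using that by (simp add: small_def)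
    have ss: "map (\<lambda>t. log_read (fst t) (snd t)) (snd c) = ?ss"
      by (simp add: log_read tape_of_def read_sym_def)
    have "length ?ss = num_tapes M" using len by (simp add: k_def)
    then have lenr: "length (snd (delta M (fst c) ?ss)) = k"
      using M[unfolded turing_machine_def, THEN conjunct2, rule_format, OF True] by (simp add: k_def)
    have "(fst c, ?ss) \<in> S" using True len by (simp add: S_def)
    then have r: "h (fst c, ?ss) = tab (fst c, ?ss)" "sz (fst (tab (fst c, ?ss))) \<le> C"
      using h(2) C by auto
    define as where "as = snd (delta M (fst c) ?ss)"
    have sim_c: "sim c = (fst (delta M (fst c) ?ss),
       map (\<lambda>t. log_act (fst t) (snd t)) (zip (map (\<lambda>a. (fst a, dir_pair (snd a))) as) (snd c)))"
      using True unfolding sim_def ss r(1) by (simp add: tab_def Let_def as_def)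
    have "map tape_of (map (\<lambda>t. log_act (fst t) (snd t)) (zip (map (\<lambda>a. (fst a, dir_pair (snd a))) as) (snd c)))
        = map2 act as (map tape_of (snd c))"
      by (rule nth_equalityI) (simp_all add: tape_of_act)
    then have "conf (sim c) = step M (conf c)"
      using True by (simp add: sim_c conf_def step_def as_def Let_def)
    moreover have "small (Suc m) (sim c)"
    proof -
      have "sz (fst (sim c)) \<le> C" using r(2) by (simp add: sim_c tab_def Let_def)
      moreover have "length (snd (sim c)) = k" using lenr len by (simp add: sim_c as_def)
      moreover have "log_small (Suc m) t" if "t \<in> set (snd (sim c))" for t
      proof -
        from that obtain a t' where "t = log_act (fst a, dir_pair (snd a)) t'" "t' \<in> set (snd c)"
          by (auto simp: sim_c zip_map1 dest: set_zip_rightD)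
        then show ?thesis using \<open>small m c\<close> by (auto simp: small_def intro!: log_small_act)
      qed
      ultimately show ?thesis by (simp add: small_def)
    qed
    ultimately show ?thesis by blast
  qed
  obtain u :: "bool list \<Rightarrow> bool list" where u: "PT u" "\<And>w. length (u w) = poly p (length w)"
    using PT_unary_poly[of p] by auto
  define init :: "bool list \<Rightarrow> nat \<times> ltape list"
    where "init w = (0, (input_log w, (0, 0)) # replicate (k - 1) ([], (0, 0)))" for w
  have init: "conf (init w) = start_config M w" "small (length w) (init w)" for w
  proof -
    have "tape_of (input_log w, (0, 0)) = input_tape w" "tape_of ([], (0, 0)) = blank_tape"
      by (auto simp: tape_of_def log_cell_input pos_def blank_tape_def) (auto simp: input_tape_def)
    then show "conf (init w) = start_config M w"
      by (simp add: conf_def init_def start_config_def k_def)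
    show "small (length w) (init w)"
      using k by (auto simp: small_def init_def log_small_def set_input_log C_def sz_nat)
  qed
  let ?F = "\<lambda>w. foldl (\<lambda>c _. sim c) (init w) (u w)"
  have run: "conf (foldl (\<lambda>c _. sim c) (init w) es) = (step M ^^ length es) (start_config M w) \<and>
      small (length w + length es) (foldl (\<lambda>c _. sim c) (init w) es)" for w and es :: "bool list"
  proof (induction es rule: rev_induct)
    case Nil
    then show ?case using init by simp
  next
    case (snoc e es)
    then show ?case
      using sim[of "length w + length es" "foldl (\<lambda>c _. sim c) (init w) es"] by simp
  qed
  have "PT sim"
  proof -
    have "PT (\<lambda>c :: nat \<times> ltape list. h (fst c, map (\<lambda>t. log_read (fst t) (snd t)) (snd c)))"
      by (rule PT_compose[OF h(1)]) (intro PT_intros)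
    then show ?thesis
      unfolding sim_def Let_def log_act_def by (intro PT_intros)
  qed
  then have simt: "PT (\<lambda>t :: bool list \<times> (nat \<times> ltape list) \<times> bool. sim (fst (snd t)))"
    by (rule PT_compose) (intro PT_intros)
  have F: "PT ?F"
  proof (rule PT_foldl_bound[where B = "\<lambda>n. let m = n + poly p n in 2 + C + k * (1 + (5 + 12 * m + m * (12 + 12 * m)))"])
    fix w pre post assume uw: "u w = pre @ post"
    let ?m = "sz w + poly p (sz w)"
    let ?c = "foldl (\<lambda>c _. sim c) (init w) pre"
    have "length pre \<le> length (u w)" by (simp add: uw)
    also have "\<dots> \<le> poly p (sz w)" unfolding u by (rule poly_mono_nat) (rule length_le_sz)
    finally have m: "length w + length pre \<le> ?m" using length_le_sz[of w] by simp
    have s: "small (length w + length pre) ?c" using run by blast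
    have "sz t \<le> 5 + 12 * ?m + ?m * (12 + 12 * ?m)" if "t \<in> set (snd ?c)" for t
    proof (rule sz_ltape)
      have "log_small (length w + length pre) t" using s that by (simp add: small_def)
      then show "log_small ?m t" using m by (auto simp: log_small_def intro: le_trans)
    qed
    from sz_list_le[OF this, where m = k] have "sz (snd ?c) \<le> 1 + k * (1 + (5 + 12 * ?m + ?m * (12 + 12 * ?m)))"
      using s by (simp add: small_def)
    moreover have "sz (fst ?c) \<le> C" using s by (simp add: small_def)
    moreover have "sz ?c = 1 + sz (fst ?c) + sz (snd ?c)" by (rule sz_prod)
    ultimately show "sz ?c \<le> (let m = ?m in 2 + C + k * (1 + (5 + 12 * m + m * (12 + 12 * m))))"
      unfolding Let_def by linarith
  next
    show "PT init" unfolding init_def by (intro PT_intros)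
  qed (unfold Let_def, (intro simt u(1) pb_intros)+)
  have g: "PT (\<lambda>t. log_holds (fst (hd (tl (snd (?F (fst t)))))) (snd t))"
    by (intro PT_log_holds PT_fst PT_hd PT_tl PT_snd PT_weaken[OF F] PT_id)
  have "log_holds (fst (hd (tl (snd (?F w))))) v \<longleftrightarrow> v = f w" if "w \<in> D" for w v
  proof -
    let ?c = "(step M ^^ poly p (length w)) (start_config M w)"
    have c: "conf (?F w) = ?c" "length (snd (?F w)) = k"
      using run[of w "u w"] by (simp_all add: u small_def)
    then have "snd ?c ! 1 = tape_of (snd (?F w) ! 1)"
      using k unfolding c(1)[symmetric] by (simp add: conf_def)
    moreover have "snd (?F w) ! 1 = hd (tl (snd (?F w)))"
      using c(2) k by (cases "snd (?F w)"; cases "tl (snd (?F w))") auto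
    ultimately have "log_holds (fst (hd (tl (snd (?F w))))) v \<longleftrightarrow> tape_holds (snd ?c ! 1) v"
      by (simp add: log_holds)
    moreover have "tape_holds (snd ?c ! 1) (f w)"
      using comp[OF that] by (simp add: computes_within_def Let_def)
    ultimately show ?thesis using tape_holds_unique by blast
  qed
  with g show ?thesis by (intro exI[of _ "\<lambda>w v. log_holds (fst (hd (tl (snd (?F w))))) v"]) simp
qed


section \<open>Small rational solutions of linear systems\<close>

definition ldot :: "nat \<Rightarrow> (nat \<Rightarrow> int) \<Rightarrow> (nat \<Rightarrow> real) \<Rightarrow> real" where
  "ldot d c z = (\<Sum>j<d. real_of_int (c j) * z j)"

lemma ldot_add: "ldot d c (\<lambda>j. x j + t * y j) = ldot d c x + t * ldot d c y"
  by (simp add: ldot_def algebra_simps sum.distrib sum_distrib_left)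

lemma ldot_minus: "ldot d c (\<lambda>j. - x j) = - ldot d c x"
  by (simp add: ldot_def sum_negf)

text \<open>
  A feasible point with a maximal set of tight constraints: moving along a direction that is
  orthogonal to the tight constraints makes a further constraint tight.
\<close>

lemma tight_constraints_span:
  fixes S :: "((nat \<Rightarrow> int) \<times> int) set"
  assumes "finite S"
    and feas: "\<And>c b. (c, b) \<in> S \<Longrightarrow> ldot d c z \<le> of_int b"
    and nonneg: "\<And>j. j < d \<Longrightarrow> ((\<lambda>i. if i = j then - 1 else 0), 0) \<in> S"
  shows "\<exists>z. (\<forall>(c, b) \<in> S. ldot d c z \<le> of_int b) \<and>
    (\<forall>v. (\<exists>j<d. v j \<noteq> 0) \<longrightarrow> (\<exists>(c, b) \<in> S. ldot d c z = of_int b \<and> ldot d c v \<noteq> 0))"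
proof -
  define F where "F z \<longleftrightarrow> (\<forall>(c, b) \<in> S. ldot d c z \<le> of_int b)" for z
  define T where "T z = {(c, b) \<in> S. ldot d c z = of_int b}" for z
  have finT: "finite (T z)" "card (T z) \<le> card S" for z
    using assms(1) by (auto simp: T_def intro!: card_mono intro: finite_subset)
  have "F z" using feas by (auto simp: F_def)
  then obtain z where z: "F z" "\<And>y. F y \<Longrightarrow> card (T y) \<le> card (T z)"
    using ex_has_greatest_nat[of F z "\<lambda>z. card (T z)" "Suc (card S)"] finT by (auto simp: less_Suc_eq_le)
  have "\<exists>(c, b) \<in> S. ldot d c z = of_int b \<and> ldot d c v \<noteq> 0" if ex: "\<exists>j<d. v j \<noteq> 0" for v
  proof (rule ccontr)
    assume "\<not> ?thesis"
    then have orth: "ldot d c v = 0" if "(c, b) \<in> T z" for c b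
      using that by (auto simp: T_def)
    \<comment> \<open>With a negative coordinate the direction runs against a nonnegativity
      constraint, so some inequality must become tight along it. Either \<open>v\<close> or its
      negative qualifies.\<close>
    have "\<exists>w. (\<exists>j<d. w j < 0) \<and> (\<forall>(c, b) \<in> T z. ldot d c w = 0)"
    proof (cases "\<exists>j<d. v j < 0")
      case True
      then show ?thesis using orth by blast
    next
      case False
      with ex have "\<exists>j<d. - v j < 0" by (metis linorder_neqE_linordered_idom neg_less_0_iff_less)
      moreover have "\<forall>(c, b) \<in> T z. ldot d c (\<lambda>j. - v j) = 0"
        using orth by (auto simp: ldot_minus)
      ultimately show ?thesis by (intro exI[of _ "\<lambda>j. - v j"]) blast
    qed
    then obtain w j where w: "j < d" "w j < 0" "\<And>c b. (c, b) \<in> T z \<Longrightarrow> ldot d c w = 0" by blast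
    define R where "R = {(c, b) \<in> S. 0 < ldot d c w}"
    \<comment> \<open>Ratio test: \<open>\<rho> s\<close> is the distance along \<open>w\<close> at
      which \<open>s\<close> becomes tight. The least such distance violates nothing.\<close>
    define \<rho> where "\<rho> s = (of_int (snd s) - ldot d (fst s) z) / ldot d (fst s) w" for s :: "(nat \<Rightarrow> int) \<times> int"
    have "ldot d (\<lambda>i. if i = j then - 1 else 0) w = (\<Sum>i<d. if i = j then - w j else 0)"
      unfolding ldot_def by (rule sum.cong) auto
    also have "\<dots> = - w j" using w(1) by simp
    finally have "((\<lambda>i. if i = j then - 1 else 0), 0) \<in> R"
      using nonneg[OF w(1)] w(2) by (simp add: R_def)
    then have R: "finite R" "R \<noteq> {}" using assms(1) by (auto simp: R_def intro: finite_subset)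
    obtain s where s: "s \<in> R" "\<And>s'. s' \<in> R \<Longrightarrow> \<rho> s \<le> \<rho> s'"
      using arg_min_if_finite[OF R, of \<rho>] by (metis not_le)
    define t where "t = \<rho> s"
    define y where "y = (\<lambda>j. z j + t * w j)"
    obtain cs bs where scb: "s = (cs, bs)" "(cs, bs) \<in> S" "0 < ldot d cs w"
      using s(1) by (auto simp: R_def)
    have t: "0 \<le> t" using z(1) scb by (auto simp: t_def \<rho>_def F_def)
    have "ldot d c y \<le> of_int b" if "(c, b) \<in> S" for c b
    proof (cases "0 < ldot d c w")
      case True
      then have "t \<le> \<rho> (c, b)" using s(2)[of "(c, b)"] that by (simp add: R_def t_def)
      then show ?thesis using True by (simp add: \<rho>_def y_def ldot_add pos_le_divide_eq)
    next
      case False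
      then have "t * ldot d c w \<le> 0" using t by (simp add: mult_nonneg_nonpos)
      moreover have "ldot d c z \<le> of_int b" using z(1) that by (auto simp: F_def)
      ultimately show ?thesis by (simp add: y_def ldot_add)
    qed
    then have "F y" by (auto simp: F_def)
    have "T z \<subseteq> T y" using w(3) by (auto simp: T_def y_def ldot_add)
    moreover have "ldot d cs y = of_int bs"
      unfolding y_def ldot_add using scb by (simp add: t_def \<rho>_def)
    then have "s \<in> T y" using scb by (simp add: T_def)
    moreover have "s \<notin> T z" using scb w(3) by fastforce
    ultimately have "T z \<subset> T y" by blast
    then have "card (T z) < card (T y)" by (rule psubset_card_mono[OF finT(1)])
    then show False using z(2)[OF \<open>F y\<close>] by simp
  qed
  then show ?thesis using z(1) unfolding F_def by blast
qed

definition rows_mat :: "nat \<Rightarrow> (nat \<Rightarrow> nat \<Rightarrow> int) \<Rightarrow> int mat" where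
  "rows_mat k r = mat k k (\<lambda>(i, j). r i j)"

text \<open>
  A nonzero minor on the first \<open>k\<close> columns extends to one on the first \<open>k + 1\<close> columns, since its
  cofactors form a nonzero vector, and the new row may be any row that is not orthogonal to it.
\<close>

lemma nonsingular_rows:
  fixes Cs :: "(nat \<Rightarrow> int) set"
  assumes span: "\<And>v. \<exists>j<d. v j \<noteq> 0 \<Longrightarrow> \<exists>c\<in>Cs. ldot d c v \<noteq> 0"
    and "k \<le> d"
  shows "\<exists>r. (\<forall>i<k. r i \<in> Cs) \<and> det (rows_mat k r) \<noteq> 0"
  using assms(2)
proof (induction k)
  case 0
  show ?case by (simp add: rows_mat_def)
next
  case (Suc k)
  then obtain r where r: "\<And>i. i < k \<Longrightarrow> r i \<in> Cs" "det (rows_mat k r) \<noteq> 0" by auto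
  define v where "v j = (if j \<le> k then cofactor (rows_mat (Suc k) r) k j else 0)" for j
  have "mat_delete (rows_mat (Suc k) r) k k = rows_mat k r"
    by (rule eq_matI) (auto simp: mat_delete_def rows_mat_def)
  then have "v k \<noteq> 0" using r(2) by (simp add: v_def cofactor_def)
  then have "\<exists>j<d. real_of_int (v j) \<noteq> 0" using Suc.prems by (intro exI[of _ k]) auto
  from span[OF this] obtain c where c: "c \<in> Cs" "ldot d c (\<lambda>j. real_of_int (v j)) \<noteq> 0" by blast
  define r' where "r' = r(k := c)"
  have cof: "cofactor (rows_mat (Suc k) r') k j = cofactor (rows_mat (Suc k) r) k j" for j
  proof -
    have "mat_delete (rows_mat (Suc k) r') k j = mat_delete (rows_mat (Suc k) r) k j"
      by (rule eq_matI) (auto simp: mat_delete_def rows_mat_def r'_def)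
    then show ?thesis by (simp add: cofactor_def)
  qed
  have "det (rows_mat (Suc k) r') = (\<Sum>j<Suc k. rows_mat (Suc k) r' $$ (k, j) * cofactor (rows_mat (Suc k) r') k j)"
    by (rule laplace_expansion_row) (simp_all add: rows_mat_def)
  also have "\<dots> = (\<Sum>j<Suc k. c j * v j)"
    by (rule sum.cong) (simp_all add: cof v_def, simp_all add: rows_mat_def r'_def)
  also have "\<dots> = (\<Sum>j<d. c j * v j)"
    using Suc.prems by (intro sum.mono_neutral_left) (auto simp: v_def)
  finally have "real_of_int (det (rows_mat (Suc k) r')) = ldot d c (\<lambda>j. real_of_int (v j))"
    by (simp add: ldot_def)
  then have "det (rows_mat (Suc k) r') \<noteq> 0" using c(2) by auto
  moreover have "\<forall>i<Suc k. r' i \<in> Cs" using r(1) c(1) by (auto simp: r'_def less_Suc_eq)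
  ultimately show ?case by blast
qed

text \<open>Leibniz' formula has \<open>n!\<close> terms; the crude factorial contributes only
  polynomially many bits.\<close>

lemma abs_det_le:
  fixes A :: "int mat"
  assumes A: "A \<in> carrier_mat n n" and bound: "\<And>i j. i < n \<Longrightarrow> j < n \<Longrightarrow> \<bar>A $$ (i, j)\<bar> \<le> \<Delta>"
  shows "\<bar>det A\<bar> \<le> fact n * \<Delta> ^ n"
proof -
  have "\<bar>det A\<bar> \<le> (\<Sum>p | p permutes {0..<n}. \<bar>signof p * (\<Prod>i = 0..<n. A $$ (i, p i))\<bar>)"
    unfolding det_def'[OF A] by (rule sum_abs)
  also have "\<dots> \<le> (\<Sum>p | p permutes {0..<n}. \<Delta> ^ n)"
  proof (rule sum_mono)
    fix p assume "p \<in> {p. p permutes {0..<n}}"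
    then have p: "p i < n" if "i < n" for i using that permutes_in_image[of p "{0..<n}" i] by auto
    have "\<bar>signof p * (\<Prod>i = 0..<n. A $$ (i, p i))\<bar> = (\<Prod>i = 0..<n. \<bar>A $$ (i, p i)\<bar>)"
      by (simp add: abs_mult abs_prod sign_def)
    also have "\<dots> \<le> (\<Prod>i = 0..<n. \<Delta>)"
      using p by (intro prod_mono) (auto intro: bound)
    finally show "\<bar>signof p * (\<Prod>i = 0..<n. A $$ (i, p i))\<bar> \<le> \<Delta> ^ n" by simp
  qed
  also have "\<dots> = fact n * \<Delta> ^ n"
    by (simp add: card_permutations[of "{0..<n}" n])
  finally show ?thesis .
qed

text \<open>The tight constraints at the chosen point contain a nonsingular square system, so the
  point is its unique solution, and Cramer's rule writes all coordinates over the absolute value of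
  one determinant.\<close>

lemma basic_solution:
  fixes S :: "((nat \<Rightarrow> int) \<times> int) set"
  assumes "finite S"
    and feas: "\<And>c b. (c, b) \<in> S \<Longrightarrow> ldot d c z \<le> of_int b"
    and nonneg: "\<And>j. j < d \<Longrightarrow> ((\<lambda>i. if i = j then - 1 else 0), 0) \<in> S"
    and bound: "\<And>c b j. (c, b) \<in> S \<Longrightarrow> j < d \<Longrightarrow> \<bar>c j\<bar> \<le> \<Delta>" "\<And>c b. (c, b) \<in> S \<Longrightarrow> \<bar>b\<bar> \<le> \<Delta>"
  shows "\<exists>p q. 0 < q \<and> q \<le> fact d * \<Delta> ^ d \<and> (\<forall>j<d. p j \<le> fact d * \<Delta> ^ d) \<and>
    (\<forall>(c, b) \<in> S. (\<Sum>j<d. c j * p j) \<le> b * q)"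
proof -
  obtain z where z: "\<And>c b. (c, b) \<in> S \<Longrightarrow> ldot d c z \<le> of_int b"
    and span: "\<And>v. \<exists>j<d. v j \<noteq> 0 \<Longrightarrow> \<exists>(c, b) \<in> S. ldot d c z = of_int b \<and> ldot d c v \<noteq> 0"
    using tight_constraints_span[of S d z, OF assms(1-3)] by blast
  define Cs where "Cs = {c. \<exists>b. (c, b) \<in> S \<and> ldot d c z = of_int b}"
  have "\<exists>c\<in>Cs. ldot d c v \<noteq> 0" if "\<exists>j<d. v j \<noteq> 0" for v
    using span[OF that] by (auto simp: Cs_def)
  then obtain r where r: "\<And>i. i < d \<Longrightarrow> r i \<in> Cs" and det: "det (rows_mat d r) \<noteq> 0"
    using nonsingular_rows[of d Cs d] by blast
  have "\<exists>b. \<forall>i<d. (r i, b i) \<in> S \<and> ldot d (r i) z = of_int (b i)"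
  proof -
    have "\<forall>i. \<exists>b. i < d \<longrightarrow> (r i, b) \<in> S \<and> ldot d (r i) z = of_int b"
      using r by (auto simp: Cs_def)
    then show ?thesis by (metis choice)
  qed
  then obtain b where b: "\<And>i. i < d \<Longrightarrow> (r i, b i) \<in> S" "\<And>i. i < d \<Longrightarrow> ldot d (r i) z = of_int (b i)" by blast
  let ?A = "rows_mat d r"
  define D where "D j = det (replace_col ?A (vec d b) j)" for j
  have A: "?A \<in> carrier_mat d d" by (simp add: rows_mat_def)
  have rc: "replace_col ?A (vec d b) j \<in> carrier_mat d d" for j
    by (simp add: replace_col_def rows_mat_def)
  have cramer: "real_of_int (D j) = z j * real_of_int (det ?A)" if "j < d" for j
  proof -
    let ?R = "map_mat real_of_int ?A"
    have R: "?R \<in> carrier_mat d d" using A by simp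
    have "?R *\<^sub>v vec d z = map_vec real_of_int (vec d b)"
    proof (rule eq_vecI)
      fix i assume "i < dim_vec (map_vec real_of_int (vec d b))"
      then have i: "i < d" by simp
      have "(?R *\<^sub>v vec d z) $ i = ldot d (r i) z"
        using i by (simp add: rows_mat_def scalar_prod_def ldot_def lessThan_atLeast0)
      then show "(?R *\<^sub>v vec d z) $ i = map_vec real_of_int (vec d b) $ i"
        using b(2)[OF i] i by simp
    qed (simp add: rows_mat_def)
    then have "det (replace_col ?R (map_vec real_of_int (vec d b)) j) = z j * det ?R"
      using cramer_lemma_mat[OF R, of "vec d z" j] that by simp
    moreover have "replace_col ?R (map_vec real_of_int (vec d b)) j = map_mat real_of_int (replace_col ?A (vec d b) j)"
      by (rule eq_matI) (auto simp: replace_col_def rows_mat_def)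
    ultimately show ?thesis by (simp add: D_def of_int_hom.hom_det)
  qed
  \<comment> \<open>Multiplying by the sign of the determinant makes the common denominator
    positive.\<close>
  define \<epsilon> where "\<epsilon> = sgn (det ?A)"
  define q where "q = \<epsilon> * det ?A"
  define p where "p j = \<epsilon> * D j" for j
  have q: "q = \<bar>det ?A\<bar>" by (simp add: q_def \<epsilon>_def sgn_mult_abs mult_sgn_abs abs_sgn mult.commute)
  have eps: "\<bar>\<epsilon>\<bar> = 1" using det by (simp add: \<epsilon>_def)
  have pz: "real_of_int (p j) = real_of_int q * z j" if "j < d" for j
    using cramer[OF that] by (simp add: p_def q_def)
  have "\<bar>det ?A\<bar> \<le> fact d * \<Delta> ^ d"
    by (rule abs_det_le[OF A]) (auto simp: rows_mat_def intro: bound(1) b(1))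
  moreover have "p j \<le> fact d * \<Delta> ^ d" if "j < d" for j
  proof -
    have "p j \<le> \<bar>p j\<bar>" by simp
    also have "\<dots> = \<bar>D j\<bar>" by (simp add: p_def abs_mult eps)
    also have "\<dots> \<le> fact d * \<Delta> ^ d" unfolding D_def
      by (rule abs_det_le[OF rc]) (auto simp: replace_col_def rows_mat_def intro: bound b(1))
    finally show ?thesis .
  qed
  moreover have "(\<Sum>j<d. c j * p j) \<le> \<beta> * q" if "(c, \<beta>) \<in> S" for c \<beta>
  proof -
    have "real_of_int (\<Sum>j<d. c j * p j) = (\<Sum>j<d. real_of_int q * (real_of_int (c j) * z j))"
      unfolding of_int_sum by (rule sum.cong) (simp_all add: pz)
    also have "\<dots> = real_of_int q * ldot d c z" by (simp add: ldot_def sum_distrib_left)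
    also have "\<dots> \<le> real_of_int q * real_of_int \<beta>"
      using z[OF that] q by (intro mult_left_mono) auto
    finally have "real_of_int (\<Sum>j<d. c j * p j) \<le> real_of_int (\<beta> * q)" by (simp add: mult.commute)
    then show ?thesis by (simp only: of_int_le_iff)
  qed
  ultimately show ?thesis using q det by (intro exI[of _ p] exI[of _ q]) auto
qed

text \<open>
  Strict inequalities are handled by homogenization: in the cone over the solution set a strict
  inequality can be given slack 1 by scaling.
\<close>

lemma rational_solution:
  fixes S :: "((nat \<Rightarrow> int) \<times> int \<times> bool) set" and z :: "nat \<Rightarrow> real"
  assumes "finite S"
    and feas: "\<And>c b st. (c, b, st) \<in> S \<Longrightarrow> if st then ldot d c z < of_int b else ldot d c z \<le> of_int b"
    and nonneg: "\<And>j. j < d \<Longrightarrow> 0 \<le> z j"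
    and bound: "\<And>c b st j. (c, b, st) \<in> S \<Longrightarrow> j < d \<Longrightarrow> \<bar>c j\<bar> \<le> int \<Delta>" "\<And>c b st. (c, b, st) \<in> S \<Longrightarrow> \<bar>b\<bar> \<le> int \<Delta>"
    and "1 \<le> \<Delta>"
  shows "\<exists>(p :: nat \<Rightarrow> nat) q. 0 < q \<and> q \<le> fact (Suc d) * \<Delta> ^ Suc d \<and> (\<forall>j<d. p j \<le> fact (Suc d) * \<Delta> ^ Suc d) \<and>
    (\<forall>(c, b, st) \<in> S. if st then (\<Sum>j<d. c j * int (p j)) < b * int q else (\<Sum>j<d. c j * int (p j)) \<le> b * int q)"
proof -
  define hom where "hom = (\<lambda>(c :: nat \<Rightarrow> int, b :: int, st). (c(d := - b), if st then - 1 else 0 :: int))"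
  define unit where "unit j = ((\<lambda>i. if i = j then - 1 else 0 :: int), 0 :: int)" for j :: nat
  \<comment> \<open>The inserted constraint says that coordinate \<open>d\<close> is at least 1. It
    keeps away from the apex of the cone, so that this coordinate can be divided by.\<close>
  define S' where "S' = insert (fst (unit d), - 1) (hom ` S \<union> unit ` {..<Suc d})"
  \<comment> \<open>A scaling factor that brings the slack of every strict inequality to at least 1:
    the sum of the reciprocals exceeds each of them. The leading 1 serves the constraint on
    coordinate \<open>d\<close>.\<close>
  define s where "s = 1 + (\<Sum>(c, b, st) \<in> S. if st then 1 / (of_int b - ldot d c z) else 0)"
  define y where "y = (\<lambda>j. if j = d then s else s * z j)"
  let ?t = "\<lambda>(c, b, st). if st then 1 / (real_of_int b - ldot d c z) else 0"
  have nn: "0 \<le> ?t e" if "e \<in> S" for e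
  proof -
    obtain c b st where "e = (c, b, st)" by (cases e) auto
    then show ?thesis using feas[of c b st] that by (simp split: if_splits)
  qed
  have slack: "1 / (of_int b - ldot d c z) \<le> s" if "(c, b, True) \<in> S" for c b
    using member_le_sum[of "(c, b, True)" S ?t, OF that nn assms(1)] by (simp add: s_def)
  have s1: "1 \<le> s" unfolding s_def
    using sum_nonneg[of S ?t, OF nn] by simp
  have ldot_hom: "ldot (Suc d) (c(d := - b)) y = s * (ldot d c z - of_int b)" for c b
  proof -
    have "ldot (Suc d) (c(d := - b)) y = (\<Sum>j<d. real_of_int (c j) * (s * z j)) - of_int b * s"
      unfolding ldot_def y_def by simp
    also have "(\<Sum>j<d. real_of_int (c j) * (s * z j)) = s * ldot d c z"
      unfolding ldot_def sum_distrib_left by (rule sum.cong) auto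
    finally show ?thesis by (simp add: algebra_simps del: fun_upd_apply)
  qed
  have ldot_unit: "ldot (Suc d) (fst (unit j)) x = - x j" if "j < Suc d" for j x
  proof -
    have "ldot (Suc d) (fst (unit j)) x = (\<Sum>i<Suc d. if i = j then - x j else 0)"
      unfolding ldot_def unit_def fst_conv by (rule sum.cong) auto
    also have "\<dots> = - x j" using that by (simp del: sum.lessThan_Suc)
    finally show ?thesis .
  qed
  have "\<exists>p q. 0 < q \<and> q \<le> fact (Suc d) * int \<Delta> ^ Suc d \<and> (\<forall>j<Suc d. p j \<le> fact (Suc d) * int \<Delta> ^ Suc d) \<and>
    (\<forall>(c, b) \<in> S'. (\<Sum>j<Suc d. c j * p j) \<le> b * q)"
  proof (rule basic_solution)
    show "finite S'" using assms(1) by (simp add: S'_def)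
    show "ldot (Suc d) c y \<le> of_int b" if mem: "(c, b) \<in> S'" for c b
    proof -
      from mem consider "c = fst (unit d)" "b = - 1" | "(c, b) \<in> hom ` S" | j where "j < Suc d" "(c, b) = unit j"
        unfolding S'_def by auto
      then show ?thesis
      proof cases
        case 1
        then show ?thesis using s1 ldot_unit[of d y] by (simp add: y_def)
      next
        case 2
        then obtain c' b' st where c': "(c', b', st) \<in> S" "c = c'(d := - b')" "b = (if st then - 1 else 0)"
          by (auto simp: hom_def)
        show ?thesis
        proof (cases st)
          case True
          then have lt: "0 < of_int b' - ldot d c' z" using feas[OF c'(1)] by simp
          have "1 / (of_int b' - ldot d c' z) \<le> s" using slack[of c' b'] c'(1) True by simp
          then have "1 \<le> s * (of_int b' - ldot d c' z)" using lt by (simp add: pos_divide_le_eq)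
          then show ?thesis unfolding c'(2,3) ldot_hom using True by (simp add: algebra_simps)
        next
          case False
          then have "ldot d c' z - of_int b' \<le> 0" using feas[OF c'(1)] by simp
          then have "s * (ldot d c' z - of_int b') \<le> 0" using s1 by (simp add: mult_nonneg_nonpos)
          then show ?thesis unfolding c'(2,3) ldot_hom using False by simp
        qed
      next
        case 3
        then have c: "c = fst (unit j)" "b = 0" by (simp_all add: unit_def)
        have "0 \<le> y j" using 3(1) nonneg[of j] s1 by (auto simp: y_def less_Suc_eq)
        then show ?thesis unfolding c using ldot_unit[OF 3(1), of y] by simp
      qed
    qed
    show "((\<lambda>i. if i = j then - 1 else 0), 0) \<in> S'" if "j < Suc d" for j
      using that by (auto simp: S'_def unit_def)
    show "\<bar>c j\<bar> \<le> int \<Delta>" if "(c, b) \<in> S'" "j < Suc d" for c b j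
      using that assms(6) by (auto simp: S'_def unit_def hom_def less_Suc_eq intro: bound split: if_splits)
    show "\<bar>b\<bar> \<le> int \<Delta>" if "(c, b) \<in> S'" for c b
      using that assms(6) by (auto simp: S'_def unit_def hom_def split: if_splits)
  qed
  then obtain p q where q: "0 < q" and p: "\<And>j. j < Suc d \<Longrightarrow> p j \<le> fact (Suc d) * int \<Delta> ^ Suc d"
    and sol: "\<And>c b. (c, b) \<in> S' \<Longrightarrow> (\<Sum>j<Suc d. c j * p j) \<le> b * q" by blast
  have sum_unit: "(\<Sum>i<Suc d. fst (unit j) i * p i) = - p j" if "j < Suc d" for j
  proof -
    have "(\<Sum>i<Suc d. fst (unit j) i * p i) = (\<Sum>i<Suc d. if i = j then - p j else 0)"
      by (rule sum.cong) (auto simp: unit_def)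
    also have "\<dots> = - p j" using that by (simp del: sum.lessThan_Suc)
    finally show ?thesis .
  qed
  have p0: "0 \<le> p j" if "j < Suc d" for j
    using sol[of "fst (unit j)" 0] sum_unit[OF that] that by (auto simp: S'_def unit_def)
  have pd: "0 < p d"
    using sol[of "fst (unit d)" "- 1"] sum_unit[of d] q by (simp add: S'_def)
  have nat_bound: "nat (p j) \<le> fact (Suc d) * \<Delta> ^ Suc d" if "j < Suc d" for j
  proof -
    have "nat (p j) \<le> nat (int (fact (Suc d) * \<Delta> ^ Suc d))"
      using p[OF that] by (intro nat_mono) (simp add: of_nat_fact algebra_simps)
    then show ?thesis by (simp only: nat_int)
  qed
  \<comment> \<open>The ratios of \<open>p j\<close> to \<open>p d\<close> no longer contain
    \<open>q\<close>, so \<open>p d\<close> becomes the denominator. The right-hand side -1 of a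
    strict row turns into \<open>- q\<close>, which is negative and yields strictness.\<close>
  have "if st then (\<Sum>j<d. c j * int (nat (p j))) < b * int (nat (p d))
      else (\<Sum>j<d. c j * int (nat (p j))) \<le> b * int (nat (p d))" if "(c, b, st) \<in> S" for c b st
  proof -
    have "(c(d := - b), if st then - 1 else 0) \<in> S'"
      using that by (auto simp: S'_def hom_def image_iff intro!: bexI[of _ "(c, b, st)"])
    from sol[OF this] have "(\<Sum>j<d. c j * p j) - b * p d \<le> (if st then - 1 else 0) * q" by simp
    moreover have "(\<Sum>j<d. c j * int (nat (p j))) = (\<Sum>j<d. c j * p j)"
      using p0 by (intro sum.cong) auto
    ultimately show ?thesis using q pd by auto
  qed
  note sol' = this
  have "case e of (c, b, st) \<Rightarrow> if st then (\<Sum>j<d. c j * int (nat (p j))) < b * int (nat (p d))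
      else (\<Sum>j<d. c j * int (nat (p j))) \<le> b * int (nat (p d))" if "e \<in> S" for e
  proof -
    obtain c b st where e: "e = (c, b, st)" by (metis prod_cases3)
    show ?thesis unfolding e prod.case by (rule sol') (use that e in blast)
  qed
  then have h1: "\<forall>(c, b, st) \<in> S. if st then (\<Sum>j<d. c j * int (nat (p j))) < b * int (nat (p d))
      else (\<Sum>j<d. c j * int (nat (p j))) \<le> b * int (nat (p d))" by (rule ballI)
  have h2: "0 < nat (p d)" using pd by simp
  have h3: "\<forall>j<d. nat (p j) \<le> fact (Suc d) * \<Delta> ^ Suc d" by (intro allI impI nat_bound) simp
  show ?thesis
    by (rule exI[of _ "\<lambda>j. nat (p j)"], rule exI[of _ "nat (p d)"])
      (intro conjI h1 h2 h3 nat_bound lessI)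
qed


section \<open>Integer data and small witnesses\<close>

text \<open>The floor only serves to land in \<open>int\<close>; on the data it is exact, which is
  what \<open>scaled\<close> records.\<close>

definition int_entry :: "nat \<Rightarrow> rat \<Rightarrow> int" where
  "int_entry \<Delta> r = \<lfloor>of_nat \<Delta> * r\<rfloor>"

text \<open>\<open>\<Delta>\<close> is a common denominator of the data, and \<open>M\<close> bounds the integers obtained by scaling with it.\<close>

definition scaled :: "nat \<Rightarrow> nat \<Rightarrow> rat \<Rightarrow> bool" where
  "scaled \<Delta> M r \<longleftrightarrow> of_int (int_entry \<Delta> r) = of_nat \<Delta> * r \<and> \<bar>int_entry \<Delta> r\<bar> \<le> int M"

definition scaled_inst :: "nat \<Rightarrow> nat \<Rightarrow> adapt_inst \<Rightarrow> bool" where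
  "scaled_inst \<Delta> M I \<longleftrightarrow> 0 < \<Delta> \<and>
     (\<forall>i<m_x I. scaled \<Delta> M (vec_a I $ i)) \<and> (\<forall>i<m_u I. scaled \<Delta> M (vec_b I $ i)) \<and>
     (\<forall>i<m_x I. \<forall>j<n_x I. scaled \<Delta> M (mat_A I $$ (i, j))) \<and>
     (\<forall>i<m_y I. \<forall>j<n_y I. scaled \<Delta> M (mat_W I $$ (i, j))) \<and>
     (\<forall>k<n_x I. \<forall>i<m_u I. \<forall>j<n_u I. scaled \<Delta> M (coeffs_B I ! k $$ (i, j))) \<and>
     (\<forall>k<n_u I. \<forall>i<m_y I. \<forall>j<n_x I. scaled \<Delta> M (coeffs_T I ! k $$ (i, j)))"

lemma scaled_real:
  assumes "scaled \<Delta> M r"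
  shows "real_of_int (int_entry \<Delta> r) = real \<Delta> * real_of_rat r"
proof -
  have "real_of_rat (of_int (int_entry \<Delta> r)) = real_of_rat (of_nat \<Delta> * r)"
    using assms by (simp only: scaled_def)
  then show ?thesis by (simp add: of_rat_mult)
qed

lemma scaled_inst_real:
  assumes "scaled_inst \<Delta> M I"
  shows "i < m_x I \<Longrightarrow> real_of_int (int_entry \<Delta> (vec_a I $ i)) = real \<Delta> * real_of_rat (vec_a I $ i)"
    and "i < m_u I \<Longrightarrow> real_of_int (int_entry \<Delta> (vec_b I $ i)) = real \<Delta> * real_of_rat (vec_b I $ i)"
    and "i < m_x I \<Longrightarrow> j < n_x I \<Longrightarrow>
      real_of_int (int_entry \<Delta> (mat_A I $$ (i, j))) = real \<Delta> * real_of_rat (mat_A I $$ (i, j))"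
    and "i < m_y I \<Longrightarrow> j < n_y I \<Longrightarrow>
      real_of_int (int_entry \<Delta> (mat_W I $$ (i, j))) = real \<Delta> * real_of_rat (mat_W I $$ (i, j))"
    and "k < n_x I \<Longrightarrow> i < m_u I \<Longrightarrow> j < n_u I \<Longrightarrow>
      real_of_int (int_entry \<Delta> (coeffs_B I ! k $$ (i, j))) = real \<Delta> * real_of_rat (coeffs_B I ! k $$ (i, j))"
    and "k < n_u I \<Longrightarrow> i < m_y I \<Longrightarrow> j < n_x I \<Longrightarrow>
      real_of_int (int_entry \<Delta> (coeffs_T I ! k $$ (i, j))) = real \<Delta> * real_of_rat (coeffs_T I ! k $$ (i, j))"
  using assms by (auto intro!: scaled_real[of \<Delta> M] simp: scaled_inst_def)

lemma scale_le: "0 < \<Delta> \<Longrightarrow> real \<Delta> * x \<le> real \<Delta> * y \<longleftrightarrow> x \<le> y"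
  by simp

section \<open>The feasible sets as linear inequalities with integer coefficients\<close>

definition row_A :: "adapt_inst \<Rightarrow> nat \<Rightarrow> nat \<Rightarrow> nat \<Rightarrow> int" where
  "row_A I \<Delta> i j = int_entry \<Delta> (mat_A I $$ (i, j))"

definition row_W :: "adapt_inst \<Rightarrow> nat \<Rightarrow> nat \<Rightarrow> nat \<Rightarrow> int" where
  "row_W I \<Delta> i j = int_entry \<Delta> (mat_W I $$ (i, j))"

text \<open>For a fixed scenario \<open>u\<close> the bilinear terms \<open>B(x) u\<close> and
  \<open>T(u) x\<close> are linear in \<open>x\<close>; \<open>row_B\<close> and
  \<open>row_T\<close> are their coefficients.\<close>

definition row_B :: "adapt_inst \<Rightarrow> nat \<Rightarrow> nat list \<Rightarrow> nat \<Rightarrow> nat \<Rightarrow> int" where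
  "row_B I \<Delta> u i k = (\<Sum>j<n_u I. int_entry \<Delta> (coeffs_B I ! k $$ (i, j)) * int (u ! j))"

definition row_T :: "adapt_inst \<Rightarrow> nat \<Rightarrow> nat list \<Rightarrow> nat \<Rightarrow> nat \<Rightarrow> int" where
  "row_T I \<Delta> u i j = (\<Sum>k<n_u I. int_entry \<Delta> (coeffs_T I ! k $$ (i, j)) * int (u ! k))"

definition nat_vec :: "nat list \<Rightarrow> real vec" where
  "nat_vec u = vec (length u) (\<lambda>j. real (u ! j))"

lemma less_eq_vec_iff: "v \<le> w \<longleftrightarrow> dim_vec v = dim_vec w \<and> (\<forall>i<dim_vec w. v $ i \<le> w $ i)"
  by (auto simp: less_eq_vec_def)

lemma X_c_iff:
  assumes "valid_inst I" "scaled_inst \<Delta> M I"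
  shows "x \<in> X_c I \<longleftrightarrow> x \<in> real_box (bound_R I) (n_x I) \<and>
    (\<forall>i<m_x I. ldot (n_x I) (row_A I \<Delta> i) (\<lambda>j. x $ j) \<le> of_int (int_entry \<Delta> (vec_a I $ i)))"
proof -
  have "(real_mat (mat_A I) *\<^sub>v x) $ i \<le> real_vec (vec_a I) $ i \<longleftrightarrow>
      ldot (n_x I) (row_A I \<Delta> i) (\<lambda>j. x $ j) \<le> of_int (int_entry \<Delta> (vec_a I $ i))"
    if x: "x \<in> carrier_vec (n_x I)" and i: "i < m_x I" for i
  proof -
    have A: "mat_A I \<in> carrier_mat (m_x I) (n_x I)" "vec_a I \<in> carrier_vec (m_x I)"
      using assms(1) by (auto simp: valid_inst_def)
    have "(real_mat (mat_A I) *\<^sub>v x) $ i = (\<Sum>j<n_x I. real_of_rat (mat_A I $$ (i, j)) * x $ j)"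
      using A i x by (simp add: scalar_prod_def lessThan_atLeast0)
    then have "real \<Delta> * (real_mat (mat_A I) *\<^sub>v x) $ i = ldot (n_x I) (row_A I \<Delta> i) (\<lambda>j. x $ j)"
      unfolding ldot_def sum_distrib_left using assms(2) i
      by (auto simp: row_A_def scaled_inst_real[OF assms(2)] mult.assoc sum_distrib_left intro!: sum.cong)
    moreover have "real \<Delta> * real_vec (vec_a I) $ i = of_int (int_entry \<Delta> (vec_a I $ i))"
      using assms(2) i A by (simp add: scaled_inst_real[OF assms(2)])
    ultimately show ?thesis
      using scale_le[of \<Delta> "(real_mat (mat_A I) *\<^sub>v x) $ i" "real_vec (vec_a I) $ i"] assms(2)
      by (simp add: scaled_inst_def)
  qed
  moreover have "dim_vec (real_mat (mat_A I) *\<^sub>v x) = m_x I" "dim_vec (real_vec (vec_a I)) = m_x I"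
    using assms(1) by (auto simp: valid_inst_def)
  ultimately show ?thesis
    by (auto simp: X_c_def less_eq_vec_iff real_box_def)
qed

lemma U_d_iff:
  assumes "valid_inst I" "scaled_inst \<Delta> M I" "x \<in> carrier_vec (n_x I)"
  shows "v \<in> U_d I x \<longleftrightarrow> (\<exists>u. v = nat_vec u \<and> length u = n_u I \<and> (\<forall>j<n_u I. u ! j \<le> bound_R I) \<and>
    (\<forall>i<m_u I. ldot (n_x I) (row_B I \<Delta> u i) (\<lambda>j. x $ j) \<le> of_int (int_entry \<Delta> (vec_b I $ i))))"
proof -
  have box: "v \<in> real_box (bound_R I) (n_u I) \<inter> int_vecs \<longleftrightarrow>
      (\<exists>u. v = nat_vec u \<and> length u = n_u I \<and> (\<forall>j<n_u I. u ! j \<le> bound_R I))"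
  proof
    assume v: "v \<in> real_box (bound_R I) (n_u I) \<inter> int_vecs"
    define u where "u = map (\<lambda>j. nat \<lfloor>v $ j\<rfloor>) [0..<n_u I]"
    have "v $ j = real (u ! j)" if "j < n_u I" for j
      using v that by (auto simp: u_def real_box_def int_vecs_def elim!: Ints_cases)
    moreover from this have "u ! j \<le> bound_R I" if "j < n_u I" for j
      using v that by (auto simp: real_box_def)
    moreover have "v \<in> carrier_vec (n_u I)" using v by (simp add: real_box_def)
    ultimately show "\<exists>u. v = nat_vec u \<and> length u = n_u I \<and> (\<forall>j<n_u I. u ! j \<le> bound_R I)"
      by (intro exI[of _ u]) (auto simp: nat_vec_def u_def intro!: eq_vecI)
  qed (auto simp: real_box_def int_vecs_def nat_vec_def)
  have eq: "(B_of I x *\<^sub>v nat_vec u) $ i \<le> real_vec (vec_b I) $ i \<longleftrightarrow>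
      ldot (n_x I) (row_B I \<Delta> u i) (\<lambda>j. x $ j) \<le> of_int (int_entry \<Delta> (vec_b I $ i))"
    if u: "length u = n_u I" and i: "i < m_u I" for u i
  proof -
    have "(B_of I x *\<^sub>v nat_vec u) $ i =
        (\<Sum>j<n_u I. (\<Sum>k<n_x I. real_of_rat (coeffs_B I ! k $$ (i, j)) * x $ k) * real (u ! j))"
      using i u by (simp add: B_of_def nat_vec_def scalar_prod_def lessThan_atLeast0)
    also have "\<dots> = (\<Sum>k<n_x I. \<Sum>j<n_u I. real_of_rat (coeffs_B I ! k $$ (i, j)) * real (u ! j) * x $ k)"
      unfolding sum_distrib_right by (subst sum.swap) (simp add: mult_ac)
    finally have B: "(B_of I x *\<^sub>v nat_vec u) $ i =
        (\<Sum>k<n_x I. \<Sum>j<n_u I. real_of_rat (coeffs_B I ! k $$ (i, j)) * real (u ! j) * x $ k)" .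
    have "real_of_int (row_B I \<Delta> u i k) = (\<Sum>j<n_u I. real \<Delta> * (real_of_rat (coeffs_B I ! k $$ (i, j)) * real (u ! j)))"
      if "k < n_x I" for k
      unfolding row_B_def of_int_sum using assms(2) i that
      by (intro sum.cong) (auto simp: scaled_inst_real[OF assms(2)])
    then have "real \<Delta> * (B_of I x *\<^sub>v nat_vec u) $ i = ldot (n_x I) (row_B I \<Delta> u i) (\<lambda>j. x $ j)"
      unfolding B ldot_def sum_distrib_left
      by (intro sum.cong) (auto simp: sum_distrib_right mult.assoc)
    moreover have "real \<Delta> * real_vec (vec_b I) $ i = of_int (int_entry \<Delta> (vec_b I $ i))"
    proof -
      have "vec_b I \<in> carrier_vec (m_u I)" using assms(1) by (simp add: valid_inst_def)
      then show ?thesis using i by (simp add: scaled_inst_real[OF assms(2)])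
    qed
    ultimately show ?thesis
      using scale_le[of \<Delta> "(B_of I x *\<^sub>v nat_vec u) $ i" "real_vec (vec_b I) $ i"] assms(2)
      by (simp add: scaled_inst_def)
  qed
  have dims: "dim_vec (B_of I x *\<^sub>v w) = m_u I" "dim_vec (real_vec (vec_b I)) = m_u I" for w
    using assms(1) by (auto simp: valid_inst_def B_of_def)
  have "B_of I x *\<^sub>v nat_vec u \<le> real_vec (vec_b I) \<longleftrightarrow> (\<forall>i<m_u I.
      ldot (n_x I) (row_B I \<Delta> u i) (\<lambda>j. x $ j) \<le> of_int (int_entry \<Delta> (vec_b I $ i)))"
    if "length u = n_u I" for u
    unfolding less_eq_vec_iff dims using eq[OF that] by simp
  then show ?thesis unfolding U_d_def mem_Collect_eq box by blast
qed

lemma Y_c_iff: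
  assumes "valid_inst I" "scaled_inst \<Delta> M I" "x \<in> carrier_vec (n_x I)" "length u = n_u I"
  shows "y \<in> Y_c I x (nat_vec u) \<longleftrightarrow> y \<in> real_box (bound_R I) (n_y I) \<and>
    (\<forall>i<m_y I. ldot (n_x I) (row_T I \<Delta> u i) (\<lambda>j. x $ j) + ldot (n_y I) (row_W I \<Delta> i) (\<lambda>j. y $ j) \<le> 0)"
proof -
  have eq: "(T_of I (nat_vec u) *\<^sub>v x + real_mat (mat_W I) *\<^sub>v y) $ i \<le> 0\<^sub>v (m_y I) $ i \<longleftrightarrow>
      ldot (n_x I) (row_T I \<Delta> u i) (\<lambda>j. x $ j) + ldot (n_y I) (row_W I \<Delta> i) (\<lambda>j. y $ j) \<le> 0"
    if y: "y \<in> carrier_vec (n_y I)" and i: "i < m_y I" for i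
  proof -
    have W: "mat_W I \<in> carrier_mat (m_y I) (n_y I)" using assms(1) by (auto simp: valid_inst_def)
    have "(T_of I (nat_vec u) *\<^sub>v x + real_mat (mat_W I) *\<^sub>v y) $ i =
        (\<Sum>j<n_x I. (\<Sum>k<n_u I. real_of_rat (coeffs_T I ! k $$ (i, j)) * real (u ! k)) * x $ j) +
        (\<Sum>j<n_y I. real_of_rat (mat_W I $$ (i, j)) * y $ j)"
      (is "_ = ?X + ?Y")
      using i assms(3,4) W y by (simp add: T_of_def nat_vec_def scalar_prod_def lessThan_atLeast0)
    moreover have "real \<Delta> * ?X = ldot (n_x I) (row_T I \<Delta> u i) (\<lambda>j. x $ j)"
    proof -
      have "real_of_int (row_T I \<Delta> u i j) = (\<Sum>k<n_u I. real \<Delta> * (real_of_rat (coeffs_T I ! k $$ (i, j)) * real (u ! k)))"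
        if "j < n_x I" for j
        unfolding row_T_def of_int_sum using assms(2) i that
        by (intro sum.cong) (auto simp: scaled_inst_real[OF assms(2)])
      then show ?thesis
        unfolding ldot_def sum_distrib_left
        by (intro sum.cong) (auto simp: sum_distrib_right sum_distrib_left mult.assoc)
    qed
    moreover have "real \<Delta> * ?Y = ldot (n_y I) (row_W I \<Delta> i) (\<lambda>j. y $ j)"
      unfolding ldot_def sum_distrib_left using assms(2) i
      by (intro sum.cong) (auto simp: row_W_def scaled_inst_real[OF assms(2)])
    ultimately have "real \<Delta> * (T_of I (nat_vec u) *\<^sub>v x + real_mat (mat_W I) *\<^sub>v y) $ i =
        ldot (n_x I) (row_T I \<Delta> u i) (\<lambda>j. x $ j) + ldot (n_y I) (row_W I \<Delta> i) (\<lambda>j. y $ j)"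
      by (simp add: distrib_left)
    then show ?thesis
      using scale_le[of \<Delta> "(T_of I (nat_vec u) *\<^sub>v x + real_mat (mat_W I) *\<^sub>v y) $ i" 0] assms(2) i
      by (simp add: scaled_inst_def)
  qed
  have dims: "dim_vec (T_of I (nat_vec u) *\<^sub>v x + real_mat (mat_W I) *\<^sub>v y) = m_y I"
    using assms(1) by (auto simp: valid_inst_def)
  show ?thesis unfolding Y_c_def mem_Collect_eq less_eq_vec_iff dims
    using eq by (auto simp: real_box_def)
qed

text \<open>The unknowns are \<open>x\<close>, followed by the \<open>K\<close> recourse vectors in
  consecutive blocks of length \<open>m\<close>. A row of the recourse constraints involves
  \<open>x\<close> and the block \<open>k\<close> only.\<close>

definition block_coeffs :: "nat \<Rightarrow> nat \<Rightarrow> nat \<Rightarrow> (nat \<Rightarrow> int) \<Rightarrow> (nat \<Rightarrow> int) \<Rightarrow> nat \<Rightarrow> int" where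
  "block_coeffs n m k f g v = (if v < n then f v
     else if n + k * m \<le> v \<and> v < n + k * m + m then g (v - (n + k * m)) else 0)"

lemma ldot_block:
  assumes "k < K"
  shows "ldot (n + K * m) (block_coeffs n m k f g) z = ldot n f z + ldot m g (\<lambda>j. z (n + k * m + j))"
proof -
  let ?h = "\<lambda>v. real_of_int (block_coeffs n m k f g v) * z v"
  have "(k + 1) * m \<le> K * m" using assms by (intro mult_le_mono) auto
  then have le: "k * m + m \<le> K * m" by simp
  have "ldot (n + K * m) (block_coeffs n m k f g) z = sum ?h {..<n} + sum ?h {n..<n + K * m}"
    unfolding ldot_def using sum.atLeastLessThan_concat[of 0 n "n + K * m" ?h]
    by (simp add: lessThan_atLeast0)
  also have "sum ?h {..<n} = ldot n f z"
    unfolding ldot_def by (rule sum.cong) (auto simp: block_coeffs_def)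
  also have "sum ?h {n..<n + K * m} = sum ?h {n + k * m..<n + k * m + m}"
    using le by (intro sum.mono_neutral_right) (auto simp: block_coeffs_def)
  also have "\<dots> = (\<Sum>j<m. ?h (n + k * m + j))"
    using sum.shift_bounds_nat_ivl[of ?h 0 "n + k * m" m] by (simp add: lessThan_atLeast0 add_ac)
  also have "\<dots> = ldot m g (\<lambda>j. z (n + k * m + j))"
    unfolding ldot_def by (rule sum.cong) (auto simp: block_coeffs_def)
  finally show ?thesis .
qed

definition frac_vec :: "nat \<Rightarrow> nat list \<Rightarrow> real vec" where
  "frac_vec q p = vec (length p) (\<lambda>j. real (p ! j) / real q)"

lemma row_bounds:
  assumes "scaled_inst \<Delta> M I" "\<forall>j<n_u I. u ! j \<le> bound_R I"
  shows "i < m_u I \<Longrightarrow> k < n_x I \<Longrightarrow> \<bar>row_B I \<Delta> u i k\<bar> \<le> int (n_u I * (M * bound_R I))"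
    and "i < m_y I \<Longrightarrow> j < n_x I \<Longrightarrow> \<bar>row_T I \<Delta> u i j\<bar> \<le> int (n_u I * (M * bound_R I))"
proof -
  have *: "\<bar>\<Sum>j<n. f j * int (u ! j)\<bar> \<le> int (n * (M * bound_R I))"
    if "\<And>j. j < n \<Longrightarrow> \<bar>f j\<bar> \<le> int M" "n = n_u I" for f n
  proof -
    have "\<bar>\<Sum>j<n. f j * int (u ! j)\<bar> \<le> (\<Sum>j<n. \<bar>f j * int (u ! j)\<bar>)" by (rule sum_abs)
    also have "\<dots> \<le> (\<Sum>j<n. int M * int (bound_R I))"
      using that assms(2) by (intro sum_mono) (auto simp: abs_mult intro!: mult_mono)
    finally show ?thesis by simp
  qed
  show "i < m_u I \<Longrightarrow> k < n_x I \<Longrightarrow> \<bar>row_B I \<Delta> u i k\<bar> \<le> int (n_u I * (M * bound_R I))"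
    unfolding row_B_def using assms(1) by (intro *) (auto simp: scaled_inst_def scaled_def)
  show "i < m_y I \<Longrightarrow> j < n_x I \<Longrightarrow> \<bar>row_T I \<Delta> u i j\<bar> \<le> int (n_u I * (M * bound_R I))"
    unfolding row_T_def using assms(1) by (intro *) (auto simp: scaled_inst_def scaled_def)
qed

lemma finite_bounded_lists: "finite {u. length u = n \<and> (\<forall>j<n. u ! j \<le> (R :: nat))}"
proof (rule finite_subset)
  show "{u. length u = n \<and> (\<forall>j<n. u ! j \<le> R)} \<subseteq> {u. set u \<subseteq> {..R} \<and> length u = n}"
    by (auto simp: in_set_conv_nth)
qed (rule finite_lists_length_eq, simp)


section \<open>From real solutions to short rational ones\<close>

lemma ldot_pad:
  assumes "n \<le> d"
  shows "ldot d (\<lambda>v. if v < n then f v else 0) z = ldot n f z"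
  unfolding ldot_def using assms by (intro sum.mono_neutral_cong_right) auto

lemma ldot_unit:
  assumes "v < d"
  shows "ldot d (\<lambda>i. if i = v then a else 0) z = of_int a * z v"
proof -
  have "ldot d (\<lambda>i. if i = v then a else 0) z = (\<Sum>i<d. if i = v then of_int a * z v else 0)"
    unfolding ldot_def by (rule sum.cong) auto
  then show ?thesis using assms by simp
qed

lemma ldot_neg: "ldot d (\<lambda>v. - f v) z = - ldot d f z"
  by (simp add: ldot_def sum_negf)

lemma ldot_cong: "(\<And>j. j < d \<Longrightarrow> z j = z' j) \<Longrightarrow> ldot d f z = ldot d f z'"
  unfolding ldot_def by (rule sum.cong) auto

text \<open>The bound of \<open>rational_solution\<close> in the homogenized dimension. The base of
  the power bounds all coefficients and right-hand sides: scaled data by \<open>M\<close>, the box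
  by \<open>bound_R\<close>, and the sums over a scenario by \<open>n_u * M * bound_R\<close>. The
  last summand covers integral coordinates, which are rewritten over denominator 1.\<close>

definition witness_bound :: "adapt_inst \<Rightarrow> nat \<Rightarrow> nat \<Rightarrow> nat" where
  "witness_bound I M K = (let d = Suc (n_x I + K * n_y I) in
     fact d * Suc (M + bound_R I + n_u I * (M * bound_R I)) ^ d + bound_R I)"

text \<open>For every scenario in the box, \<open>kk\<close> fixes a recourse vector that serves it
  under \<open>z\<close>, or \<open>ii\<close> a row that it violates. With these choices fixed the
  condition on \<open>z\<close> becomes a finite system, and each of its solutions satisfies the
  original condition. Its number of rows does not enter the bound.\<close>

lemma small_witness_real:
  fixes K :: nat and I :: adapt_inst and z :: "nat \<Rightarrow> real"
  defines "n \<equiv> n_x I" and "m \<equiv> n_y I" and "R \<equiv> bound_R I"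
  defines "d \<equiv> n + K * m"
  defines "xs w \<equiv> vec n w" and "ys w k \<equiv> vec m (\<lambda>j. w (n + k * m + j))"
  assumes I: "valid_inst I" "scaled_inst \<Delta> M I"
    and z: "\<And>v. v < d \<Longrightarrow> 0 \<le> z v \<and> z v \<le> R"
    and Ints: "\<And>v. v < d \<Longrightarrow> D v \<Longrightarrow> z v \<in> \<int>"
    and X: "xs z \<in> X_c I"
    and Y: "\<And>u. u \<in> U_d I (xs z) \<Longrightarrow> \<exists>k<K. ys z k \<in> Y_c I (xs z) u"
  shows "\<exists>(p :: nat \<Rightarrow> nat) q. 0 < q \<and> q \<le> witness_bound I M K \<and> (\<forall>v<d. p v \<le> witness_bound I M K) \<and>
    (let w = (\<lambda>v. real (p v) / real q) in
      (\<forall>v<d. w v \<le> R \<and> (D v \<longrightarrow> w v = z v)) \<and> xs w \<in> X_c I \<and>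
      (\<forall>u \<in> U_d I (xs w). \<exists>k<K. ys w k \<in> Y_c I (xs w) u))"
proof -
  define C where "C = Suc (M + R + n_u I * (M * R))"
  define UB where "UB = {u. length u = n_u I \<and> (\<forall>j<n_u I. u ! j \<le> R)}"
  define pad where "pad f v = (if v < n then f v else 0 :: int)" for f :: "nat \<Rightarrow> int" and v
  have nd: "n \<le> d" by (simp add: d_def)
  have ldot_pad': "ldot d (pad f) w = ldot n f w" for f w
    unfolding pad_def using ldot_pad[OF nd] by simp
  have "\<exists>k. u \<in> UB \<longrightarrow> nat_vec u \<in> U_d I (xs z) \<longrightarrow> k < K \<and> ys z k \<in> Y_c I (xs z) (nat_vec u)" for u
    using Y by blast
  then obtain kk where kk: "\<And>u. u \<in> UB \<Longrightarrow> nat_vec u \<in> U_d I (xs z) \<Longrightarrow> kk u < K \<and> ys z (kk u) \<in> Y_c I (xs z) (nat_vec u)"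
    by metis
  have carr: "xs w \<in> carrier_vec (n_x I)" for w by (simp add: xs_def n_def)
  have xs_ldot: "ldot (n_x I) f (\<lambda>j. xs w $ j) = ldot n f w" for f w
    by (auto simp: xs_def n_def intro!: ldot_cong)
  have ys_ldot: "ldot (n_y I) f (\<lambda>j. ys w k $ j) = ldot m f (\<lambda>j. w (n + k * m + j))" for f w k
    by (auto simp: ys_def m_def intro!: ldot_cong)
  have "\<exists>i. u \<in> UB \<longrightarrow> nat_vec u \<notin> U_d I (xs z) \<longrightarrow>
      i < m_u I \<and> of_int (int_entry \<Delta> (vec_b I $ i)) < ldot n (row_B I \<Delta> u i) z" for u
  proof -
    have "nat_vec u \<in> U_d I (xs z)"
      if "u \<in> UB" "\<forall>i<m_u I. ldot n (row_B I \<Delta> u i) z \<le> of_int (int_entry \<Delta> (vec_b I $ i))"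
      unfolding U_d_iff[OF I carr] xs_ldot using that by (intro exI[of _ u]) (simp add: UB_def R_def)
    then show ?thesis by (meson not_le)
  qed
  then obtain ii where ii: "\<And>u. u \<in> UB \<Longrightarrow> nat_vec u \<notin> U_d I (xs z) \<Longrightarrow>
      ii u < m_u I \<and> of_int (int_entry \<Delta> (vec_b I $ ii u)) < ldot n (row_B I \<Delta> u (ii u)) z"
    by metis
  define unit where "unit v a i = (if i = v then a else 0 :: int)" for v :: nat and a i
  define S1 where "S1 = (\<lambda>v. (unit v 1, int R, False)) ` {..<d}"
  define S2 where "S2 = (\<lambda>i. (pad (row_A I \<Delta> i), int_entry \<Delta> (vec_a I $ i), False)) ` {..<m_x I}"
  define S3 where "S3 = (\<lambda>(u, i). (block_coeffs n m (kk u) (row_T I \<Delta> u i) (row_W I \<Delta> i), 0 :: int, False)) `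
    ({u \<in> UB. nat_vec u \<in> U_d I (xs z)} \<times> {..<m_y I})"
  define S4 where "S4 = (\<lambda>u. (pad (\<lambda>k. - row_B I \<Delta> u (ii u) k), - int_entry \<Delta> (vec_b I $ ii u), True)) `
    {u \<in> UB. nat_vec u \<notin> U_d I (xs z)}"
  \<comment> \<open>Two opposite inequalities pin each coordinate in \<open>D\<close> to its value
    in \<open>z\<close>, which is an integer and so equals its floor.\<close>
  define S5 where "S5 = (\<lambda>(v, a). (unit v a, a * \<lfloor>z v\<rfloor>, False)) ` ({v. v < d \<and> D v} \<times> {1, -1})"
  define S where "S = S1 \<union> S2 \<union> S3 \<union> S4 \<union> S5"
  have finUB: "finite UB" unfolding UB_def by (rule finite_bounded_lists)
  have unit_ldot: "ldot d (unit v a) w = of_int a * w v" if "v < d" for v a w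
    unfolding unit_def by (rule ldot_unit[OF that])
  have blk: "ldot d (block_coeffs n m (kk u) f g) w = ldot n f w + ldot m g (\<lambda>j. w (n + kk u * m + j))"
    if "u \<in> UB" "nat_vec u \<in> U_d I (xs z)" for u f g w
    unfolding d_def by (rule ldot_block) (use kk[OF that] in blast)
  have "\<exists>(p :: nat \<Rightarrow> nat) q. 0 < q \<and> q \<le> fact (Suc d) * C ^ Suc d \<and> (\<forall>j<d. p j \<le> fact (Suc d) * C ^ Suc d) \<and>
    (\<forall>(c, b, st) \<in> S. if st then (\<Sum>j<d. c j * int (p j)) < b * int q else (\<Sum>j<d. c j * int (p j)) \<le> b * int q)"
  proof (rule rational_solution[where z = z])
    show "finite S" unfolding S_def S1_def S2_def S3_def S4_def S5_def using finUB by auto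
    show "if st then ldot d c z < of_int b else ldot d c z \<le> of_int b" if "(c, b, st) \<in> S" for c b st
    proof -
      from that consider "(c, b, st) \<in> S1" | "(c, b, st) \<in> S2" | "(c, b, st) \<in> S3" | "(c, b, st) \<in> S4" | "(c, b, st) \<in> S5"
        unfolding S_def by blast
      then show ?thesis
      proof cases
        case 1
        then show ?thesis using z by (auto simp: S1_def unit_ldot)
      next
        case 2
        then show ?thesis
          using X[unfolded X_c_iff[OF I]] by (auto simp: S2_def ldot_pad' xs_ldot)
      next
        case 3
        then obtain u i where u: "u \<in> UB" "nat_vec u \<in> U_d I (xs z)" "i < m_y I"
          and c: "c = block_coeffs n m (kk u) (row_T I \<Delta> u i) (row_W I \<Delta> i)" "b = 0" "\<not> st"
          by (auto simp: S3_def)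
        have "length u = n_u I" using u(1) by (simp add: UB_def)
        from Y_c_iff[OF I carr this, of "ys z (kk u)" z] kk[OF u(1,2)] u(3)
        have "ldot n (row_T I \<Delta> u i) z + ldot m (row_W I \<Delta> i) (\<lambda>j. z (n + kk u * m + j)) \<le> 0"
          unfolding xs_ldot ys_ldot by blast
        then show ?thesis unfolding c(1,2) using c(3) by (simp add: blk[OF u(1,2)])
      next
        case 4
        then obtain u where u: "u \<in> UB" "nat_vec u \<notin> U_d I (xs z)"
          and c: "c = pad (\<lambda>k. - row_B I \<Delta> u (ii u) k)" "b = - int_entry \<Delta> (vec_b I $ ii u)" st
          by (auto simp: S4_def)
        show ?thesis unfolding c(1,2) ldot_pad' ldot_neg using c(3) ii[OF u] by simp
      next
        case 5
        then show ?thesis using Ints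
          by (auto simp: S5_def unit_ldot elim!: Ints_cases)
      qed
    qed
    show "0 \<le> z j" if "j < d" for j using z[OF that] by simp
    have row: "\<bar>int_entry \<Delta> r\<bar> \<le> int C" if "scaled \<Delta> M r" for r
    proof -
      have "int M \<le> int C" unfolding of_nat_le_iff by (simp add: C_def)
      with that show ?thesis by (simp add: scaled_def)
    qed
    have sc: "i < m_x I \<Longrightarrow> scaled \<Delta> M (vec_a I $ i)" "i < m_u I \<Longrightarrow> scaled \<Delta> M (vec_b I $ i)"
      "i < m_x I \<Longrightarrow> j < n \<Longrightarrow> scaled \<Delta> M (mat_A I $$ (i, j))"
      "i < m_y I \<Longrightarrow> j < m \<Longrightarrow> scaled \<Delta> M (mat_W I $$ (i, j))" for i j
      using I(2) by (auto simp: scaled_inst_def n_def m_def)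
    have rB: "u \<in> UB \<Longrightarrow> i < m_u I \<Longrightarrow> k < n \<Longrightarrow> \<bar>row_B I \<Delta> u i k\<bar> \<le> int C"
      and rT: "u \<in> UB \<Longrightarrow> i < m_y I \<Longrightarrow> k < n \<Longrightarrow> \<bar>row_T I \<Delta> u i k\<bar> \<le> int C" for u i k
    proof -
      have C: "int (n_u I * (M * bound_R I)) \<le> int C" unfolding of_nat_le_iff by (simp add: C_def R_def)
      show "u \<in> UB \<Longrightarrow> i < m_u I \<Longrightarrow> k < n \<Longrightarrow> \<bar>row_B I \<Delta> u i k\<bar> \<le> int C"
        using row_bounds(1)[OF I(2), of u i k] C by (simp add: UB_def R_def n_def)
      show "u \<in> UB \<Longrightarrow> i < m_y I \<Longrightarrow> k < n \<Longrightarrow> \<bar>row_T I \<Delta> u i k\<bar> \<le> int C"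
        using row_bounds(2)[OF I(2), of u i k] C by (simp add: UB_def R_def n_def)
    qed
    show "\<bar>c j\<bar> \<le> int C" if "(c, b, st) \<in> S" "j < d" for c b st j
      using that(1) unfolding S_def
    proof (elim UnE)
      assume "(c, b, st) \<in> S1"
      then show ?thesis by (auto simp: S1_def unit_def C_def)
    next
      assume "(c, b, st) \<in> S2"
      then show ?thesis using row sc(3) by (auto simp: S2_def pad_def row_A_def)
    next
      assume "(c, b, st) \<in> S3"
      then show ?thesis using row sc(4) rT by (auto simp: S3_def block_coeffs_def row_W_def)
    next
      assume "(c, b, st) \<in> S4"
      then show ?thesis using rB ii by (auto simp: S4_def pad_def)
    next
      assume "(c, b, st) \<in> S5"
      then show ?thesis by (auto simp: S5_def unit_def C_def)
    qed
    show "\<bar>b\<bar> \<le> int C" if "(c, b, st) \<in> S" for c b st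
      using that unfolding S_def
    proof (elim UnE)
      assume "(c, b, st) \<in> S1"
      then show ?thesis by (auto simp: S1_def C_def)
    next
      assume "(c, b, st) \<in> S2"
      then show ?thesis using row sc(1) by (auto simp: S2_def)
    next
      assume "(c, b, st) \<in> S3"
      then show ?thesis by (auto simp: S3_def)
    next
      assume "(c, b, st) \<in> S4"
      then show ?thesis using row sc(2) ii by (auto simp: S4_def)
    next
      assume "(c, b, st) \<in> S5"
      then obtain v where v: "v < d" "\<bar>b\<bar> = \<bar>\<lfloor>z v\<rfloor>\<bar>" by (auto simp: S5_def)
      have "0 \<le> \<lfloor>z v\<rfloor>" "\<lfloor>z v\<rfloor> \<le> int R" using z[OF v(1)] by (simp_all add: floor_le_iff)
      moreover have "int R \<le> int C" unfolding of_nat_le_iff by (simp add: C_def)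
      ultimately show ?thesis using v(2) by linarith
    qed
    show "1 \<le> C" by (simp add: C_def)
  qed
  from this obtain p :: "nat \<Rightarrow> nat" and q :: nat where pq: "0 < q \<and> q \<le> fact (Suc d) * C ^ Suc d \<and>
    (\<forall>j<d. p j \<le> fact (Suc d) * C ^ Suc d) \<and>
    (\<forall>(c, b, st) \<in> S. if st then (\<Sum>j<d. c j * int (p j)) < b * int q else (\<Sum>j<d. c j * int (p j)) \<le> b * int q)"
    by (elim exE) (erule that)
  note q = pq[THEN conjunct1] pq[THEN conjunct2, THEN conjunct1]
  note p = pq[THEN conjunct2, THEN conjunct2, THEN conjunct1, rule_format]
  note sol = pq[THEN conjunct2, THEN conjunct2, THEN conjunct2]
  have wb: "fact (Suc d) * C ^ Suc d \<le> witness_bound I M K"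
    by (simp add: witness_bound_def Let_def d_def n_def m_def C_def R_def)
  define w where "w = (\<lambda>v. real (p v) / real q)"
  have sum_w: "real_of_int (\<Sum>j<d. c j * int (p j)) = real q * ldot d c w" for c
    using q(1) by (simp add: ldot_def w_def sum_distrib_left)
  have le: "ldot d c w \<le> of_int b" if "(c, b, False) \<in> S" for c b
  proof -
    have "(\<Sum>j<d. c j * int (p j)) \<le> b * int q" using bspec[OF sol that] by simp
    then have "real_of_int (\<Sum>j<d. c j * int (p j)) \<le> real_of_int (b * int q)" by (simp only: of_int_le_iff)
    then have "real q * ldot d c w \<le> real q * of_int b" unfolding sum_w by (simp add: mult.commute)
    then show ?thesis using q(1) by simp
  qed
  have less: "ldot d c w < of_int b" if "(c, b, True) \<in> S" for c b
  proof -
    have "(\<Sum>j<d. c j * int (p j)) < b * int q" using bspec[OF sol that] by simp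
    then have "real_of_int (\<Sum>j<d. c j * int (p j)) < real_of_int (b * int q)" by (simp only: of_int_less_iff)
    then have "real q * ldot d c w < real q * of_int b" unfolding sum_w by (simp add: mult.commute)
    then show ?thesis using q(1) by simp
  qed
  have wR: "w v \<le> R" if "v < d" for v
    using le[of "unit v 1" "int R"] that by (auto simp: S_def S1_def unit_ldot)
  have w0: "0 \<le> w v" for v by (simp add: w_def)
  have wD: "w v = z v" if "v < d" "D v" for v
  proof -
    have "(unit v a, a * \<lfloor>z v\<rfloor>, False) \<in> S" if "a = 1 \<or> a = -1" for a
      using that \<open>v < d\<close> \<open>D v\<close> by (auto simp: S_def S5_def)
    from le[OF this[of 1]] le[OF this[of "-1"]] have "w v = of_int \<lfloor>z v\<rfloor>"
      by (simp add: unit_ldot \<open>v < d\<close>)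
    also have "\<dots> = z v" using Ints[OF that] by (auto elim!: Ints_cases)
    finally show ?thesis .
  qed
  have wX: "xs w \<in> X_c I"
    unfolding X_c_iff[OF I] xs_ldot
  proof (intro conjI allI impI)
    show "xs w \<in> real_box (bound_R I) (n_x I)"
      using wR w0 nd by (auto simp: real_box_def xs_def n_def[symmetric] R_def[symmetric])
    fix i assume "i < m_x I"
    then show "ldot n (row_A I \<Delta> i) w \<le> of_int (int_entry \<Delta> (vec_a I $ i))"
      using le[of "pad (row_A I \<Delta> i)" "int_entry \<Delta> (vec_a I $ i)"] by (auto simp: S_def S2_def ldot_pad')
  qed
  have wY: "\<exists>k<K. ys w k \<in> Y_c I (xs w) v" if v: "v \<in> U_d I (xs w)" for v
  proof -
    obtain u where u: "v = nat_vec u" "u \<in> UB"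
      and B: "\<And>i. i < m_u I \<Longrightarrow> ldot n (row_B I \<Delta> u i) w \<le> of_int (int_entry \<Delta> (vec_b I $ i))"
      using v[unfolded U_d_iff[OF I carr] xs_ldot] by (auto simp: UB_def R_def)
    \<comment> \<open>No scenario is new for \<open>w\<close>: one that was excluded under
      \<open>z\<close> still violates its row \<open>ii u\<close>, by the strict inequality in
      \<open>S4\<close>.\<close>
    have uU: "nat_vec u \<in> U_d I (xs z)"
    proof (rule ccontr)
      assume no: "nat_vec u \<notin> U_d I (xs z)"
      then have "(pad (\<lambda>k. - row_B I \<Delta> u (ii u) k), - int_entry \<Delta> (vec_b I $ ii u), True) \<in> S"
        using u(2) by (auto simp: S_def S4_def)
      from less[OF this] B[of "ii u"] ii[OF u(2) no] show False
        by (simp add: ldot_pad' ldot_neg)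
    qed
    have kK: "kk u < K" using kk[OF u(2) uU] by blast
    have len: "length u = n_u I" using u(2) by (simp add: UB_def)
    have "(kk u + 1) * m \<le> K * m" using kK by (intro mult_le_mono) auto
    then have lt: "n + kk u * m + j < d" if "j < m" for j using that by (simp add: d_def)
    have "ys w (kk u) \<in> Y_c I (xs w) (nat_vec u)"
      unfolding Y_c_iff[OF I carr len] xs_ldot ys_ldot
    proof (intro conjI allI impI)
      show "ys w (kk u) \<in> real_box (bound_R I) (n_y I)"
        using wR w0 lt by (auto simp: real_box_def ys_def m_def[symmetric] R_def[symmetric])
      fix i assume "i < m_y I"
      then have "(block_coeffs n m (kk u) (row_T I \<Delta> u i) (row_W I \<Delta> i), 0, False) \<in> S"
        using u(2) uU unfolding S_def S3_def by (auto intro!: image_eqI[of _ _ "(u, i)"])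
      from le[OF this] show "ldot n (row_T I \<Delta> u i) w + ldot m (row_W I \<Delta> i) (\<lambda>j. w (n + kk u * m + j)) \<le> 0"
        by (simp add: blk[OF u(2) uU])
    qed
    with kK u(1) show ?thesis by blast
  qed
  have "q \<le> witness_bound I M K" "\<forall>v<d. p v \<le> witness_bound I M K"
    using q(2) p wb by (meson le_trans)+
  then show ?thesis
    unfolding Let_def using q(1) wR wD wX wY
    by (intro exI[of _ p] exI[of _ q]) (simp add: w_def)
qed


lemma small_witness:
  assumes I: "valid_inst I" "scaled_inst \<Delta> M I"
    and adapt: "K_adaptable K (n_y I) (if dx then X_d I else X_c I) (U_d I) (if dy then Y_d I else Y_c I)"
  shows "\<exists>qx px qy py. 0 < qx \<and> qx \<le> witness_bound I M K \<and> (dx \<longrightarrow> qx = 1) \<and>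
    length px = n_x I \<and> (\<forall>p\<in>set px. p \<le> witness_bound I M K) \<and>
    0 < qy \<and> qy \<le> witness_bound I M K \<and> (dy \<longrightarrow> qy = 1) \<and> length py = K \<and>
    (\<forall>y\<in>set py. length y = n_y I \<and> (\<forall>p\<in>set y. p \<le> witness_bound I M K \<and> p \<le> bound_R I * qy)) \<and>
    frac_vec qx px \<in> X_c I \<and>
    (\<forall>u \<in> U_d I (frac_vec qx px). \<exists>y\<in>set py. frac_vec qy y \<in> Y_c I (frac_vec qx px) u)"
proof -
  let ?n = "n_x I" and ?m = "n_y I" and ?R = "bound_R I" and ?B = "witness_bound I M K"
  let ?d = "?n + K * ?m"
  obtain x ys where x: "x \<in> (if dx then X_d I else X_c I)" and ys: "length ys = K"
    and cover: "\<And>u. u \<in> U_d I x \<Longrightarrow> set ys \<inter> (if dy then Y_d I else Y_c I) x u \<noteq> {}"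
    using adapt unfolding K_adaptable_def by blast
  have xX: "x \<in> X_c I" "dx \<Longrightarrow> x \<in> int_vecs" using x by (auto simp: X_d_def split: if_splits)
  have xbox: "x \<in> real_box ?R ?n" using xX(1) by (simp add: X_c_def)
  \<comment> \<open>Recourse vectors outside the box, or not integral where this is demanded, serve
    no scenario. Replacing them by zero makes every unknown bounded and leaves the coverage
    intact.\<close>
  define yy where "yy k = (if ys ! k \<in> real_box ?R ?m \<and> (dy \<longrightarrow> ys ! k \<in> int_vecs) then ys ! k else 0\<^sub>v ?m)" for k
  have yy: "yy k \<in> real_box ?R ?m" "dy \<Longrightarrow> yy k \<in> int_vecs" for k
    by (auto simp: yy_def real_box_def int_vecs_def)
  define z where "z v = (if v < ?n then x $ v else yy ((v - ?n) div ?m) $ ((v - ?n) mod ?m))" for v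
  define D where "D v = (if v < ?n then dx else dy)" for v
  have zx: "vec ?n z = x" using xbox by (auto simp: z_def real_box_def intro!: eq_vecI)
  have zy: "vec ?m (\<lambda>j. z (?n + k * ?m + j)) = yy k" for k
  proof (rule eq_vecI)
    fix j assume "j < dim_vec (yy k)"
    then have "j < ?m" using yy(1)[of k] by (auto simp: real_box_def)
    then show "vec ?m (\<lambda>j. z (?n + k * ?m + j)) $ j = yy k $ j" by (simp add: z_def)
  qed (use yy(1)[of k] in \<open>auto simp: real_box_def\<close>)
  have zb: "0 \<le> z v \<and> z v \<le> ?R \<and> (D v \<longrightarrow> z v \<in> \<int>)" if v: "v < ?d" for v
  proof (cases "v < ?n")
    case True
    then show ?thesis using xbox xX(2) by (auto simp: z_def D_def real_box_def int_vecs_def)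
  next
    case False
    then have "?m > 0" using v by (cases "?m = 0") auto
    then have lt: "(v - ?n) mod ?m < ?m" by simp
    have "yy ((v - ?n) div ?m) \<in> real_box ?R ?m" "dy \<Longrightarrow> yy ((v - ?n) div ?m) \<in> int_vecs" by (rule yy)+
    then show ?thesis using False lt by (auto simp: z_def D_def real_box_def int_vecs_def)
  qed
  have cov: "\<exists>k<K. yy k \<in> Y_c I x u" if u: "u \<in> U_d I x" for u
  proof -
    obtain y where y: "y \<in> set ys" "y \<in> (if dy then Y_d I else Y_c I) x u" using cover[OF u] by blast
    then obtain k where k: "k < K" "y = ys ! k" using ys by (auto simp: in_set_conv_nth)
    have "y \<in> Y_c I x u" "dy \<Longrightarrow> y \<in> int_vecs" using y(2) by (auto simp: Y_d_def split: if_splits)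
    then show ?thesis using k by (intro exI[of _ k]) (auto simp: yy_def Y_c_def)
  qed
  from small_witness_real[OF I, of K z D, unfolded zx zy] zb xX(1) cov
  have ex: "\<exists>(p :: nat \<Rightarrow> nat) q. 0 < q \<and> q \<le> ?B \<and> (\<forall>v<?d. p v \<le> ?B) \<and>
    (let w = (\<lambda>v. real (p v) / real q) in
      (\<forall>v<?d. w v \<le> ?R \<and> (D v \<longrightarrow> w v = z v)) \<and> vec ?n w \<in> X_c I \<and>
      (\<forall>u \<in> U_d I (vec ?n w). \<exists>k<K. vec ?m (\<lambda>j. w (?n + k * ?m + j)) \<in> Y_c I (vec ?n w) u))"
    by blast
  from ex obtain p :: "nat \<Rightarrow> nat" and q :: nat where pq: "0 < q \<and> q \<le> ?B \<and> (\<forall>v<?d. p v \<le> ?B) \<and>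
    (let w = (\<lambda>v. real (p v) / real q) in
      (\<forall>v<?d. w v \<le> ?R \<and> (D v \<longrightarrow> w v = z v)) \<and> vec ?n w \<in> X_c I \<and>
      (\<forall>u \<in> U_d I (vec ?n w). \<exists>k<K. vec ?m (\<lambda>j. w (?n + k * ?m + j)) \<in> Y_c I (vec ?n w) u))"
    by (elim exE) (erule that)
  define w where "w v = real (p v) / real q" for v
  have q: "0 < q" "q \<le> ?B" and pB: "\<And>v. v < ?d \<Longrightarrow> p v \<le> ?B"
    and wR: "\<And>v. v < ?d \<Longrightarrow> w v \<le> ?R" and wD: "\<And>v. v < ?d \<Longrightarrow> D v \<Longrightarrow> w v = z v"
    and wX: "vec ?n w \<in> X_c I"
    and wY: "\<And>u. u \<in> U_d I (vec ?n w) \<Longrightarrow> \<exists>k<K. vec ?m (\<lambda>j. w (?n + k * ?m + j)) \<in> Y_c I (vec ?n w) u"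
    using pq unfolding Let_def w_def[abs_def] by auto
  \<comment> \<open>The solution comes with one denominator \<open>q\<close> for all unknowns. Where
    integrality is demanded the value is the integer \<open>z v\<close> and is written over 1, so
    \<open>x\<close> and the recourse vectors get denominators of their own.\<close>
  define num where "num e v = (if e then nat \<lfloor>z v\<rfloor> else p v)" for e v
  define den where "den e = (if e then 1 else q)" for e
  have RB: "?R \<le> ?B" by (simp add: witness_bound_def Let_def)
  have den: "0 < den e" "den e \<le> ?B" for e using q by (auto simp: den_def)
  have num: "real (num e v) / real (den e) = w v" "num e v \<le> ?B" "num e v \<le> ?R * den e"
    if v: "v < ?d" and e: "e \<Longrightarrow> D v" for e v
  proof -
    show eq: "real (num e v) / real (den e) = w v"
    proof (cases e)
      case True
      then have "z v \<in> \<int>" "0 \<le> z v" using zb[OF v] e by auto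
      then have "real (nat \<lfloor>z v\<rfloor>) = z v" by (auto elim!: Ints_cases)
      then show ?thesis using True wD[OF v e] by (simp add: num_def den_def)
    qed (simp add: num_def den_def w_def)
    have "real (num e v) = w v * real (den e)" using eq den(1)[of e] by (auto simp: field_simps)
    also have "\<dots> \<le> real ?R * real (den e)" using wR[OF v] by (intro mult_right_mono) auto
    finally show le: "num e v \<le> ?R * den e" by (simp flip: of_nat_mult)
    show "num e v \<le> ?B"
    proof (cases e)
      case True
      then show ?thesis using le RB by (simp add: den_def)
    qed (simp add: num_def pB v)
  qed
  define px where "px = map (num dx) [0..<?n]"
  define py where "py = map (\<lambda>k. map (\<lambda>j. num dy (?n + k * ?m + j)) [0..<?m]) [0..<K]"
  have fx: "frac_vec (den dx) px = vec ?n w"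
    by (rule eq_vecI) (auto simp: frac_vec_def px_def num D_def)
  have lt: "?n + k * ?m + j < ?d" if "k < K" "j < ?m" for k j
  proof -
    have "(k + 1) * ?m \<le> K * ?m" using that(1) by (intro mult_le_mono) auto
    then show ?thesis using that(2) by simp
  qed
  have fy: "frac_vec (den dy) (map (\<lambda>j. num dy (?n + k * ?m + j)) [0..<?m]) = vec ?m (\<lambda>j. w (?n + k * ?m + j))"
    if "k < K" for k
    using lt[OF that] by (intro eq_vecI) (auto simp: frac_vec_def num D_def)
  have c1: "\<forall>p\<in>set px. p \<le> ?B"
    using num(2)[of _ dx] by (auto simp: px_def D_def)
  have c2: "\<forall>y\<in>set py. length y = ?m \<and> (\<forall>p\<in>set y. p \<le> ?B \<and> p \<le> ?R * den dy)"
    using num(2,3)[of _ dy] lt by (auto simp: py_def D_def)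
  have c3: "\<forall>u \<in> U_d I (vec ?n w). \<exists>y\<in>set py. frac_vec (den dy) y \<in> Y_c I (vec ?n w) u"
  proof
    fix u assume "u \<in> U_d I (vec ?n w)"
    from wY[OF this] obtain k where k: "k < K" "vec ?m (\<lambda>j. w (?n + k * ?m + j)) \<in> Y_c I (vec ?n w) u" by blast
    then show "\<exists>y\<in>set py. frac_vec (den dy) y \<in> Y_c I (vec ?n w) u"
      by (intro bexI[of _ "map (\<lambda>j. num dy (?n + k * ?m + j)) [0..<?m]"]) (auto simp: fy py_def)
  qed
  show ?thesis
    by (rule exI[of _ "den dx"], rule exI[of _ px], rule exI[of _ "den dy"], rule exI[of _ py], unfold fx)
      (intro conjI den c1 c2 c3 wX; simp add: den_def px_def py_def)
qed


section \<open>The verifier\<close>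

text \<open>
  An integer is represented by a pair of natural numbers, of which it is the difference.
  A rational number \<open>\<plusminus>n/d\<close> comes with a certificate \<open>b * d = a * n + 1\<close> that the fraction is reduced,
  and with the cofactor \<open>e\<close> of \<open>d\<close> in the common denominator \<open>\<Delta>\<close>.
\<close>

type_synonym zz = "nat \<times> nat"
type_synonym rdat = "bool \<times> nat \<times> nat \<times> nat \<times> nat \<times> nat"

definition ival :: "zz \<Rightarrow> int" where
  "ival z = int (fst z) - int (snd z)"

definition rat_ok :: "nat \<Rightarrow> rdat \<Rightarrow> bool" where
  "rat_ok \<Delta> = (\<lambda>(s, n, d, a, b, e). b * d = a * n + 1 \<and> d * e = \<Delta> \<and> (s \<longrightarrow> n \<noteq> 0))"

definition rat_val :: "rdat \<Rightarrow> rat" where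
  "rat_val = (\<lambda>(s, n, d, a, b, e). (if s then - of_nat n else of_nat n) / of_nat d)"

definition rat_ent :: "rdat \<Rightarrow> zz" where
  "rat_ent = (\<lambda>(s, n, d, a, b, e). if s then (0, n * e) else (n * e, 0))"

definition rat_bits :: "rdat \<Rightarrow> bool list" where
  "rat_bits = (\<lambda>(s, n, d, a, b, e). (s # enc_nat n) @ (False # enc_nat d))"

definition row_dot :: "rdat list \<Rightarrow> nat list \<Rightarrow> zz" where
  "row_dot r y = foldl (\<lambda>acc t. (fst acc + fst (rat_ent (fst t)) * snd t, snd acc + snd (rat_ent (fst t)) * snd t))
     (0, 0) (zip r y)"

definition zadd :: "zz list \<Rightarrow> zz list \<Rightarrow> zz list" where
  "zadd v w = map (\<lambda>t. (fst (fst t) + fst (snd t), snd (fst t) + snd (snd t))) (zip v w)"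

text \<open>Serves both bilinear terms: \<open>B(x) u\<close> has its scalars in \<open>x\<close>,
  \<open>T(u) x\<close> has them in \<open>u\<close>. The list \<open>m\<close> fixes the number of
  rows even when there are no matrices to add.\<close>

definition lincomb :: "bool list \<Rightarrow> nat list \<Rightarrow> rdat list list list \<Rightarrow> nat list \<Rightarrow> zz list" where
  "lincomb m c Ms y = foldl zadd (map (\<lambda>_. (0, 0)) m)
     (map (\<lambda>t. map (\<lambda>r. (fst t * fst (row_dot r y), fst t * snd (row_dot r y))) (snd t)) (zip c Ms))"

definition mat_ok :: "nat \<Rightarrow> bool list \<Rightarrow> bool list \<Rightarrow> rdat list list \<Rightarrow> bool" where
  "mat_ok \<Delta> m n M \<longleftrightarrow> length M = length m \<and> list_all (\<lambda>r. length r = length n \<and> list_all (rat_ok \<Delta>) r) M"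

section \<open>Polynomial time of the verifier's arithmetic\<close>

lemma PT_rat_ops [PT_intros]:
  assumes "PT f"
  shows "PT (\<lambda>z. rat_ent (f z))" "PT g \<Longrightarrow> PT (\<lambda>z. rat_ok (g z) (f z))"
  unfolding rat_ent_def rat_ok_def case_prod_beta by (intro PT_intros assms; assumption)+

lemma PT_enc_list:
  assumes "PT (\<lambda>t. e (fst t) (snd t))" "PT f"
  shows "PT (\<lambda>z. enc_list (e z) (f z))"
proof -
  have *: "enc_list h xs = concat (map (\<lambda>x. True # h x) xs) @ [False]" for h :: "'b \<Rightarrow> bool list" and xs
    by (induction xs) auto
  show ?thesis unfolding * by (intro PT_intros assms)
qed

lemma PT_enc_nat [PT_intros]: "PT f \<Longrightarrow> PT (\<lambda>z. enc_nat (f z))"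
  unfolding enc_nat_def enc_string_def by (intro PT_enc_list PT_intros)

lemma PT_rat_bits [PT_intros]: "PT f \<Longrightarrow> PT (\<lambda>z. rat_bits (f z))"
  unfolding rat_bits_def case_prod_beta by (intro PT_intros)

lemma bl_mult_add: "bl (a + b * c) \<le> bl a + bl b + bl c + 1"
  using bl_add[of a "b * c"] bl_mult[of b c] by linarith

lemma PT_row_dot [PT_intros]:
  assumes "PT f" "PT g"
  shows "PT (\<lambda>z. row_dot (f z) (g z))"
proof -
  obtain p where p: "\<And>r. sz (rat_ent r) \<le> poly p (sz r)"
    using PT_size[OF PT_rat_ops(1)[OF PT_id]] by blast
  show ?thesis unfolding row_dot_def
  proof (rule PT_foldl[where g = "\<lambda>n. 2 * poly p n + 2 * n + 12"])
    fix z :: 'a and acc :: zz and t :: "rdat \<times> nat"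
    have t: "sz t = 1 + sz (fst t) + sz (snd t)" by (rule sz_prod)
    have "sz (rat_ent (fst t)) \<le> poly p (sz z + sz t)"
      using p[of "fst t"] poly_mono_nat[of "sz (fst t)" "sz z + sz t" p] t by simp
    then have "6 * bl (fst (rat_ent (fst t))) + 6 * bl (snd (rat_ent (fst t))) \<le> poly p (sz z + sz t)"
      by (simp add: sz_prod[of "rat_ent (fst t)"] sz_nat)
    moreover have "6 * bl (snd t) \<le> sz t" using t by (simp add: sz_nat)
    ultimately show "sz (fst acc + fst (rat_ent (fst t)) * snd t, snd acc + snd (rat_ent (fst t)) * snd t)
        \<le> sz acc + (2 * poly p (sz z + sz t) + 2 * (sz z + sz t) + 12)"
      using bl_mult_add[of "fst acc" "fst (rat_ent (fst t))" "snd t"]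
        bl_mult_add[of "snd acc" "snd (rat_ent (fst t))" "snd t"]
      by (simp add: sz_prod[of acc] sz_nat)
  qed (intro PT_intros assms pb_intros)+
qed

text \<open>Asymmetric, to fit the growth condition of \<open>PT_foldl\<close> with \<open>v\<close>
  as accumulator. The factor 5 absorbs the carries, since even a pair of zeros has size 3.\<close>

lemma sz_zadd: "sz (zadd v w) \<le> sz v + 5 * sz w"
proof (induction v arbitrary: w)
  case Nil
  then show ?case by (simp add: zadd_def)
next
  case (Cons a v)
  show ?case
  proof (cases w)
    case Nil
    then show ?thesis using sz_pos[of "a # v"] by (simp add: zadd_def)
  next
    case (Cons b w')
    have "sz (zadd v w') \<le> sz v + 5 * sz w'" by (rule Cons.IH)
    moreover have "sz (fst a + fst b, snd a + snd b) \<le> sz a + 5 * sz b"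
      using bl_add[of "fst a" "fst b"] bl_add[of "snd a" "snd b"]
      by (simp add: sz_prod[of a] sz_prod[of b] sz_nat)
    moreover have "zadd (a # v) w = (fst a + fst b, snd a + snd b) # zadd v w'"
      by (simp add: Cons zadd_def)
    ultimately show ?thesis using Cons by simp
  qed
qed

lemma PT_lincomb [PT_intros]:
  fixes f1 :: "'a :: coded \<Rightarrow> bool list"
  assumes "PT f1" "PT f2" "PT f3" "PT f4"
  shows "PT (\<lambda>z. lincomb (f1 z) (f2 z) (f3 z) (f4 z))"
proof -
  have "PT (\<lambda>t :: ('a \<times> nat \<times> rdat list list) \<times> rdat list. f4 (fst (fst t)))"
    by (rule PT_weaken[OF PT_weaken[OF assms(4)]])
  note f4 = this
  show ?thesis unfolding lincomb_def
  proof (rule PT_foldl[where g = "\<lambda>n. 5 * n"])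
    show "sz (zadd acc e) \<le> sz acc + 5 * (sz z + sz e)" for z :: 'a and acc e
      using sz_zadd[of acc e] by simp
    show "PT (\<lambda>t :: 'a \<times> zz list \<times> zz list. zadd (fst (snd t)) (snd (snd t)))"
      unfolding zadd_def by (intro PT_intros)
  qed (intro PT_intros assms f4 pb_intros)+
qed

lemma PT_mat_ok:
  fixes f1 :: "'a :: coded \<Rightarrow> nat"
  assumes "PT f1" "PT f2" "PT f3" "PT f4"
  shows "PT (\<lambda>z. mat_ok (f1 z) (f2 z) (f3 z) (f4 z))"
  unfolding mat_ok_def
  by (intro PT_intros assms PT_weaken[OF assms(3)] PT_weaken[OF PT_weaken[OF assms(1)]])


section \<open>The instance in tabular form and the tests on it\<close>

type_synonym dims = "bool list \<times> bool list \<times> bool list \<times> bool list \<times> bool list \<times> bool list"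
type_synonym data = "rdat list \<times> rdat list \<times> rdat list list \<times> rdat list list \<times>
  rdat list list list \<times> rdat list list list"

definition mat_val :: "bool list \<Rightarrow> bool list \<Rightarrow> rdat list list \<Rightarrow> rat mat" where
  "mat_val m n M = mat (length m) (length n) (\<lambda>(i, j). rat_val (M ! i ! j))"

text \<open>A dimension is a list of that length. This matches the unary \<open>enc_dim\<close> and
  directly provides the row counts for \<open>lincomb\<close>.\<close>

definition inst_of :: "dims \<Rightarrow> nat \<Rightarrow> data \<Rightarrow> adapt_inst" where
  "inst_of = (\<lambda>(nx, nu, ny, mx, mu, my) R (va, vb, mA, mW, cB, cT).
     \<lparr>n_x = length nx, n_u = length nu, n_y = length ny, m_x = length mx, m_u = length mu, m_y = length my,
      bound_R = R, vec_a = vec_of_list (map rat_val va), vec_b = vec_of_list (map rat_val vb),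
      mat_A = mat_val mx nx mA, mat_W = mat_val my ny mW,
      coeffs_B = map (mat_val mu nu) cB, coeffs_T = map (mat_val my nx) cT\<rparr>)"

definition data_ok :: "dims \<Rightarrow> nat \<Rightarrow> data \<Rightarrow> bool" where
  "data_ok = (\<lambda>(nx, nu, ny, mx, mu, my) \<Delta> (va, vb, mA, mW, cB, cT). \<Delta> \<noteq> 0 \<and>
     length va = length mx \<and> list_all (rat_ok \<Delta>) va \<and> length vb = length mu \<and> list_all (rat_ok \<Delta>) vb \<and>
     mat_ok \<Delta> mx nx mA \<and> mat_ok \<Delta> my ny mW \<and>
     length cB = length nx \<and> list_all (mat_ok \<Delta> mu nu) cB \<and>
     length cT = length nu \<and> list_all (mat_ok \<Delta> my nx) cT)"

definition dim_bits :: "bool list \<Rightarrow> bool list" where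
  "dim_bits n = map (\<lambda>_. True) n @ [False]"

definition inst_bits :: "dims \<Rightarrow> nat \<Rightarrow> data \<Rightarrow> bool list" where
  "inst_bits = (\<lambda>(nx, nu, ny, mx, mu, my) R (va, vb, mA, mW, cB, cT).
     dim_bits nx @ dim_bits nu @ dim_bits ny @ dim_bits mx @ dim_bits mu @ dim_bits my @ enc_nat R @
     enc_list rat_bits va @ enc_list rat_bits vb @ enc_list (enc_list rat_bits) mA @ enc_list (enc_list rat_bits) mW @
     enc_list (enc_list (enc_list rat_bits)) cB @ enc_list (enc_list (enc_list rat_bits)) cT)"

text \<open>The flags \<open>dx\<close> and \<open>dy\<close> ask for integral \<open>x\<close> and \<open>y\<close>, that is, for denominator 1.\<close>

definition x_ok :: "bool \<Rightarrow> dims \<Rightarrow> nat \<Rightarrow> data \<Rightarrow> nat \<Rightarrow> nat list \<Rightarrow> bool" where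
  "x_ok dx = (\<lambda>(nx, nu, ny, mx, mu, my) R (va, vb, mA, mW, cB, cT) qx px.
     qx \<noteq> 0 \<and> (dx \<longrightarrow> qx = 1) \<and> length px = length nx \<and> list_all (\<lambda>p. p \<le> R * qx) px \<and>
     list_all (\<lambda>t. fst (row_dot (fst t) px) + snd (rat_ent (snd t)) * qx \<le>
       snd (row_dot (fst t) px) + fst (rat_ent (snd t)) * qx) (zip mA va))"

definition ys_ok :: "bool \<Rightarrow> dims \<Rightarrow> nat \<Rightarrow> nat \<Rightarrow> nat list list \<Rightarrow> bool" where
  "ys_ok dy = (\<lambda>(nx, nu, ny, mx, mu, my) R qy py.
     qy \<noteq> 0 \<and> (dy \<longrightarrow> qy = 1) \<and> list_all (\<lambda>y. length y = length ny \<and> list_all (\<lambda>p. p \<le> R * qy) y) py)"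

definition u_ok :: "dims \<Rightarrow> nat \<Rightarrow> data \<Rightarrow> nat \<Rightarrow> nat list \<Rightarrow> nat list \<Rightarrow> bool" where
  "u_ok = (\<lambda>(nx, nu, ny, mx, mu, my) R (va, vb, mA, mW, cB, cT) qx px u.
     length u = length nu \<and> list_all (\<lambda>p. p \<le> R) u \<and>
     list_all (\<lambda>t. fst (fst t) + snd (rat_ent (snd t)) * qx \<le> snd (fst t) + fst (rat_ent (snd t)) * qx)
       (zip (lincomb mu px cB u) vb))"

definition y_ok :: "dims \<Rightarrow> data \<Rightarrow> nat \<Rightarrow> nat list \<Rightarrow> nat \<Rightarrow> nat list \<Rightarrow> nat list \<Rightarrow> bool" where
  "y_ok = (\<lambda>(nx, nu, ny, mx, mu, my) (va, vb, mA, mW, cB, cT) qx px qy u y.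
     list_all (\<lambda>t. qy * fst (fst t) + qx * fst (row_dot (snd t) y) \<le>
       qy * snd (fst t) + qx * snd (row_dot (snd t) y)) (zip (lincomb my u cT px) mW))"

text \<open>The Bezout identity forces \<open>d\<close> to be positive and coprime to
  \<open>n\<close>, so \<open>n\<close> and \<open>d\<close> are what \<open>quotient_of\<close>
  returns up to sign. Requiring \<open>n\<close> to be nonzero under a minus sign excludes a second
  representation of zero, with a different encoding.\<close>

lemma rat_ok_props:
  assumes "rat_ok \<Delta> r" "0 < \<Delta>"
  shows "enc_rat (rat_val r) = rat_bits r"
    and "rat_of_int (ival (rat_ent r)) = of_nat \<Delta> * rat_val r"
    and "int_entry \<Delta> (rat_val r) = ival (rat_ent r)"
proof -
  obtain s n d a b e where r: "r = (s, n, d, a, b, e)" by (metis surj_pair)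
  have eq: "b * d = a * n + 1" "d * e = \<Delta>" "s \<Longrightarrow> n \<noteq> 0"
    using assms(1) by (auto simp: r rat_ok_def)
  have d: "0 < d" using eq(1) by (cases d) auto
  have "coprime n d"
  proof (rule coprimeI)
    fix c assume "c dvd n" "c dvd d"
    then have "c dvd a * n + 1" "c dvd a * n" unfolding eq(1)[symmetric] by auto
    then show "is_unit c" using dvd_add_right_iff by blast
  qed
  then have cop: "coprime (if s then - int n else int n) (int d)" by simp
  have "rat_val r = Rat.Fract (if s then - int n else int n) (int d)"
    by (simp add: r rat_val_def Fract_of_int_quotient)
  then have "quotient_of (rat_val r) = (if s then - int n else int n, int d)"
    using d cop by (simp add: quotient_of_Fract normalize_stable)
  then show "enc_rat (rat_val r) = rat_bits r"
    using eq(3) by (auto simp: r enc_rat_def enc_int_def rat_bits_def)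
  show *: "rat_of_int (ival (rat_ent r)) = of_nat \<Delta> * rat_val r"
    using d by (auto simp: r rat_val_def rat_ent_def ival_def eq(2)[symmetric] field_simps)
  show "int_entry \<Delta> (rat_val r) = ival (rat_ent r)"
    unfolding int_entry_def *[symmetric] by simp
qed

lemma enc_list_map: "enc_list e (map f xs) = enc_list (\<lambda>x. e (f x)) xs"
  by (induction xs) auto

lemma enc_list_cong: "(\<And>x. x \<in> set xs \<Longrightarrow> e x = e' x) \<Longrightarrow> enc_list e xs = enc_list e' xs"
  by (induction xs) auto

lemma enc_vec_val:
  assumes "list_all (rat_ok \<Delta>) v" "0 < \<Delta>"
  shows "enc_list enc_rat (map rat_val v) = enc_list rat_bits v"
  using assms by (auto simp: enc_list_map list_all_iff rat_ok_props intro!: enc_list_cong)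

lemma enc_mat_val:
  assumes "mat_ok \<Delta> m n M" "0 < \<Delta>"
  shows "enc_mat (mat_val m n M) = enc_list (enc_list rat_bits) M"
proof -
  have "rows (mat_val m n M) = map (\<lambda>r. vec_of_list (map rat_val r)) M"
  proof (rule nth_equalityI)
    show "length (rows (mat_val m n M)) = length (map (\<lambda>r. vec_of_list (map rat_val r)) M)"
      using assms(1) by (simp add: mat_val_def mat_ok_def)
    fix i assume "i < length (rows (mat_val m n M))"
    then have i: "i < length m" by (simp add: mat_val_def)
    then have "length (M ! i) = length n" using assms(1) by (auto simp: mat_ok_def list_all_length)
    then show "rows (mat_val m n M) ! i = map (\<lambda>r. vec_of_list (map rat_val r)) M ! i"
      using i assms(1) by (intro eq_vecI) (auto simp: mat_val_def mat_ok_def vec_of_list_index)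
  qed
  then have "enc_mat (mat_val m n M) = enc_list (\<lambda>r. enc_list enc_rat (map rat_val r)) M"
    by (simp only: enc_mat_def enc_list_map enc_vec_def list_vec)
  also have "\<dots> = enc_list (enc_list rat_bits) M"
    using assms by (auto simp: mat_ok_def list_all_iff intro!: enc_list_cong enc_vec_val)
  finally show ?thesis .
qed

lemma dim_bits: "dim_bits n = enc_dim (length n)"
  by (simp add: dim_bits_def enc_dim_def map_replicate_const)

lemma mat_val_carrier [simp]: "mat_val m n M \<in> carrier_mat (length m) (length n)"
  by (simp add: mat_val_def)

lemma inst_of_bits:
  assumes "data_ok dm \<Delta> da"
  shows "enc_inst (inst_of dm R da) = inst_bits dm R da"
proof -
  obtain nx nu ny mx mu my where dm: "dm = (nx, nu, ny, mx, mu, my)" by (metis surj_pair)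
  obtain va vb mA mW cB cT where da: "da = (va, vb, mA, mW, cB, cT)" by (metis surj_pair)
  have \<Delta>: "0 < \<Delta>" using assms by (simp add: dm da data_ok_def)
  have ms: "enc_list enc_mat (map (mat_val m n) Ms) = enc_list (enc_list (enc_list rat_bits)) Ms"
    if "list_all (mat_ok \<Delta> m n) Ms" for m n Ms
    unfolding enc_list_map using that \<Delta> by (intro enc_list_cong enc_mat_val) (auto simp: list_all_iff)
  show ?thesis
    using assms \<Delta> unfolding dm da inst_of_def inst_bits_def data_ok_def enc_inst_def enc_vec_def
    by (simp add: dim_bits list_vec enc_vec_val[of \<Delta>] enc_mat_val[of \<Delta>] ms del: vec_of_list_map)
qed

lemma inst_of_valid:
  assumes "data_ok dm \<Delta> da"
  shows "valid_inst (inst_of dm R da)"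
  using assms by (cases dm; cases da) (auto simp: data_ok_def inst_of_def valid_inst_def carrier_dim_vec)

text \<open>For soundness any bound on the scaled entries will do; its size matters only when a
  short certificate is constructed.\<close>

lemma finite_int_bound: "finite F \<Longrightarrow> \<exists>M. \<forall>r\<in>F. \<bar>f r\<bar> \<le> int M"
proof (induction F rule: finite_induct)
  case (insert x F)
  then obtain M where M: "\<forall>r\<in>F. \<bar>f r\<bar> \<le> int M" by blast
  have "\<forall>r\<in>insert x F. \<bar>f r\<bar> \<le> int (max M (nat \<bar>f x\<bar>))"
    using M by (auto simp: le_max_iff_disj)
  then show ?case by blast
qed simp

definition data_rats :: "data \<Rightarrow> rdat list" where
  "data_rats = (\<lambda>(va, vb, mA, mW, cB, cT). va @ vb @ concat mA @ concat mW @ concat (concat cB) @ concat (concat cT))"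

lemma scaled_inst_of:
  assumes "data_ok dm \<Delta> da" and M: "\<And>r. r \<in> set (data_rats da) \<Longrightarrow> \<bar>ival (rat_ent r)\<bar> \<le> int M"
  shows "scaled_inst \<Delta> M (inst_of dm R da)"
proof -
  obtain nx nu ny mx mu my where dm: "dm = (nx, nu, ny, mx, mu, my)" by (metis surj_pair)
  obtain va vb mA mW cB cT where da: "da = (va, vb, mA, mW, cB, cT)" by (metis surj_pair)
  have \<Delta>: "0 < \<Delta>" using assms by (simp add: dm da data_ok_def)
  have sc: "scaled \<Delta> M (rat_val r)" if "rat_ok \<Delta> r" "r \<in> set (data_rats da)" for r
    using rat_ok_props[OF that(1) \<Delta>] M[OF that(2)] by (simp add: scaled_def)
  have v: "scaled \<Delta> M (vec_of_list (map rat_val v) $ i)"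
    if "list_all (rat_ok \<Delta>) v" "i < length v" "set v \<subseteq> set (data_rats da)" for v i
    using that by (auto simp: vec_of_list_index list_all_length intro!: sc)
  have m: "scaled \<Delta> M (mat_val m n A $$ (i, j))"
    if A: "mat_ok \<Delta> m n A" and i: "i < length m" "j < length n" and s: "set (concat A) \<subseteq> set (data_rats da)" for m n A i j
  proof -
    have l: "i < length A" "length (A ! i) = length n" "list_all (rat_ok \<Delta>) (A ! i)"
      using A i by (auto simp: mat_ok_def list_all_length)
    then have "A ! i ! j \<in> set (concat A)" using i by (auto intro!: bexI[of _ "A ! i"])
    then show ?thesis using l i s by (auto simp: mat_val_def list_all_length intro!: sc)
  qed
  have ms: "scaled \<Delta> M (map (mat_val m n) As ! k $$ (i, j))"
    if "list_all (mat_ok \<Delta> m n) As" "k < length As" "i < length m" "j < length n" "set (concat (concat As)) \<subseteq> set (data_rats da)"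
    for m n As i j k
  proof -
    have "mat_ok \<Delta> m n (As ! k)" using that by (simp add: list_all_length)
    moreover have "set (concat (As ! k)) \<subseteq> set (data_rats da)"
    proof -
      have "set (concat (As ! k)) \<subseteq> set (concat (concat As))"
        using nth_mem[OF that(2)] unfolding set_concat set_map by blast
      then show ?thesis using that(5) by blast
    qed
    ultimately show ?thesis using that m[of m n "As ! k" i j] by simp
  qed
  have sub: "set va \<subseteq> set (data_rats da)" "set vb \<subseteq> set (data_rats da)" "set (concat mA) \<subseteq> set (data_rats da)"
    "set (concat mW) \<subseteq> set (data_rats da)" "set (concat (concat cB)) \<subseteq> set (data_rats da)"
    "set (concat (concat cT)) \<subseteq> set (data_rats da)"
    by (auto simp: da data_rats_def)
  show ?thesis
    using assms(1) v[OF _ _ sub(1)] v[OF _ _ sub(2)] m[OF _ _ _ sub(3)] m[OF _ _ _ sub(4)] ms[OF _ _ _ _ sub(5)] ms[OF _ _ _ _ sub(6)]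
    unfolding scaled_inst_def dm da inst_of_def data_ok_def by (simp add: \<Delta>)
qed

lemma row_dot_val:
  assumes "length r = n" "length y = n"
  shows "ival (row_dot r y) = (\<Sum>j<n. ival (rat_ent (r ! j)) * int (y ! j))"
proof -
  let ?st = "\<lambda>acc t. (fst acc + fst (rat_ent (fst t)) * snd t, snd acc + snd (rat_ent (fst t)) * snd t)"
  have st: "ival (?st acc t) = ival acc + ival (rat_ent (fst t)) * int (snd t)" for acc t
    by (simp add: ival_def algebra_simps)
  have "ival (foldl ?st acc ts) = ival acc + sum_list (map (\<lambda>t. ival (rat_ent (fst t)) * int (snd t)) ts)" for acc ts
  proof (induction ts arbitrary: acc)
    case (Cons t ts)
    show ?case unfolding foldl.simps Cons.IH st by simp
  qed simp
  from this[of "(0, 0)"] have "ival (row_dot r y) = sum_list (map (\<lambda>t. ival (rat_ent (fst t)) * int (snd t)) (zip r y))"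
    unfolding row_dot_def by (simp only: ival_def) simp
  also have "\<dots> = (\<Sum>j<n. ival (rat_ent (r ! j)) * int (y ! j))"
    using assms by (simp add: sum_list_sum_nth lessThan_atLeast0)
  finally show ?thesis .
qed

lemma lincomb_val:
  assumes "list_all (\<lambda>M. length M = length m) Ms" "length c = length Ms"
  shows "length (lincomb m c Ms y) = length m"
    and "i < length m \<Longrightarrow> ival (lincomb m c Ms y ! i) = (\<Sum>k<length Ms. int (c ! k) * ival (row_dot (Ms ! k ! i) y))"
proof -
  let ?v = "\<lambda>t :: nat \<times> rdat list list. map (\<lambda>r. (fst t * fst (row_dot r y), fst t * snd (row_dot r y))) (snd t)"
  have *: "length (foldl zadd acc (map ?v ts)) = length m \<and>
      (i < length m \<longrightarrow> ival (foldl zadd acc (map ?v ts) ! i) =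
        ival (acc ! i) + sum_list (map (\<lambda>t. int (fst t) * ival (row_dot (snd t ! i) y)) ts))"
    if "length acc = length m" "\<forall>t\<in>set ts. length (snd t) = length m" for acc ts
    using that
  proof (induction ts arbitrary: acc)
    case (Cons t ts)
    have l: "length (zadd acc (?v t)) = length m" using Cons.prems by (simp add: zadd_def)
    have "ival (zadd acc (?v t) ! i) = ival (acc ! i) + int (fst t) * ival (row_dot (snd t ! i) y)" if "i < length m"
      using that Cons.prems by (simp add: zadd_def ival_def algebra_simps)
    then show ?case using Cons.IH[OF l] Cons.prems by simp
  qed simp
  have ts: "\<forall>t\<in>set (zip c Ms). length (snd t) = length m"
    using assms(1) by (auto simp: list_all_iff dest: set_zip_rightD)
  have acc: "length (map (\<lambda>_. (0 :: nat, 0 :: nat)) m) = length m" by simp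
  show "length (lincomb m c Ms y) = length m" unfolding lincomb_def using *[OF acc ts] by blast
  assume i: "i < length m"
  have "ival (lincomb m c Ms y ! i) = sum_list (map (\<lambda>t. int (fst t) * ival (row_dot (snd t ! i) y)) (zip c Ms))"
    unfolding lincomb_def using *[OF acc ts] i by (simp add: ival_def)
  also have "\<dots> = (\<Sum>k<length Ms. int (c ! k) * ival (row_dot (Ms ! k ! i) y))"
    using assms(2) by (simp add: sum_list_sum_nth lessThan_atLeast0)
  finally show "ival (lincomb m c Ms y ! i) = (\<Sum>k<length Ms. int (c ! k) * ival (row_dot (Ms ! k ! i) y))" .
qed

lemma ldot_frac:
  assumes "length p = n" "0 < q"
  shows "ldot n f (\<lambda>j. frac_vec q p $ j) = real_of_int (\<Sum>j<n. f j * int (p ! j)) / real q"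
  using assms by (simp add: ldot_def frac_vec_def sum_divide_distrib)

lemma ldot_frac_le:
  assumes "length p = n" "0 < q"
  shows "ldot n f (\<lambda>j. frac_vec q p $ j) \<le> of_int b \<longleftrightarrow> (\<Sum>j<n. f j * int (p ! j)) \<le> b * int q"
proof -
  have "ldot n f (\<lambda>j. frac_vec q p $ j) \<le> of_int b \<longleftrightarrow>
      real_of_int (\<Sum>j<n. f j * int (p ! j)) \<le> real_of_int (b * int q)"
    unfolding ldot_frac[OF assms] using assms(2) by (simp add: divide_le_eq)
  then show ?thesis by (simp only: of_int_le_iff)
qed

lemma frac_vec_box:
  assumes "length p = n" "0 < q"
  shows "frac_vec q p \<in> real_box R n \<longleftrightarrow> (\<forall>j<n. p ! j \<le> R * q)"
proof -
  have "real (p ! j) / real q \<le> real R \<longleftrightarrow> p ! j \<le> R * q" for j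
    using assms(2) by (simp add: divide_le_eq flip: of_nat_mult)
  then show ?thesis using assms by (auto simp: real_box_def frac_vec_def)
qed


section \<open>Integer tests and membership in the feasible sets\<close>

lemma list_all_zip:
  assumes "length xs = m" "length ys = m"
  shows "list_all P (zip xs ys) \<longleftrightarrow> (\<forall>i<m. P (xs ! i, ys ! i))"
  using assms by (simp add: list_all_length)

text \<open>The verifier computes without subtraction, so negative parts are moved to the other side
  of each comparison.\<close>

lemma zle_iff: "fst a + snd b * q \<le> snd a + fst b * q \<longleftrightarrow> ival a \<le> ival b * int q"
proof -
  have "fst a + snd b * q \<le> snd a + fst b * q \<longleftrightarrow>
      int (fst a + snd b * q) \<le> int (snd a + fst b * q)" by (simp only: of_nat_le_iff)
  then show ?thesis by (simp add: ival_def algebra_simps)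
qed

lemma nat_vec_inj: "nat_vec u = nat_vec v \<longleftrightarrow> u = v"
proof
  assume eq: "nat_vec u = nat_vec v"
  then have len: "length u = length v" by (metis dim_vec nat_vec_def)
  have "u ! j = v ! j" if "j < length u" for j
    using arg_cong[OF eq, of "\<lambda>x. x $ j"] that len by (simp add: nat_vec_def)
  with len show "u = v" by (intro nth_equalityI)
qed simp

lemma mat_val_nth:
  assumes "mat_ok \<Delta> m n M" "0 < \<Delta>" "i < length m" "j < length n"
  shows "int_entry \<Delta> (mat_val m n M $$ (i, j)) = ival (rat_ent (M ! i ! j))"
proof -
  have "rat_ok \<Delta> (M ! i ! j)" using assms by (auto simp: mat_ok_def list_all_length)
  from rat_ok_props(3)[OF this assms(2)] show ?thesis using assms by (simp add: mat_val_def)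
qed

context
  fixes nx nu ny mx mu my :: "bool list" and R \<Delta> M :: nat
    and va vb :: "rdat list" and mA mW :: "rdat list list" and cB cT :: "rdat list list list"
    and dm da I
  defines "dm \<equiv> (nx, nu, ny, mx, mu, my)" and "da \<equiv> (va, vb, mA, mW, cB, cT)"
    and "I \<equiv> inst_of dm R da"
  assumes ok: "data_ok dm \<Delta> da" and scaled: "scaled_inst \<Delta> M I"
begin

lemma inst_dims:
  "n_x I = length nx" "n_u I = length nu" "n_y I = length ny" "m_x I = length mx" "m_u I = length mu"
  "m_y I = length my" "bound_R I = R"
  by (simp_all add: I_def dm_def da_def inst_of_def)

lemma Delta_pos: "0 < \<Delta>"
  using ok by (simp add: dm_def da_def data_ok_def)

lemma valid: "valid_inst I"
  unfolding I_def by (rule inst_of_valid[OF ok])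

lemma data_lens:
  "length va = length mx" "length vb = length mu" "length mA = length mx" "length mW = length my"
  "length cB = length nx" "length cT = length nu"
  "i < length mx \<Longrightarrow> length (mA ! i) = length nx" "i < length my \<Longrightarrow> length (mW ! i) = length ny"
  "k < length nx \<Longrightarrow> length (cB ! k) = length mu" "k < length nu \<Longrightarrow> length (cT ! k) = length my"
  "k < length nx \<Longrightarrow> i < length mu \<Longrightarrow> length (cB ! k ! i) = length nu"
  "k < length nu \<Longrightarrow> i < length my \<Longrightarrow> length (cT ! k ! i) = length nx"
  using ok by (auto simp: dm_def da_def data_ok_def mat_ok_def list_all_length)

lemma entries:
  "i < length mx \<Longrightarrow> int_entry \<Delta> (vec_a I $ i) = ival (rat_ent (va ! i))"
  "i < length mu \<Longrightarrow> int_entry \<Delta> (vec_b I $ i) = ival (rat_ent (vb ! i))"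
  "i < length mx \<Longrightarrow> j < length nx \<Longrightarrow> row_A I \<Delta> i j = ival (rat_ent (mA ! i ! j))"
  "i < length my \<Longrightarrow> j < length ny \<Longrightarrow> row_W I \<Delta> i j = ival (rat_ent (mW ! i ! j))"
  "i < length mu \<Longrightarrow> k < length nx \<Longrightarrow>
    row_B I \<Delta> u i k = (\<Sum>j<length nu. ival (rat_ent (cB ! k ! i ! j)) * int (u ! j))"
  "i < length my \<Longrightarrow> j < length nx \<Longrightarrow>
    row_T I \<Delta> u i j = (\<Sum>k<length nu. ival (rat_ent (cT ! k ! i ! j)) * int (u ! k))"
proof -
  have a: "list_all (rat_ok \<Delta>) va" "list_all (rat_ok \<Delta>) vb" "mat_ok \<Delta> mx nx mA" "mat_ok \<Delta> my ny mW"
    "list_all (mat_ok \<Delta> mu nu) cB" "list_all (mat_ok \<Delta> my nx) cT"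
    using ok by (simp_all add: dm_def da_def data_ok_def)
  have f: "vec_a I = vec_of_list (map rat_val va)" "vec_b I = vec_of_list (map rat_val vb)"
    "mat_A I = mat_val mx nx mA" "mat_W I = mat_val my ny mW"
    "coeffs_B I = map (mat_val mu nu) cB" "coeffs_T I = map (mat_val my nx) cT"
    by (simp_all add: I_def dm_def da_def inst_of_def)
  show "i < length mx \<Longrightarrow> int_entry \<Delta> (vec_a I $ i) = ival (rat_ent (va ! i))"
    "i < length mu \<Longrightarrow> int_entry \<Delta> (vec_b I $ i) = ival (rat_ent (vb ! i))"
    using a(1,2) rat_ok_props(3)[OF _ Delta_pos] data_lens(1,2)
    by (auto simp: f vec_of_list_index list_all_length)
  show "i < length mx \<Longrightarrow> j < length nx \<Longrightarrow> row_A I \<Delta> i j = ival (rat_ent (mA ! i ! j))"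
    unfolding row_A_def f by (rule mat_val_nth[OF a(3) Delta_pos])
  show "i < length my \<Longrightarrow> j < length ny \<Longrightarrow> row_W I \<Delta> i j = ival (rat_ent (mW ! i ! j))"
    unfolding row_W_def f by (rule mat_val_nth[OF a(4) Delta_pos])
  show "i < length mu \<Longrightarrow> k < length nx \<Longrightarrow>
      row_B I \<Delta> u i k = (\<Sum>j<length nu. ival (rat_ent (cB ! k ! i ! j)) * int (u ! j))"
    unfolding row_B_def f inst_dims using a(5) data_lens(5)
    by (auto simp: list_all_length mat_val_nth[OF _ Delta_pos] intro!: sum.cong)
  show "i < length my \<Longrightarrow> j < length nx \<Longrightarrow>
      row_T I \<Delta> u i j = (\<Sum>k<length nu. ival (rat_ent (cT ! k ! i ! j)) * int (u ! k))"
    unfolding row_T_def f inst_dims using a(6) data_lens(6)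
    by (auto simp: list_all_length mat_val_nth[OF _ Delta_pos] intro!: sum.cong)
qed

lemma x_ok_iff:
  "x_ok dx dm R da qx px \<longleftrightarrow> qx \<noteq> 0 \<and> (dx \<longrightarrow> qx = 1) \<and> length px = length nx \<and> frac_vec qx px \<in> X_c I"
proof -
  have "list_all (\<lambda>p. p \<le> R * qx) px \<and>
     list_all (\<lambda>t. fst (row_dot (fst t) px) + snd (rat_ent (snd t)) * qx \<le>
       snd (row_dot (fst t) px) + fst (rat_ent (snd t)) * qx) (zip mA va) \<longleftrightarrow> frac_vec qx px \<in> X_c I"
    if len: "length px = length nx" and q: "qx \<noteq> 0"
  proof -
    have "ival (row_dot (mA ! i) px) \<le> ival (rat_ent (va ! i)) * int qx \<longleftrightarrow>
        ldot (n_x I) (row_A I \<Delta> i) (\<lambda>j. frac_vec qx px $ j) \<le> of_int (int_entry \<Delta> (vec_a I $ i))"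
      if i: "i < length mx" for i
    proof -
      have "ival (row_dot (mA ! i) px) = (\<Sum>j<n_x I. row_A I \<Delta> i j * int (px ! j))"
        using row_dot_val[of "mA ! i" "length nx" px] len i by (simp add: data_lens entries inst_dims)
      then show ?thesis
        using ldot_frac_le[of px "n_x I" qx "row_A I \<Delta> i" "int_entry \<Delta> (vec_a I $ i)"] len q i
        by (simp add: entries inst_dims)
    qed
    then show ?thesis
      unfolding X_c_iff[OF valid scaled] zle_iff list_all_zip[OF data_lens(3,1)]
      using frac_vec_box[of px "n_x I" qx R] len q by (simp add: inst_dims list_all_length)
  qed
  then show ?thesis unfolding x_ok_def dm_def da_def by auto
qed

lemma u_ok_iff:
  assumes "qx \<noteq> 0" "length px = length nx"
  shows "u_ok dm R da qx px u \<longleftrightarrow> length u = length nu \<and> nat_vec u \<in> U_d I (frac_vec qx px)"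
proof -
  have carr: "frac_vec qx px \<in> carrier_vec (n_x I)" using assms by (simp add: frac_vec_def inst_dims)
  have "list_all (\<lambda>p. p \<le> R) u \<and>
     list_all (\<lambda>t. fst (fst t) + snd (rat_ent (snd t)) * qx \<le> snd (fst t) + fst (rat_ent (snd t)) * qx)
       (zip (lincomb mu px cB u) vb) \<longleftrightarrow> nat_vec u \<in> U_d I (frac_vec qx px)"
    if len: "length u = length nu"
  proof -
    have Ms: "list_all (\<lambda>M. length M = length mu) cB" "length px = length cB"
      using assms data_lens(5,9) by (simp_all add: list_all_length)
    have "ival (lincomb mu px cB u ! i) \<le> ival (rat_ent (vb ! i)) * int qx \<longleftrightarrow>
        ldot (n_x I) (row_B I \<Delta> u i) (\<lambda>j. frac_vec qx px $ j) \<le> of_int (int_entry \<Delta> (vec_b I $ i))"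
      if i: "i < length mu" for i
    proof -
      have "ival (lincomb mu px cB u ! i) = (\<Sum>k<length nx. int (px ! k) * ival (row_dot (cB ! k ! i) u))"
        using lincomb_val(2)[OF Ms i] by (simp add: data_lens)
      also have "\<dots> = (\<Sum>k<n_x I. row_B I \<Delta> u i k * int (px ! k))"
        unfolding inst_dims using i len
        by (intro sum.cong) (simp_all add: entries row_dot_val[of _ "length nu"] data_lens mult.commute)
      finally show ?thesis
        using ldot_frac_le[of px "n_x I" qx "row_B I \<Delta> u i" "int_entry \<Delta> (vec_b I $ i)"] assms i
        by (simp add: entries inst_dims)
    qed
    then have "list_all (\<lambda>p. p \<le> R) u \<and>
     list_all (\<lambda>t. fst (fst t) + snd (rat_ent (snd t)) * qx \<le> snd (fst t) + fst (rat_ent (snd t)) * qx)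
       (zip (lincomb mu px cB u) vb) \<longleftrightarrow> (\<forall>j<n_u I. u ! j \<le> bound_R I) \<and> (\<forall>i<m_u I.
        ldot (n_x I) (row_B I \<Delta> u i) (\<lambda>j. frac_vec qx px $ j) \<le> of_int (int_entry \<Delta> (vec_b I $ i)))"
      unfolding zle_iff list_all_zip[OF lincomb_val(1)[OF Ms] data_lens(2)] using len
      by (simp add: inst_dims list_all_length)
    also have "\<dots> \<longleftrightarrow> nat_vec u \<in> U_d I (frac_vec qx px)"
      unfolding U_d_iff[OF valid scaled carr] nat_vec_inj using len by (auto simp: inst_dims)
    finally show ?thesis .
  qed
  then show ?thesis unfolding u_ok_def dm_def da_def by auto
qed

text \<open>The two terms of the constraint have denominators \<open>qx\<close> and
  \<open>qy\<close>; multiplying by their positive product gives a comparison of integers.\<close>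

lemma y_ok_iff:
  assumes "qx \<noteq> 0" "length px = length nx" "qy \<noteq> 0" "length y = length ny" "list_all (\<lambda>p. p \<le> R * qy) y"
    and u: "length u = length nu"
  shows "y_ok dm da qx px qy u y \<longleftrightarrow> frac_vec qy y \<in> Y_c I (frac_vec qx px) (nat_vec u)"
proof -
  have carr: "frac_vec qx px \<in> carrier_vec (n_x I)" using assms by (simp add: frac_vec_def inst_dims)
  have Ms: "list_all (\<lambda>M. length M = length my) cT" "length u = length cT"
    using u data_lens(6,10) by (simp_all add: list_all_length)
  have "qy * fst (lincomb my u cT px ! i) + qx * fst (row_dot (mW ! i) y) \<le>
       qy * snd (lincomb my u cT px ! i) + qx * snd (row_dot (mW ! i) y) \<longleftrightarrow>
      ldot (n_x I) (row_T I \<Delta> u i) (\<lambda>j. frac_vec qx px $ j) + ldot (n_y I) (row_W I \<Delta> i) (\<lambda>j. frac_vec qy y $ j) \<le> 0"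
    if i: "i < length my" for i
  proof -
    let ?l = "lincomb my u cT px ! i" and ?r = "row_dot (mW ! i) y"
    have "ival ?l = (\<Sum>k<length nu. int (u ! k) * ival (row_dot (cT ! k ! i) px))"
      using lincomb_val(2)[OF Ms i] by (simp add: data_lens)
    also have "\<dots> = (\<Sum>k<length nu. \<Sum>j<length nx. ival (rat_ent (cT ! k ! i ! j)) * int (u ! k) * int (px ! j))"
      using i assms(2)
      by (intro sum.cong) (simp_all add: row_dot_val[of _ "length nx"] data_lens sum_distrib_left mult_ac)
    also have "\<dots> = (\<Sum>j<n_x I. row_T I \<Delta> u i j * int (px ! j))"
      unfolding inst_dims using i
      by (subst sum.swap) (intro sum.cong, simp_all add: entries sum_distrib_right)
    finally have l: "ldot (n_x I) (row_T I \<Delta> u i) (\<lambda>j. frac_vec qx px $ j) = real_of_int (ival ?l) / real qx"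
      using ldot_frac[of px "n_x I" qx "row_T I \<Delta> u i"] assms(1,2) by (simp add: inst_dims)
    have "ival ?r = (\<Sum>j<n_y I. row_W I \<Delta> i j * int (y ! j))"
      using row_dot_val[of "mW ! i" "length ny" y] assms(4) i by (simp add: data_lens entries inst_dims)
    then have r: "ldot (n_y I) (row_W I \<Delta> i) (\<lambda>j. frac_vec qy y $ j) = real_of_int (ival ?r) / real qy"
      using ldot_frac[of y "n_y I" qy "row_W I \<Delta> i"] assms(3,4) by (simp add: inst_dims)
    have "qy * fst ?l + qx * fst ?r \<le> qy * snd ?l + qx * snd ?r \<longleftrightarrow>
        int (qy * fst ?l + qx * fst ?r) \<le> int (qy * snd ?l + qx * snd ?r)" by (simp only: of_nat_le_iff)
    also have "\<dots> \<longleftrightarrow> int qy * ival ?l + int qx * ival ?r \<le> 0"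
      by (simp add: ival_def algebra_simps)
    also have "\<dots> \<longleftrightarrow> real_of_int (int qy * ival ?l + int qx * ival ?r) \<le> 0" by (simp only: of_int_le_0_iff)
    also have "\<dots> \<longleftrightarrow> real_of_int (ival ?l) / real qx + real_of_int (ival ?r) / real qy \<le> 0"
    proof -
      have pos: "0 < real qx * real qy" using assms(1,3) by simp
      have eq: "real_of_int (int qy * ival ?l + int qx * ival ?r) =
          (real_of_int (ival ?l) / real qx + real_of_int (ival ?r) / real qy) * (real qx * real qy)"
        using assms(1,3) by (simp add: field_simps)
      have "a * c \<le> 0 \<longleftrightarrow> a \<le> 0" if "0 < c" for a c :: real
        using that by (auto simp: mult_le_0_iff)
      then show ?thesis unfolding eq by this (rule pos)
    qed
    finally show ?thesis unfolding l r .
  qed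
  then show ?thesis
    unfolding y_ok_def dm_def da_def prod.case list_all_zip[OF lincomb_val(1)[OF Ms] data_lens(4)]
      Y_c_iff[OF valid scaled carr u[folded inst_dims]]
    using frac_vec_box[of y "n_y I" qy R] assms(3-5) by (simp add: inst_dims list_all_length)
qed

end

type_synonym cert = "dims \<times> (nat \<times> nat) \<times> data \<times> (nat \<times> nat list \<times> nat \<times> nat list list)"

text \<open>The certificate itself determines the number of recourse vectors, and \<open>g\<close>
  checks that it is \<open>K\<close>. Together with the first two conjuncts this answer is used only
  on encodings of valid instances, where \<open>g\<close> is the graph of \<open>K\<close>. Only the
  last conjunct depends on the scenario.\<close>

definition verify :: "bool \<Rightarrow> bool \<Rightarrow> (bool list \<Rightarrow> bool list \<Rightarrow> bool) \<Rightarrow> bool list \<Rightarrow> cert \<Rightarrow> nat list \<Rightarrow> bool" where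
  "verify dx dy g w = (\<lambda>(dm, (R, \<Delta>), da, (qx, px, qy, py)) u.
     data_ok dm \<Delta> da \<and> inst_bits dm R da = w \<and> g w (enc_nat (length py)) \<and>
     x_ok dx dm R da qx px \<and> ys_ok dy dm R qy py \<and>
     (u_ok dm R da qx px u \<longrightarrow> list_ex (y_ok dm da qx px qy u) py))"

lemma PT_verify:
  assumes "PT (\<lambda>t. g (fst t) (snd t))"
  shows "PT (\<lambda>t. verify dx dy g (fst t) (fst (snd t)) (snd (snd t)))"
proof -
  have "PT (\<lambda>t :: bool list \<times> cert \<times> nat list. (\<lambda>t. g (fst t) (snd t))
     (fst t, enc_nat (length (snd (snd (snd (snd (snd (snd (fst (snd t)))))))))))"
    by (rule PT_compose[OF assms]) (intro PT_intros)
  then have g: "PT (\<lambda>t :: bool list \<times> cert \<times> nat list.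
     g (fst t) (enc_nat (length (snd (snd (snd (snd (snd (snd (fst (snd t)))))))))))" by simp
  show ?thesis
    unfolding verify_def data_ok_def inst_bits_def dim_bits_def x_ok_def ys_ok_def u_ok_def y_ok_def case_prod_beta
    by (intro PT_intros PT_mat_ok PT_enc_list g)
qed


section \<open>Soundness\<close>

lemma length_enc_list: "length (enc_list e xs) = Suc (\<Sum>x\<leftarrow>xs. Suc (length (e x)))"
  by (induction xs) auto

lemma length_enc_nat: "length (enc_nat n) = 2 * bl n + 1"
  by (simp add: enc_nat_def enc_string_def length_enc_list bl_def sum_list_triv)

lemma inst_dims_le:
  "n_x I \<le> length (enc_inst I)" "n_u I \<le> length (enc_inst I)" "n_y I \<le> length (enc_inst I)"
  "m_x I \<le> length (enc_inst I)" "m_u I \<le> length (enc_inst I)" "m_y I \<le> length (enc_inst I)"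
  "bl (bound_R I) \<le> length (enc_inst I)"
  by (simp_all add: enc_inst_def enc_dim_def length_enc_nat)

lemma verify_sound:
  assumes g: "\<And>I v. valid_inst I \<Longrightarrow> g (enc_inst I) v \<longleftrightarrow> v = enc_nat (K I)"
    and V: "\<And>u :: nat list. sz u \<le> 1 + length w * (8 + 6 * length w) \<Longrightarrow> verify dx dy g w D u"
  shows "\<exists>I. w = enc_inst I \<and> valid_inst I \<and>
    K_adaptable (K I) (n_y I) (if dx then X_d I else X_c I) (U_d I) (if dy then Y_d I else Y_c I)"
proof -
  obtain dm R \<Delta> da qx px qy py where D: "D = (dm, (R, \<Delta>), da, (qx, px, qy, py))" by (metis surj_pair)
  obtain nx nu ny mx mu my where dm: "dm = (nx, nu, ny, mx, mu, my)" by (metis surj_pair)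
  obtain va vb mA mW cB cT where da: "da = (va, vb, mA, mW, cB, cT)" by (metis surj_pair)
  define I where "I = inst_of dm R da"
  \<comment> \<open>One trial scenario, the empty list, is enough to obtain all conjuncts that do
    not mention the scenario.\<close>
  have "verify dx dy g w D []" by (rule V) simp
  then have ok: "data_ok dm \<Delta> da" and w: "inst_bits dm R da = w" and gk: "g w (enc_nat (length py))"
    and x: "x_ok dx dm R da qx px" and ys: "ys_ok dy dm R qy py"
    by (simp_all add: verify_def D)
  have "\<exists>M. \<forall>r\<in>set (data_rats da). \<bar>ival (rat_ent r)\<bar> \<le> int M" by (rule finite_int_bound) simp
  then obtain M where "\<And>r. r \<in> set (data_rats da) \<Longrightarrow> \<bar>ival (rat_ent r)\<bar> \<le> int M" by blast
  then have sc: "scaled_inst \<Delta> M I" unfolding I_def by (rule scaled_inst_of[OF ok])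
  have valid: "valid_inst I" unfolding I_def by (rule inst_of_valid[OF ok])
  have enc: "w = enc_inst I" unfolding I_def inst_of_bits[OF ok] w ..
  have "enc_nat (length py) = enc_nat (K I)" using g[OF valid] gk enc by blast
  then have K: "length py = K I"
    using prefix_freeD[OF prefix_free_enc_nat, of _ "[]" _ "[]"] by simp
  have dims: "n_x I = length nx" "n_u I = length nu" "n_y I = length ny" "bound_R I = R"
    by (simp_all add: I_def dm da inst_of_def)
  note ctx = ok[unfolded dm da] sc[unfolded I_def dm da]
  let ?x = "frac_vec qx px"
  have x': "qx \<noteq> 0" "dx \<Longrightarrow> qx = 1" "length px = length nx" "?x \<in> X_c I"
    using x x_ok_iff[OF ctx] by (auto simp: I_def dm da)
  have y': "qy \<noteq> 0" "dy \<Longrightarrow> qy = 1" "\<And>y. y \<in> set py \<Longrightarrow> length y = length ny \<and> list_all (\<lambda>p. p \<le> R * qy) y"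
    using ys by (auto simp: ys_ok_def dm list_all_iff)
  have u_iff: "u_ok dm R da qx px u \<longleftrightarrow> length u = length nu \<and> nat_vec u \<in> U_d I ?x" for u
    unfolding I_def dm da by (rule u_ok_iff[OF ctx x'(1,3)])
  have y_iff: "y_ok dm da qx px qy u y \<longleftrightarrow> frac_vec qy y \<in> Y_c I ?x (nat_vec u)"
    if "length y = length ny" "list_all (\<lambda>p. p \<le> R * qy) y" "length u = length nu" for y u
    unfolding I_def dm da by (rule y_ok_iff[OF ctx x'(1,3) y'(1) that])
  have int1: "frac_vec 1 p \<in> int_vecs" for p by (simp add: frac_vec_def int_vecs_def)
  have "?x \<in> (if dx then X_d I else X_c I)" using x'(2,4) int1 by (auto simp: X_d_def)
  moreover have "set (map (frac_vec qy) py) \<inter> (if dy then Y_d I else Y_c I) ?x v \<noteq> {}" if v: "v \<in> U_d I ?x" for v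
  proof -
    have "?x \<in> carrier_vec (n_x I)" using x'(3) by (simp add: frac_vec_def dims)
    from v[unfolded U_d_iff[OF valid sc this]] obtain u where u: "v = nat_vec u" "length u = n_u I"
      "\<And>j. j < n_u I \<Longrightarrow> u ! j \<le> bound_R I" by blast
    \<comment> \<open>The origin of the length bound for the universal word: there are at most
      \<open>length w\<close> coordinates, and none has more digits than \<open>bound_R I\<close>,
      which is itself written in \<open>w\<close>.\<close>
    have "sz u \<le> 1 + length w * (1 + (1 + 6 * length w))"
    proof (rule sz_list_le)
      show "length u \<le> length w" using u(2) inst_dims_le(2)[of I] by (simp add: enc)
      fix p assume "p \<in> set u"
      then have "p \<le> bound_R I" using u(2,3) by (auto simp: in_set_conv_nth)
      then have "bl p \<le> length w" using bl_mono[of p "bound_R I"] inst_dims_le(7)[of I] by (simp add: enc)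
      then show "sz p \<le> 1 + 6 * length w" by (simp add: sz_nat)
    qed
    then have "sz u \<le> 1 + length w * (8 + 6 * length w)"
      by (rule le_trans) (simp add: algebra_simps)
    from V[OF this] have "u_ok dm R da qx px u \<longrightarrow> list_ex (y_ok dm da qx px qy u) py"
      by (simp add: verify_def D)
    moreover have "u_ok dm R da qx px u"
      unfolding u_iff using v u dims by simp
    ultimately obtain y where y: "y \<in> set py" "y_ok dm da qx px qy u y" by (auto simp: list_ex_iff)
    have "frac_vec qy y \<in> Y_c I ?x v"
      using y_iff[of y u] y'(3)[OF y(1)] y(2) u(1,2) dims by simp
    then have "frac_vec qy y \<in> (if dy then Y_d I else Y_c I) ?x v"
      using y'(2) int1 by (auto simp: Y_d_def)
    then show ?thesis using y(1) by auto
  qed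
  ultimately have "K_adaptable (K I) (n_y I) (if dx then X_d I else X_c I) (U_d I) (if dy then Y_d I else Y_c I)"
    unfolding K_adaptable_def using K y'(3)
    by (intro bexI[of _ ?x] exI[of _ "map (frac_vec qy) py"]) (auto simp: frac_vec_def dims)
  with valid enc show ?thesis by blast
qed


section \<open>Completeness\<close>

text \<open>The coefficients go into the certificate and must be short, so one of them is reduced
  modulo \<open>n\<close>, which bounds the other as well. For \<open>n\<close> at most 1 no
  remainder 1 exists, hence the separate case.\<close>

lemma bezout_small:
  fixes n d :: nat
  assumes "coprime n d" "0 < d"
  shows "\<exists>a b. b * d = a * n + 1 \<and> a \<le> d \<and> b \<le> n + 1"
proof (cases "n \<le> 1")
  case True
  then consider "n = 0" | "n = 1" by linarith
  then show ?thesis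
  proof cases
    case 1
    then have "d = 1" using assms by simp
    then show ?thesis using 1 by (intro exI[of _ 0] exI[of _ 1]) simp
  next
    case 2
    then show ?thesis using assms by (intro exI[of _ "d - 1"] exI[of _ 1]) simp
  qed
next
  case False
  then have n: "1 < n" by simp
  have "coprime d n" using assms(1) by (simp add: coprime_commute)
  then obtain x y where eq: "d * x = n * y + 1"
    using bezout_nat[of d n] assms(2) by (auto simp: coprime_iff_gcd_eq_1)
  define b where "b = x mod n"
  have "(b * d) mod n = (d * x) mod n" by (simp add: b_def mod_mult_right_eq mult.commute[of _ d])
  also have "\<dots> = (1 + n * y) mod n" by (simp only: eq add.commute)
  also have "\<dots> = 1" unfolding mod_mult_self2 using n by simp
  finally have "b * d = (b * d div n) * n + 1" by (metis div_mult_mod_eq)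
  moreover have "b * d div n \<le> d"
  proof -
    have "b * d \<le> n * d" using n by (intro mult_le_mono1) (simp add: b_def less_imp_le)
    then have "b * d div n \<le> n * d div n" by (rule div_le_mono)
    then show ?thesis using n by simp
  qed
  moreover have "b < n" using n by (simp add: b_def)
  then have "b \<le> n + 1" by simp
  ultimately show ?thesis by blast
qed

section \<open>The tabular form of a given instance\<close>

definition den :: "rat \<Rightarrow> nat" where
  "den r = nat (snd (quotient_of r))"

definition num :: "rat \<Rightarrow> nat" where
  "num r = nat \<bar>fst (quotient_of r)\<bar>"

lemma quotient_of_props:
  "0 < den r" "coprime (num r) (den r)"
  "r = (if r < 0 then - of_nat (num r) else of_nat (num r)) / of_nat (den r)"
  "r < 0 \<Longrightarrow> num r \<noteq> 0"
proof -
  obtain p q where pq: "quotient_of r = (p, q)" by fastforce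
  have q: "0 < q" using quotient_of_denom_pos[OF pq] .
  have cop: "coprime p q" using quotient_of_coprime[OF pq] .
  have r: "r = of_int p / of_int q" by (rule quotient_of_div[OF pq])
  have neg: "r < 0 \<longleftrightarrow> p < 0" unfolding r using q by (simp add: divide_less_0_iff)
  show "0 < den r" using q by (simp add: den_def pq)
  show "coprime (num r) (den r)"
    using cop q by (simp add: num_def den_def pq coprime_int_iff[symmetric])
  show "r < 0 \<Longrightarrow> num r \<noteq> 0" using neg by (simp add: num_def pq)
  have "of_nat (den r) = (of_int q :: rat)" using q by (simp add: den_def pq)
  moreover have "(if r < 0 then - of_nat (num r) else of_nat (num r)) = (of_int p :: rat)"
    unfolding neg by (simp add: num_def pq)
  ultimately show "r = (if r < 0 then - of_nat (num r) else of_nat (num r)) / of_nat (den r)"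
    using r by simp
qed

definition bez :: "rat \<Rightarrow> nat \<times> nat" where
  "bez r = (SOME z. snd z * den r = fst z * num r + 1 \<and> fst z \<le> den r \<and> snd z \<le> num r + 1)"

lemma bez: "snd (bez r) * den r = fst (bez r) * num r + 1" "fst (bez r) \<le> den r" "snd (bez r) \<le> num r + 1"
proof -
  have "\<exists>z. snd z * den r = fst z * num r + 1 \<and> fst z \<le> den r \<and> snd z \<le> num r + 1"
    using bezout_small[OF quotient_of_props(2,1)[of r]] by auto
  from someI_ex[OF this]
  show "snd (bez r) * den r = fst (bez r) * num r + 1" "fst (bez r) \<le> den r" "snd (bez r) \<le> num r + 1"
    unfolding bez_def by blast+
qed

definition rdat_of :: "nat \<Rightarrow> rat \<Rightarrow> rdat" where
  "rdat_of \<Delta> r = (r < 0, num r, den r, fst (bez r), snd (bez r), \<Delta> div den r)"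

lemma rat_ok_of: "den r dvd \<Delta> \<Longrightarrow> rat_ok \<Delta> (rdat_of \<Delta> r)"
  using bez(1)[of r] quotient_of_props(4)[of r] by (auto simp: rat_ok_def rdat_of_def)

lemma rat_val_of [simp]: "rat_val (rdat_of \<Delta> r) = r"
  using quotient_of_props(3)[of r] by (simp add: rat_val_def rdat_of_def)

lemma bl_num_den: "bl (num r) + bl (den r) + 2 \<le> length (enc_rat r)"
  by (simp add: enc_rat_def enc_int_def length_enc_nat num_def den_def)
    (cases "quotient_of r", simp add: quotient_of_denom_pos less_imp_le)

definition vec_dat :: "nat \<Rightarrow> rat vec \<Rightarrow> rdat list" where
  "vec_dat \<Delta> v = map (rdat_of \<Delta>) (list_of_vec v)"

definition mat_dat :: "nat \<Rightarrow> rat mat \<Rightarrow> rdat list list" where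
  "mat_dat \<Delta> A = map (vec_dat \<Delta>) (rows A)"

definition unary :: "nat \<Rightarrow> bool list" where
  "unary n = replicate n True"

lemma length_unary [simp]: "length (unary n) = n"
  by (simp add: unary_def)

definition mat_rats :: "rat mat \<Rightarrow> rat list" where
  "mat_rats A = concat (map list_of_vec (rows A))"

definition inst_rats :: "adapt_inst \<Rightarrow> rat list" where
  "inst_rats I = list_of_vec (vec_a I) @ list_of_vec (vec_b I) @ mat_rats (mat_A I) @ mat_rats (mat_W I) @
     concat (map mat_rats (coeffs_B I)) @ concat (map mat_rats (coeffs_T I))"

lemma sum_list_enc_list: "(\<Sum>x\<leftarrow>xs. length (e x)) \<le> length (enc_list e xs)"
  unfolding length_enc_list by (induction xs) auto

lemma sum_list_concat_le:
  fixes f :: "'a \<Rightarrow> nat"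
  assumes "\<And>x. x \<in> set xs \<Longrightarrow> (\<Sum>y\<leftarrow>h x. f y) \<le> length (e x)"
  shows "(\<Sum>y\<leftarrow>concat (map h xs). f y) \<le> length (enc_list e xs)"
proof -
  have "(\<Sum>y\<leftarrow>concat (map h xs). f y) \<le> (\<Sum>x\<leftarrow>xs. length (e x))"
    using assms by (induction xs) (auto intro: add_mono)
  then show ?thesis using sum_list_enc_list[of e xs] by linarith
qed

lemma sum_inst_rats: "(\<Sum>r\<leftarrow>inst_rats I. length (enc_rat r)) \<le> length (enc_inst I)"
proof -
  have v: "(\<Sum>r\<leftarrow>list_of_vec v. length (enc_rat r)) \<le> length (enc_vec v)" for v
    unfolding enc_vec_def by (rule sum_list_enc_list)
  have m: "(\<Sum>r\<leftarrow>mat_rats A. length (enc_rat r)) \<le> length (enc_mat A)" for A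
    unfolding mat_rats_def enc_mat_def by (rule sum_list_concat_le) (rule v)
  have ms: "(\<Sum>r\<leftarrow>concat (map mat_rats As). length (enc_rat r)) \<le> length (enc_list enc_mat As)" for As
    by (rule sum_list_concat_le) (rule m)
  show ?thesis unfolding inst_rats_def enc_inst_def
    using v[of "vec_a I"] v[of "vec_b I"] m[of "mat_A I"] m[of "mat_W I"] ms[of "coeffs_B I"] ms[of "coeffs_T I"]
    by simp
qed

text \<open>The plain product of the denominators: bit lengths add up under multiplication, and
  their sum is bounded by the length of the encoding.\<close>

definition common_den :: "adapt_inst \<Rightarrow> nat" where
  "common_den I = prod_list (map den (inst_rats I))"

lemma common_den_pos: "0 < common_den I"
proof -
  have "0 < prod_list (map den rs)" for rs
    using quotient_of_props(1) by (induction rs) simp_all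
  then show ?thesis by (simp add: common_den_def)
qed

lemma den_dvd: "r \<in> set (inst_rats I) \<Longrightarrow> den r dvd common_den I"
  unfolding common_den_def by (rule prod_list_dvd) simp

lemma bl_common_den: "bl (common_den I) \<le> length (enc_inst I) + 1"
proof -
  have "bl (prod_list (map den rs)) \<le> (\<Sum>r\<leftarrow>rs. length (enc_rat r)) + 1" for rs
  proof (induction rs)
    case Nil
    show ?case by (simp add: bl_le_iff)
  next
    case (Cons r rs)
    then show ?case using bl_mult[of "den r" "prod_list (map den rs)"] bl_num_den[of r] by simp
  qed
  from this[of "inst_rats I"] show ?thesis using sum_inst_rats[of I] by (simp add: common_den_def)
qed

lemma bl_inst_rats:
  assumes "r \<in> set (inst_rats I)"
  shows "bl (num r) \<le> length (enc_inst I)" "bl (den r) \<le> length (enc_inst I)"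
proof -
  have "length (enc_rat r) \<le> (\<Sum>r\<leftarrow>inst_rats I. length (enc_rat r))"
    using assms by (intro member_le_sum_list) auto
  then have "length (enc_rat r) \<le> length (enc_inst I)" using sum_inst_rats[of I] by linarith
  then show "bl (num r) \<le> length (enc_inst I)" "bl (den r) \<le> length (enc_inst I)"
    using bl_num_den[of r] by simp_all
qed

definition inst_dm :: "adapt_inst \<Rightarrow> dims" where
  "inst_dm I = (unary (n_x I), unary (n_u I), unary (n_y I), unary (m_x I), unary (m_u I), unary (m_y I))"

definition inst_da :: "adapt_inst \<Rightarrow> data" where
  "inst_da I = (let \<Delta> = common_den I in (vec_dat \<Delta> (vec_a I), vec_dat \<Delta> (vec_b I), mat_dat \<Delta> (mat_A I), mat_dat \<Delta> (mat_W I),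
     map (mat_dat \<Delta>) (coeffs_B I), map (mat_dat \<Delta>) (coeffs_T I)))"

lemma data_rats_inst: "data_rats (inst_da I) = map (rdat_of (common_den I)) (inst_rats I)"
proof -
  have m: "concat (mat_dat \<Delta> A) = map (rdat_of \<Delta>) (mat_rats A)" for \<Delta> A
    by (simp add: mat_dat_def mat_rats_def vec_dat_def[abs_def] map_concat comp_def)
  have "concat (concat (map (mat_dat \<Delta>) As)) = map (rdat_of \<Delta>) (concat (map mat_rats As))" for \<Delta> As
    by (induction As) (simp_all add: m)
  then show ?thesis by (simp add: data_rats_def inst_da_def Let_def inst_rats_def m vec_dat_def)
qed

lemma mat_val_dat:
  assumes "A \<in> carrier_mat m n"
  shows "mat_val (unary m) (unary n) (mat_dat \<Delta> A) = A"
  using assms by (intro eq_matI) (auto simp: mat_val_def mat_dat_def vec_dat_def list_of_vec_index)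

lemma inst_of_inst:
  assumes "valid_inst I"
  shows "inst_of (inst_dm I) (bound_R I) (inst_da I) = I"
proof -
  have v: "vec_of_list (map rat_val (vec_dat \<Delta> v)) = v" for \<Delta> v
    by (simp add: vec_dat_def comp_def vec_list del: vec_of_list_map)
  have ms: "map (mat_val (unary m) (unary n)) (map (mat_dat \<Delta>) As) = As" if "set As \<subseteq> carrier_mat m n" for m n \<Delta> As
    using that by (auto simp: mat_val_dat intro!: map_idI)
  show ?thesis
    using assms unfolding valid_inst_def inst_of_def inst_dm_def inst_da_def Let_def
    by (simp add: v ms mat_val_dat del: vec_of_list_map map_map)
qed

lemma data_ok_inst:
  assumes "valid_inst I"
  shows "data_ok (inst_dm I) (common_den I) (inst_da I)"
proof -
  let ?\<Delta> = "common_den I"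
  have v: "list_all (rat_ok ?\<Delta>) (vec_dat ?\<Delta> v)" if "set (list_of_vec v) \<subseteq> set (inst_rats I)" for v
    using that by (auto simp: vec_dat_def list_all_iff intro!: rat_ok_of den_dvd)
  have m: "mat_ok ?\<Delta> (unary m) (unary n) (mat_dat ?\<Delta> A)"
    if "A \<in> carrier_mat m n" "set (mat_rats A) \<subseteq> set (inst_rats I)" for m n A
    unfolding mat_ok_def
  proof
    show "length (mat_dat ?\<Delta> A) = length (unary m)" using that(1) by (simp add: mat_dat_def)
    show "list_all (\<lambda>r. length r = length (unary n) \<and> list_all (rat_ok ?\<Delta>) r) (mat_dat ?\<Delta> A)"
      unfolding list_all_iff[of _ "mat_dat ?\<Delta> A"]
    proof
      fix r assume "r \<in> set (mat_dat ?\<Delta> A)"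
      then obtain x where x: "x \<in> set (rows A)" "r = vec_dat ?\<Delta> x" by (auto simp: mat_dat_def)
      have "set (list_of_vec x) \<subseteq> set (inst_rats I)" using x(1) that(2) by (auto simp: mat_rats_def)
      moreover have "dim_vec x = n" using x(1) that(1) by (auto simp: rows_def)
      ultimately show "length r = length (unary n) \<and> list_all (rat_ok ?\<Delta>) r"
        using v[of x] by (simp add: x(2)) (simp add: vec_dat_def)
    qed
  qed
  have ms: "list_all (mat_ok ?\<Delta> (unary m) (unary n)) (map (mat_dat ?\<Delta>) As)"
    if "set As \<subseteq> carrier_mat m n" "set (concat (map mat_rats As)) \<subseteq> set (inst_rats I)" for m n As
    unfolding list_all_iff set_map using that by (auto intro!: m)
  have sub: "set (list_of_vec (vec_a I)) \<subseteq> set (inst_rats I)" "set (list_of_vec (vec_b I)) \<subseteq> set (inst_rats I)"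
    "set (mat_rats (mat_A I)) \<subseteq> set (inst_rats I)" "set (mat_rats (mat_W I)) \<subseteq> set (inst_rats I)"
    "set (concat (map mat_rats (coeffs_B I))) \<subseteq> set (inst_rats I)"
    "set (concat (map mat_rats (coeffs_T I))) \<subseteq> set (inst_rats I)"
    by (auto simp: inst_rats_def)
  have len: "length (vec_dat ?\<Delta> v) = dim_vec v" for v by (simp add: vec_dat_def)
  show ?thesis
    using assms v[OF sub(1)] v[OF sub(2)] m[OF _ sub(3)] m[OF _ sub(4)] ms[OF _ sub(5)] ms[OF _ sub(6)] common_den_pos[of I]
    unfolding valid_inst_def data_ok_def inst_dm_def inst_da_def Let_def by (simp add: len)
qed


section \<open>Size of the certificate\<close>

lemma bl_Suc: "bl (Suc n) \<le> bl n + 1"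
  using less_2_bl[of n] by (simp add: bl_le_iff)

lemma bl_fact: "bl (fact d) \<le> d * d + 1"
proof -
  have "bl (fact d) \<le> bl (d ^ d)" using fact_le_power[of d, where ?'a = nat] by (intro bl_mono) simp
  also have "\<dots> \<le> d * bl d + 1" by (rule bl_power)
  also have "\<dots> \<le> d * d + 1" using bl_le_self[of d] by simp
  finally show ?thesis .
qed

text \<open>The bit length of \<open>witness_bound\<close>, summand by summand: the factorial, the
  power with a base of at most \<open>9 * n + 12\<close> bits, the box bound, and one carry. The
  number \<open>K\<close> enters through the dimension \<open>d\<close>, and only its polynomial
  bound keeps the result polynomial.\<close>

definition entry_bits :: "nat poly \<Rightarrow> nat \<Rightarrow> nat" where
  "entry_bits p n = (let d = Suc (n + poly p n * n) in (d * d + 1) + (d * (9 * n + 12) + 1) + n + 1)"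

lemma bl_witness_bound:
  fixes N :: nat
  assumes "n_x I \<le> N" "n_y I \<le> N" "n_u I \<le> N" "bl (bound_R I) \<le> N" "K \<le> poly p N" "bl M \<le> 2 * N + 3"
  shows "bl (witness_bound I M K) \<le> entry_bits p N"
proof -
  define d where "d = Suc (n_x I + K * n_y I)"
  define d' where "d' = Suc (N + poly p N * N)"
  define C where "C = Suc (M + bound_R I + n_u I * (M * bound_R I))"
  have dd: "d \<le> d'" unfolding d_def d'_def using assms by (simp add: add_mono mult_le_mono)
  have "bl (n_u I * (M * bound_R I)) \<le> bl (n_u I) + (bl M + bl (bound_R I))"
    using bl_mult[of "n_u I" "M * bound_R I"] bl_mult[of M "bound_R I"] by linarith
  moreover have "bl (n_u I) \<le> N" using bl_le_self[of "n_u I"] assms(3) by linarith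
  moreover have "bl C \<le> bl (M + bound_R I + n_u I * (M * bound_R I)) + 1" unfolding C_def by (rule bl_Suc)
  moreover have "bl (M + bound_R I + n_u I * (M * bound_R I)) \<le> bl M + bl (bound_R I) + 1 + bl (n_u I * (M * bound_R I)) + 1"
    using bl_add[of "M + bound_R I" "n_u I * (M * bound_R I)"] bl_add[of M "bound_R I"] by linarith
  ultimately have C: "bl C \<le> 9 * N + 12" using assms by linarith
  have "bl (C ^ d) \<le> d * bl C + 1" by (rule bl_power)
  also have "\<dots> \<le> d' * (9 * N + 12) + 1" using dd C by (simp add: mult_le_mono)
  finally have "bl (C ^ d) \<le> d' * (9 * N + 12) + 1" .
  moreover have "bl (fact d) \<le> d' * d' + 1" using bl_fact[of d] mult_le_mono[OF dd dd] by linarith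
  moreover have eq: "witness_bound I M K = fact d * C ^ d + bound_R I"
    by (simp only: witness_bound_def Let_def d_def C_def)
  moreover have "bl (fact d * C ^ d + bound_R I) \<le> bl (fact d) + bl (C ^ d) + bl (bound_R I) + 1"
    using bl_add[of "fact d * C ^ d" "bound_R I"] bl_mult[of "fact d" "C ^ d"] by linarith
  ultimately have "bl (witness_bound I M K) \<le> (d' * d' + 1) + (d' * (9 * N + 12) + 1) + N + 1"
    unfolding eq using assms(4) by linarith
  then show ?thesis by (simp add: entry_bits_def Let_def d'_def)
qed

text \<open>Here \<open>s1\<close> bounds one rational with its auxiliary numbers, \<open>s2\<close>
  a vector, \<open>s3\<close> a matrix and \<open>s4\<close> a list of matrices, while
  \<open>e\<close> and \<open>l\<close> bound one entry and one vector of the solution. The final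
  sum follows the components of \<open>cert\<close>: dimensions, the pair of box bound and common
  denominator, data, solution.\<close>

definition cert_size :: "nat poly \<Rightarrow> nat \<Rightarrow> nat" where
  "cert_size p n = (let s1 = 40 + 40 * n; s2 = 1 + n * (1 + s1); s3 = 1 + n * (1 + s2); s4 = 1 + n * (1 + s3);
     e = 1 + 6 * entry_bits p n; l = 1 + n * (1 + e) in
     3 + (5 + 6 * (1 + 6 * n)) + (1 + (1 + 6 * n) + (7 + 6 * n)) + (5 + 2 * s2 + 2 * s3 + 2 * s4) +
     (3 + 2 * e + l + (1 + poly p n * (1 + l))))"

lemma poly_bounded_cert_size: "poly_bounded (cert_size p)"
  unfolding cert_size_def entry_bits_def Let_def by (intro pb_intros)

lemma sz_unary: "sz (unary n) = 1 + 6 * n"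
  by (simp add: sz_bool_list)

lemma sz_inst_da:
  fixes N :: nat
  assumes "valid_inst I" "length (enc_inst I) = N"
  defines "s1 \<equiv> 40 + 40 * N"
  defines "s2 \<equiv> 1 + N * (1 + s1)"
  defines "s3 \<equiv> 1 + N * (1 + s2)"
  defines "s4 \<equiv> 1 + N * (1 + s3)"
  shows "sz (inst_da I) \<le> 5 + 2 * s2 + 2 * s3 + 2 * s4"
proof -
  let ?\<Delta> = "common_den I"
  have le: "n_x I \<le> N" "n_u I \<le> N" "n_y I \<le> N" "m_x I \<le> N" "m_u I \<le> N" "m_y I \<le> N"
    using inst_dims_le[of I] assms(2) by auto
  have r: "sz (rdat_of ?\<Delta> r) \<le> s1" if "r \<in> set (inst_rats I)" for r
  proof -
    have n: "bl (num r) \<le> N" "bl (den r) \<le> N" using bl_inst_rats[OF that] assms(2) by auto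
    have "bl (fst (bez r)) \<le> N" using bl_mono[OF bez(2)[of r]] n by linarith
    moreover have "bl (snd (bez r)) \<le> N + 1"
      using bl_mono[OF bez(3)[of r]] bl_Suc[of "num r"] n by simp
    moreover have "bl (?\<Delta> div den r) \<le> N + 1"
      using bl_mono[of "?\<Delta> div den r" ?\<Delta>] bl_common_den[of I] assms(2) by simp
    ultimately show ?thesis using n by (simp add: rdat_of_def sz_nat s1_def)
  qed
  have v: "sz (vec_dat ?\<Delta> v) \<le> s2" if "set (list_of_vec v) \<subseteq> set (inst_rats I)" "dim_vec v \<le> N" for v
    unfolding s2_def using that r by (intro sz_list_le) (auto simp: vec_dat_def)
  have m: "sz (mat_dat ?\<Delta> A) \<le> s3"
    if "A \<in> carrier_mat m n" "m \<le> N" "n \<le> N" "set (mat_rats A) \<subseteq> set (inst_rats I)" for A m n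
    unfolding s3_def
  proof (rule sz_list_le)
    show "length (mat_dat ?\<Delta> A) \<le> N" using that by (simp add: mat_dat_def)
    fix x assume "x \<in> set (mat_dat ?\<Delta> A)"
    then obtain y where y: "y \<in> set (rows A)" "x = vec_dat ?\<Delta> y" by (auto simp: mat_dat_def)
    have "set (list_of_vec y) \<subseteq> set (inst_rats I)" using y(1) that(4) by (auto simp: mat_rats_def)
    moreover have "dim_vec y \<le> N" using y(1) that(1,3) by (auto simp: rows_def)
    ultimately show "sz x \<le> s2" unfolding y(2) by (rule v)
  qed
  have ms: "sz (map (mat_dat ?\<Delta>) As) \<le> s4"
    if "set As \<subseteq> carrier_mat m n" "m \<le> N" "n \<le> N" "length As \<le> N" "set (concat (map mat_rats As)) \<subseteq> set (inst_rats I)" for As m n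
    unfolding s4_def
  proof (rule sz_list_le)
    show "length (map (mat_dat ?\<Delta>) As) \<le> N" using that by simp
    fix x assume "x \<in> set (map (mat_dat ?\<Delta>) As)"
    then obtain A where A: "A \<in> set As" "x = mat_dat ?\<Delta> A" by auto
    show "sz x \<le> s3" unfolding A(2) using A(1) that by (intro m[of A m n]) auto
  qed
  have V: "vec_a I \<in> carrier_vec (m_x I)" "vec_b I \<in> carrier_vec (m_u I)"
     "mat_A I \<in> carrier_mat (m_x I) (n_x I)" "mat_W I \<in> carrier_mat (m_y I) (n_y I)"
     "length (coeffs_B I) = n_x I" "set (coeffs_B I) \<subseteq> carrier_mat (m_u I) (n_u I)"
     "length (coeffs_T I) = n_u I" "set (coeffs_T I) \<subseteq> carrier_mat (m_y I) (n_x I)"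
    using assms(1) unfolding valid_inst_def by blast+
  have sub: "set (list_of_vec (vec_a I)) \<subseteq> set (inst_rats I)" "set (list_of_vec (vec_b I)) \<subseteq> set (inst_rats I)"
    "set (mat_rats (mat_A I)) \<subseteq> set (inst_rats I)" "set (mat_rats (mat_W I)) \<subseteq> set (inst_rats I)"
    "set (concat (map mat_rats (coeffs_B I))) \<subseteq> set (inst_rats I)"
    "set (concat (map mat_rats (coeffs_T I))) \<subseteq> set (inst_rats I)"
    by (auto simp: inst_rats_def)
  have "sz (vec_dat ?\<Delta> (vec_a I)) \<le> s2" "sz (vec_dat ?\<Delta> (vec_b I)) \<le> s2"
    using V(1,2) le by (auto intro!: v sub)
  moreover have "sz (mat_dat ?\<Delta> (mat_A I)) \<le> s3" by (rule m[OF V(3) le(4,1) sub(3)])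
  moreover have "sz (mat_dat ?\<Delta> (mat_W I)) \<le> s3" by (rule m[OF V(4) le(6,3) sub(4)])
  moreover have "sz (map (mat_dat ?\<Delta>) (coeffs_B I)) \<le> s4"
    by (rule ms[OF V(6) le(5,2) _ sub(5)]) (simp add: V(5) le)
  moreover have "sz (map (mat_dat ?\<Delta>) (coeffs_T I)) \<le> s4"
    by (rule ms[OF V(8) le(6,1) _ sub(6)]) (simp add: V(7) le)
  ultimately show ?thesis by (simp add: inst_da_def Let_def)
qed

lemma verify_complete:
  assumes g: "\<And>I v. valid_inst I \<Longrightarrow> g (enc_inst I) v \<longleftrightarrow> v = enc_nat (K I)"
    and I: "valid_inst I" and K: "K I \<le> poly p (length (enc_inst I))"
    and adapt: "K_adaptable (K I) (n_y I) (if dx then X_d I else X_c I) (U_d I) (if dy then Y_d I else Y_c I)"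
  shows "\<exists>D. sz D \<le> cert_size p (length (enc_inst I)) \<and> (\<forall>u. verify dx dy g (enc_inst I) D u)"
proof -
  define N where "N = length (enc_inst I)"
  define \<Delta> where "\<Delta> = common_den I"
  \<comment> \<open>A scaled entry is a numerator of at most \<open>N\<close> bits times a cofactor
    of at most \<open>N + 1\<close> bits, so it stays below this power.\<close>
  define M :: nat where "M = 2 ^ (2 * N + 2)"
  let ?B = "witness_bound I M (K I)"
  have le: "n_x I \<le> N" "n_u I \<le> N" "n_y I \<le> N" "m_x I \<le> N" "m_u I \<le> N" "m_y I \<le> N" "bl (bound_R I) \<le> N"
    using inst_dims_le[of I] by (auto simp: N_def)
  note ok = data_ok_inst[OF I, folded \<Delta>_def] and inst = inst_of_inst[OF I]
  have "\<bar>ival (rat_ent e)\<bar> \<le> int M" if "e \<in> set (data_rats (inst_da I))" for e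
  proof -
    have "e \<in> rdat_of \<Delta> ` set (inst_rats I)" using that by (simp add: data_rats_inst \<Delta>_def)
    then obtain r where r: "r \<in> set (inst_rats I)" "e = rdat_of \<Delta> r" by blast
    have "bl (num r * (\<Delta> div den r)) \<le> bl (num r) + bl (\<Delta> div den r)" by (rule bl_mult)
    also have "\<dots> \<le> N + (N + 1)"
      using bl_inst_rats(1)[OF r(1)] bl_common_den[of I] bl_mono[of "\<Delta> div den r" \<Delta>]
      by (simp add: N_def \<Delta>_def)
    finally have "num r * (\<Delta> div den r) < 2 ^ (N + (N + 1))" by (simp only: bl_le_iff)
    also have "\<dots> \<le> M" unfolding M_def by (intro power_increasing) auto
    finally have "int (num r * (\<Delta> div den r)) \<le> int M"
      unfolding of_nat_le_iff by (rule less_imp_le)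
    moreover have "\<bar>ival (rat_ent e)\<bar> = int (num r * (\<Delta> div den r))"
      by (simp add: r(2) rdat_of_def rat_ent_def ival_def)
    ultimately show ?thesis by (simp only:)
  qed
  note sc0 = scaled_inst_of[OF ok this, of "bound_R I"]
  have sc: "scaled_inst \<Delta> M I" using sc0 unfolding inst .
  from small_witness[OF I sc adapt] obtain qx px qy py where
    qx: "0 < qx" "qx \<le> ?B" "dx \<longrightarrow> qx = 1" and px: "length px = n_x I" "\<forall>p\<in>set px. p \<le> ?B"
    and qy: "0 < qy" "qy \<le> ?B" "dy \<longrightarrow> qy = 1" and py: "length py = K I"
      "\<forall>y\<in>set py. length y = n_y I \<and> (\<forall>p\<in>set y. p \<le> ?B \<and> p \<le> bound_R I * qy)"
    and X: "frac_vec qx px \<in> X_c I"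
    and Y: "\<forall>u \<in> U_d I (frac_vec qx px). \<exists>y\<in>set py. frac_vec qy y \<in> Y_c I (frac_vec qx px) u"
    by (elim exE conjE) (rule that)
  define D :: cert where "D = (inst_dm I, (bound_R I, \<Delta>), inst_da I, (qx, px, qy, py))"
  obtain va vb mA mW cB cT where da: "inst_da I = (va, vb, mA, mW, cB, cT)" by (metis surj_pair)
  note ctx = ok[unfolded da inst_dm_def] sc0[unfolded da inst_dm_def]
  have "verify dx dy g (enc_inst I) D u" for u
  proof -
    have "inst_bits (inst_dm I) (bound_R I) (inst_da I) = enc_inst I"
      unfolding inst_of_bits[OF ok, symmetric] inst ..
    moreover have "g (enc_inst I) (enc_nat (length py))" unfolding g[OF I] py(1) ..
    moreover have "x_ok dx (inst_dm I) (bound_R I) (inst_da I) qx px"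
      using x_ok_iff[OF ctx, of dx qx px] qx px(1) X unfolding da[symmetric] inst_dm_def[symmetric] inst by simp
    moreover have "ys_ok dy (inst_dm I) (bound_R I) qy py"
      using qy py(2) by (auto simp: ys_ok_def inst_dm_def list_all_iff)
    moreover have "list_ex (y_ok (inst_dm I) (inst_da I) qx px qy u) py"
      if u: "u_ok (inst_dm I) (bound_R I) (inst_da I) qx px u"
    proof -
      have "qx \<noteq> 0" "length px = length (unary (n_x I))" "qy \<noteq> 0" using qx px qy by simp_all
      note args = this
      have uU: "length u = length (unary (n_u I))" "nat_vec u \<in> U_d I (frac_vec qx px)"
        using u u_ok_iff[OF ctx args(1,2), of u] unfolding da[symmetric] inst_dm_def[symmetric] inst by simp_all
      from Y uU(2) obtain y where y: "y \<in> set py" "frac_vec qy y \<in> Y_c I (frac_vec qx px) (nat_vec u)" by blast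
      have "length y = length (unary (n_y I))" "list_all (\<lambda>p. p \<le> bound_R I * qy) y"
        using py(2) y(1) by (auto simp: list_all_iff)
      from y_ok_iff[OF ctx args this uU(1)] y(2)
      have "y_ok (inst_dm I) (inst_da I) qx px qy u y"
        unfolding da[symmetric] inst_dm_def[symmetric] inst by simp
      with y(1) show ?thesis by (auto simp: list_ex_iff)
    qed
    ultimately show ?thesis unfolding verify_def D_def using ok by simp
  qed
  moreover have "sz D \<le> cert_size p N"
  proof -
    define e where "e = 1 + 6 * entry_bits p N"
    define l where "l = 1 + N * (1 + e)"
    have "bl M \<le> 2 * N + 3" unfolding M_def bl_le_iff by (rule power_strict_increasing) auto
    then have B: "bl ?B \<le> entry_bits p N"
      using le K by (intro bl_witness_bound) (auto simp: N_def)
    have ent: "sz q \<le> e" if "q \<le> ?B" for q :: nat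
      using bl_mono[OF that] B by (simp add: sz_nat e_def)
    have px_sz: "sz px \<le> l" unfolding l_def
      by (rule sz_list_le) (use px le ent in auto)
    have "sz y \<le> l" if "y \<in> set py" for y unfolding l_def
      by (rule sz_list_le) (use py(2) that le ent in auto)
    then have "sz py \<le> 1 + poly p N * (1 + l)"
      by (rule sz_list_le) (use py(1) K in \<open>auto simp: N_def\<close>)
    then have c: "sz (qx, px, qy, py) \<le> 3 + 2 * e + l + (1 + poly p N * (1 + l))"
      using ent[OF qx(2)] ent[OF qy(2)] px_sz by simp
    have dm: "sz (inst_dm I) \<le> 5 + 6 * (1 + 6 * N)"
      using le by (simp add: inst_dm_def sz_unary)
    have R: "sz (bound_R I, \<Delta>) \<le> 1 + (1 + 6 * N) + (7 + 6 * N)"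
      using le bl_common_den[of I] by (simp add: sz_nat \<Delta>_def N_def)
    have D: "sz D = 3 + sz (inst_dm I) + sz (bound_R I, \<Delta>) + sz (inst_da I) + sz (qx, px, qy, py)"
      by (simp add: D_def)
    show ?thesis
      unfolding D cert_size_def Let_def e_def[symmetric] l_def[symmetric]
      by (intro add_mono order_refl dm R c sz_inst_da[OF I N_def[symmetric]])
  qed
  ultimately show ?thesis unfolding N_def by blast
qed

lemma adaptability_in_Sigma2p:
  assumes "polytime_parameter K" "polynomial_parameter K"
  shows "bounded_K_adaptability K (\<lambda>I. if dx then X_d I else X_c I) U_d (\<lambda>I. if dy then Y_d I else Y_c I) \<in> Sigma2p"
proof -
  obtain f where f: "polytime_computable_on (enc_inst ` Collect valid_inst) f"
    "\<And>I. valid_inst I \<Longrightarrow> f (enc_inst I) = enc_nat (K I)"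
    using assms(1) by (auto simp: polytime_parameter_def)
  obtain g where g: "PT (\<lambda>t. g (fst t) (snd t))" "\<forall>w \<in> enc_inst ` Collect valid_inst. \<forall>v. g w v \<longleftrightarrow> v = f w"
    using polytime_computable_on_graph[OF f(1)] by auto
  have gK: "g (enc_inst I) v \<longleftrightarrow> v = enc_nat (K I)" if "valid_inst I" for I v
    using g(2) f(2)[OF that] that by auto
  obtain p where p: "\<And>I. valid_inst I \<Longrightarrow> K I \<le> poly p (length (enc_inst I))"
    using assms(2) by (auto simp: polynomial_parameter_def)
  show ?thesis
  proof (rule Sigma2pI[where V = "verify dx dy g" and g = "cert_size p" and h = "\<lambda>n. 1 + n * (8 + 6 * n)"])
    show "PT (\<lambda>t. verify dx dy g (fst t) (fst (snd t)) (snd (snd t)))" by (rule PT_verify[OF g(1)])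
    show "poly_bounded (cert_size p)" by (rule poly_bounded_cert_size)
    show "poly_bounded (\<lambda>n. 1 + n * (8 + 6 * n))" by (intro pb_intros)
  next
    fix w assume "w \<in> bounded_K_adaptability K (\<lambda>I. if dx then X_d I else X_c I) U_d (\<lambda>I. if dy then Y_d I else Y_c I)"
    then obtain I where w: "w = enc_inst I" "valid_inst I"
      "K_adaptable (K I) (n_y I) (if dx then X_d I else X_c I) (U_d I) (if dy then Y_d I else Y_c I)"
      by (auto simp: bounded_K_adaptability_def)
    show "\<exists>a. sz a \<le> cert_size p (length w) \<and> (\<forall>b. verify dx dy g w a b)"
      unfolding w(1) by (rule verify_complete[where g = g and K = K and p = p, OF gK w(2) p[OF w(2)] w(3)])
  next
    fix w a assume "\<And>b :: nat list. sz b \<le> 1 + length w * (8 + 6 * length w) \<Longrightarrow> verify dx dy g w a b"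
    from verify_sound[where g = g and K = K, OF gK this]
    show "w \<in> bounded_K_adaptability K (\<lambda>I. if dx then X_d I else X_c I) U_d (\<lambda>I. if dy then Y_d I else Y_c I)"
      by (auto simp: bounded_K_adaptability_def)
  qed
qed

theorem theorem20:
  fixes K :: "adapt_inst \<Rightarrow> nat"
    and X :: "adapt_inst \<Rightarrow> real vec set"
    and Y :: "adapt_inst \<Rightarrow> real vec \<Rightarrow> real vec \<Rightarrow> real vec set"
  assumes "polytime_parameter K"
    and "polynomial_parameter K"
    and "X \<in> {X_c, X_d}"
    and "Y \<in> {Y_c, Y_d}"
  shows "bounded_K_adaptability K X U_d Y \<in> Sigma2p"
proof -
  have "X = (\<lambda>I. if X = X_d then X_d I else X_c I)" "Y = (\<lambda>I. if Y = Y_d then Y_d I else Y_c I)"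
    using assms(3,4) by (cases "X = X_d"; cases "Y = Y_d"; simp)+
  then show ?thesis
    using adaptability_in_Sigma2p[OF assms(1,2), of "X = X_d" "Y = Y_d"] by simp
qed

end
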